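(* Let $G$ be a connected Lie group acting freely and properly on $Q$, let $L:TQ\to\mathbb R$ be a $G$-invariant Lagrangian (no regularity is assumed), fix a principal connection on $Q\to Q/G$ and $\mu\in\mathfrak g^*$, and let $M_\mu=TQ\oplus J^{-1}(\mu)$. With the frames and coordinates described in the context (in particular with $\hat E_A=L^B_A\,\partial/\partial\theta^B$), a curve $(x^i(t),\theta^I(t),v^i(t),\hat{\mathrm v}^a(t),p_i(t))$ in $M_\mu/G_\mu$ is a solution of the reduced implicit Lagrange-Routh equations if it satisfies $$\dot x^i=v^i,\qquad \dot\theta^I=\hat{\mathrm v}^JL^I_J-\dot x^i\Lambda^I_i,\qquad \dot p_i=\frac{\partial R^\mu}{\partial x^i}-\Lambda^I_i\frac{\partial R^\mu}{\partial\theta^I}-\mu_aB^a_{ij}\dot x^j,$$ $$p_i=\frac{\partial R^\mu}{\partial v^i},\qquad \frac{\partial R^\mu}{\partial\hat{\mathrm v}^a}=0,$$ where $R^\mu$ is regarded as a function of $(x^i,\theta^I,v^i,\hat{\mathrm v}^a)$ on $TQ/G_\mu$.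
   Context: Summation over repeated indices is used. $J:T^*Q\to\mathfrak g^*$ is the canonical momentum map $\langle J(p_q),\xi\rangle=\langle p_q,\tilde\xi(q)\rangle$, where $\tilde\xi$ is the fundamental vector field of $\xi\in\mathfrak g$. $G_\mu$ is the coadjoint isotropy group of $\mu$, with Lie algebra $\mathfrak g_\mu$; it acts on $M_\mu\subset M=TQ\oplus T^*Q$ by restriction of the lifted (tangent and cotangent) $G$-action. An $\mathrm{Ad}(G_\mu)$-invariant decomposition $\mathfrak g=\mathfrak g_\mu\oplus(\mathfrak g/\mathfrak g_\mu)$ is used, and $\{E_a\}=\{E_A,E_I\}$ is a basis of $\mathfrak g$ with $\{E_A\}$ a basis of $\mathfrak g_\mu$ and $\{E_I\}$ a basis of the complement $\mathfrak g/\mathfrak g_\mu$; $\mu_a=\langle\mu,E_a\rangle$. Indices $a,b$ run over all of $\mathfrak g$, $A,B$ over $\mathfrak g_\mu$, and $I,J$ over the complement. Local frames on $Q$. Over an open set $U\subset Q/G$ with coordinates $x^i$ over which $Q$ is trivial, identify $Q|_U=U\times G$ with action $h\cdot(x,g)=(x,hg)$. $X_i$ is the horizontal lift of $\partial/\partial x^i$ for the chosen principal connection, $\tilde E_a$ is the fundamental vector field of $E_a$, and $\hat E_a(x,g)=\widetilde{(\mathrm{Ad}_gE_a)}(x,g)$, which is a $G$-invariant vertical vector field. The functions $B^a_{ij}$ are defined by $[X_i,X_j]=B^a_{ij}\tilde E_a$. Quasi-velocities of $v_q\in T_qQ$: $v_q=v^iX_i+\tilde{\mathrm v}^a\tilde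 E_a=v^iX_i+\hat{\mathrm v}^a\hat E_a$. For $p_q\in T^*_qQ$, $p_i=\langle p_q,X_i(q)\rangle$. Coordinates. $(\theta^a)=(\theta^A,\theta^I)$ are fiber coordinates such that the fibers of $G\to G/G_\mu$ (the $G_\mu$-orbits in $G$) are given by $\theta^I=$ constant, so that $(x^i,\theta^I)$ are local coordinates on $Q/G_\mu$. The functions $\Lambda^a_i$ are given by $X_i=\partial/\partial x^i-\Lambda_i^a\,\partial/\partial\theta^a$. The functions $L^a_b$ are given by $\hat E_A=L^B_A\,\partial/\partial\theta^B$ and $\hat E_I=L^B_I\,\partial/\partial\theta^B+L^J_I\,\partial/\partial\theta^J$; that is, it is assumed that $L^I_A=0$. The functions $v^i,\hat{\mathrm v}^a,p_i$ are $G$-invariant, so $(x^i,\theta^I,v^i,\hat{\mathrm v}^a,p_i)$ are local coordinates on $M_\mu/G_\mu$ and $(x^i,\theta^I,v^i,\hat{\mathrm v}^a)$ on $TQ/G_\mu$. The generalized Routhian $R^\mu(q,v)=L(q,v)-\mu_a\tilde{\mathrm v}^a$ on $TQ$ is $G_\mu$-invariant, and the induced function on $TQ/G_\mu$ is denoted by the same symbol; $\mu_aB^a_{ij}$ is also $G_\mu$-invariant. Reduced implicit Lagrange-Routh equations. These are the equations on $M_\mu/G_\mu$ to which the following $G_\mu$-invariant system (the implicit Lagrange-Routh equations in invariant form, for curves in $M_\mu$) drops: $$\hat{\mathrm v}^a=\hat{\mathrm u}^a,\quad \hat E^{\rm V}_a(R^\mu)=0,\quad v^i=\dot x^i,\quad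 X_i^{\rm V}(R^\mu)=p_i,\quad \dot p_i=X_i^{\rm C}(R^\mu)-\mu_aB^a_{ij}v^j,$$ where $(\dot x^i,\hat{\mathrm u}^a)$ are the quasi-velocities of $\dot q(t)$ with respect to $\{X_i,\hat E_a\}$, so that $\hat{\mathrm v}^a=\hat{\mathrm u}^a$ is equivalent to $\hat{\mathrm v}^bL^a_b=\dot\theta^a+\dot x^i\Lambda^a_i$ (the components $a=A$ serve as reconstruction equations for $\theta^A$). For a vector field $X=X^\alpha\partial/\partial q^\alpha$ on $Q$ the complete and vertical lifts to $TQ$ are $X^{\rm C}=X^\beta\frac{\partial}{\partial q^\beta}+\frac{\partial X^\beta}{\partial q^\gamma}v^\gamma\frac{\partial}{\partial v^\beta}$, $X^{\rm V}=X^\beta\frac{\partial}{\partial v^\beta}$. *)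

theory Defs
  imports "HOL-Analysis.Analysis" "HOL-Algebra.Group_Action"
begin

section \<open>Smooth manifolds\<close>

primrec Ck_on :: "nat \<Rightarrow> ('a::real_normed_vector \<Rightarrow> 'b::real_normed_vector) \<Rightarrow> 'a set \<Rightarrow> bool" where
  "Ck_on 0 f S \<longleftrightarrow> continuous_on S f"
| "Ck_on (Suc k) f S \<longleftrightarrow> (\<forall>y\<in>S. f differentiable (at y)) \<and>
     (\<forall>e. Ck_on k (\<lambda>y. frechet_derivative f (at y) e) S)"

text \<open>Smoothness on a subset that need not be open: locally, \<open>f\<close> extends to a smooth function
  on an open set. This is needed because charts may take values in a proper linear subspace of the
  model space.\<close>

definition smooth_on :: "('a::real_normed_vector \<Rightarrow> 'b::real_normed_vector) \<Rightarrow> 'a set \<Rightarrow> bool" where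
  "smooth_on f S \<longleftrightarrow> (\<forall>y\<in>S. \<exists>T F. open T \<and> y \<in> T \<and> (\<forall>k. Ck_on k F T) \<and> (\<forall>z\<in>S \<inter> T. F z = f z))"

type_synonym ('p, 'e) chart = "'p set \<times> ('p \<Rightarrow> 'e)"
type_synonym ('p, 'e) atlas = "('p, 'e) chart set"

abbreviation cdom :: "('p, 'e) chart \<Rightarrow> 'p set" where "cdom c \<equiv> fst c"
abbreviation cmap :: "('p, 'e) chart \<Rightarrow> 'p \<Rightarrow> 'e" where "cmap c \<equiv> snd c"
abbreviation cinv :: "('p, 'e) chart \<Rightarrow> 'e \<Rightarrow> 'p" where "cinv c \<equiv> inv_into (cdom c) (cmap c)"

definition is_chart :: "'e::euclidean_space set \<Rightarrow> ('p::topological_space, 'e) chart \<Rightarrow> bool" where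
  "is_chart V c \<longleftrightarrow> open (cdom c) \<and> openin (top_of_set V) (cmap c ` cdom c) \<and>
     inj_on (cmap c) (cdom c) \<and> homeomorphism (cdom c) (cmap c ` cdom c) (cmap c) (cinv c)"

definition compatible :: "('p, 'e::euclidean_space) chart \<Rightarrow> ('p, 'e) chart \<Rightarrow> bool" where
  "compatible c d \<longleftrightarrow> smooth_on (cmap d \<circ> cinv c) (cmap c ` (cdom c \<inter> cdom d)) \<and>
     smooth_on (cmap c \<circ> cinv d) (cmap d ` (cdom c \<inter> cdom d))"

text \<open>A smooth manifold modelled on the linear subspace \<open>V\<close>, with \<open>A\<close> its maximal atlas. The
  dimension is that of \<open>V\<close>, so it may be \<open>0\<close>.\<close>

definition manifold ::
  "'e::euclidean_space set \<Rightarrow> ('p::{t2_space, second_countable_topology}, 'e) atlas \<Rightarrow> bool" where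
  "manifold V A \<longleftrightarrow> subspace V \<and> (\<Union>c\<in>A. cdom c) = UNIV \<and>
     (\<forall>c. c \<in> A \<longleftrightarrow> is_chart V c \<and> (\<forall>d\<in>A. compatible c d))"

definition chart_at :: "('p, 'e) atlas \<Rightarrow> 'p \<Rightarrow> ('p, 'e) chart" where
  "chart_at A p = (SOME c. c \<in> A \<and> p \<in> cdom c)"

definition smooth_into ::
  "('r::topological_space, 'e::euclidean_space) atlas \<Rightarrow> 'f::real_normed_vector set \<Rightarrow> ('f \<Rightarrow> 'r) \<Rightarrow> bool" where
  "smooth_into B S f \<longleftrightarrow> continuous_on S f \<and>
     (\<forall>d\<in>B. smooth_on (cmap d \<circ> f) {y \<in> S. f y \<in> cdom d})"

definition smooth_map ::
  "('p, 'e::euclidean_space) atlas \<Rightarrow> ('r::topological_space, 'f::euclidean_space) atlas \<Rightarrow> ('p \<Rightarrow> 'r) \<Rightarrow> bool" where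
  "smooth_map A B f \<longleftrightarrow> (\<forall>c\<in>A. smooth_into B (cmap c ` cdom c) (f \<circ> cinv c))"

definition smooth_map2 ::
  "('p, 'e::euclidean_space) atlas \<Rightarrow> ('s, 'h::euclidean_space) atlas \<Rightarrow>
   ('r::topological_space, 'f::euclidean_space) atlas \<Rightarrow> ('p \<Rightarrow> 's \<Rightarrow> 'r) \<Rightarrow> bool" where
  "smooth_map2 A A' B f \<longleftrightarrow> (\<forall>c\<in>A. \<forall>c'\<in>A'.
     smooth_into B ((cmap c ` cdom c) \<times> (cmap c' ` cdom c')) (\<lambda>(y, z). f (cinv c y) (cinv c' z)))"


section \<open>Tangent vectors\<close>

text \<open>A tangent vector at \<open>p\<close> is the family of its components in all the charts around \<open>p\<close>, subject
  to the transformation law; at the other charts the family is \<open>0\<close>.\<close>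

type_synonym ('p, 'e) tvec = "('p, 'e) chart \<Rightarrow> 'e"

definition trans_deriv ::
  "('p, 'e::euclidean_space) chart \<Rightarrow> ('p, 'e) chart \<Rightarrow> 'p \<Rightarrow> 'e \<Rightarrow> 'e" where
  "trans_deriv c d p =
     frechet_derivative (cmap d \<circ> cinv c) (at (cmap c p) within cmap c ` (cdom c \<inter> cdom d))"

definition tspace :: "'e::euclidean_space set \<Rightarrow> ('p, 'e) atlas \<Rightarrow> 'p \<Rightarrow> ('p, 'e) tvec set" where
  "tspace V A p = {w. (\<forall>c. c \<notin> A \<or> p \<notin> cdom c \<longrightarrow> w c = 0) \<and>
     (\<forall>c\<in>A. p \<in> cdom c \<longrightarrow> w c \<in> V \<and> (\<forall>d\<in>A. p \<in> cdom d \<longrightarrow> w d = trans_deriv c d p (w c)))}"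

definition coord_vec ::
  "('p, 'e::euclidean_space) atlas \<Rightarrow> ('p, 'e) chart \<Rightarrow> 'p \<Rightarrow> 'e \<Rightarrow> ('p, 'e) tvec" where
  "coord_vec A c p e = (\<lambda>d. if d \<in> A \<and> p \<in> cdom d then trans_deriv c d p e else 0)"

definition tangent_map ::
  "('p, 'e::euclidean_space) atlas \<Rightarrow> ('r, 'f::euclidean_space) atlas \<Rightarrow> ('p \<Rightarrow> 'r) \<Rightarrow> 'p \<Rightarrow>
   ('p, 'e) tvec \<Rightarrow> ('r, 'f) tvec" where
  "tangent_map A B f p w = (\<lambda>d. if d \<in> B \<and> f p \<in> cdom d then
     (let c = chart_at A p in
        frechet_derivative (cmap d \<circ> f \<circ> cinv c)
          (at (cmap c p) within cmap c ` {r \<in> cdom c. f r \<in> cdom d}) (w c)) else 0)"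

definition differential ::
  "('p, 'e::euclidean_space) atlas \<Rightarrow> ('p \<Rightarrow> 'f::real_normed_vector) \<Rightarrow> 'p \<Rightarrow> ('p, 'e) tvec \<Rightarrow> 'f" where
  "differential A f p w = (let c = chart_at A p in
     frechet_derivative (f \<circ> cinv c) (at (cmap c p) within cmap c ` cdom c) (w c))"

definition velocity :: "('p, 'e::euclidean_space) atlas \<Rightarrow> (real \<Rightarrow> 'p) \<Rightarrow> real \<Rightarrow> ('p, 'e) tvec" where
  "velocity A \<sigma> t =
     (\<lambda>c. if c \<in> A \<and> \<sigma> t \<in> cdom c then vector_derivative (cmap c \<circ> \<sigma>) (at t) else 0)"

definition lcomb2 :: "real \<Rightarrow> ('p, 'e::real_vector) tvec \<Rightarrow> real \<Rightarrow> ('p, 'e) tvec \<Rightarrow> ('p, 'e) tvec" where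
  "lcomb2 a u b w = (\<lambda>c. a *\<^sub>R u c + b *\<^sub>R w c)"

definition lcomb :: "real ^ 'm \<Rightarrow> ('m::finite \<Rightarrow> ('p, 'e::real_vector) tvec) \<Rightarrow> ('p, 'e) tvec" where
  "lcomb r F = (\<lambda>c. \<Sum>\<alpha>\<in>UNIV. (r $ \<alpha>) *\<^sub>R F \<alpha> c)"

definition functional_on :: "('p, 'e::real_vector) tvec set \<Rightarrow> (('p, 'e) tvec \<Rightarrow> real) \<Rightarrow> bool" where
  "functional_on S f \<longleftrightarrow>
     (\<forall>u\<in>S. \<forall>w\<in>S. \<forall>a b. f (lcomb2 a u b w) = a * f u + b * f w) \<and> (\<forall>w. w \<notin> S \<longrightarrow> f w = 0)"

definition coord_space :: "'m::finite set \<Rightarrow> (real ^ 'm) set" where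
  "coord_space D = {y. \<forall>\<alpha>. \<alpha> \<notin> D \<longrightarrow> y $ \<alpha> = 0}"

definition is_basis ::
  "'m::finite set \<Rightarrow> ('m \<Rightarrow> ('p, 'e::real_vector) tvec) \<Rightarrow> ('p, 'e) tvec set \<Rightarrow> bool" where
  "is_basis D F S \<longleftrightarrow> (\<forall>\<alpha>\<in>D. F \<alpha> \<in> S) \<and> (\<forall>w\<in>S. \<exists>!r. r \<in> coord_space D \<and> w = lcomb r F)"

text \<open>Components of a tangent vector with respect to a frame.\<close>

definition comps :: "('m::finite \<Rightarrow> ('p, 'e::real_vector) tvec) \<Rightarrow> ('p, 'e) tvec \<Rightarrow> real ^ 'm" where
  "comps F w = (THE r. w = lcomb r F)"


section \<open>Lie brackets, complete and vertical lifts\<close>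

text \<open>In this section manifolds are modelled on the whole Euclidean space, so that derivatives at a
  point suffice. The operations are given by their usual coordinate formulas.\<close>

definition field_rep :: "('p \<Rightarrow> ('p, 'e) tvec) \<Rightarrow> ('p, 'e) chart \<Rightarrow> 'e \<Rightarrow> 'e" where
  "field_rep X c = (\<lambda>y. X (cinv c y) c)"

definition lie_bracket ::
  "('p, 'e::euclidean_space) atlas \<Rightarrow> ('p \<Rightarrow> ('p, 'e) tvec) \<Rightarrow> ('p \<Rightarrow> ('p, 'e) tvec) \<Rightarrow>
   'p \<Rightarrow> ('p, 'e) tvec" where
  "lie_bracket A X Y q = (\<lambda>c. if c \<in> A \<and> q \<in> cdom c then
      frechet_derivative (field_rep Y c) (at (cmap c q)) (X q c) -
      frechet_derivative (field_rep X c) (at (cmap c q)) (Y q c) else 0)"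

definition bundle_rep ::
  "('p, 'e::euclidean_space) atlas \<Rightarrow> ('p \<Rightarrow> ('p, 'e) tvec \<Rightarrow> 'b) \<Rightarrow> ('p, 'e) chart \<Rightarrow> 'e \<times> 'e \<Rightarrow> 'b" where
  "bundle_rep A F c = (\<lambda>(y, e). F (cinv c y) (coord_vec A c (cinv c y) e))"

text \<open>The directions below are the components of the complete lift,
  \<open>(X\<^sup>\<beta>, \<partial>X\<^sup>\<beta>/\<partial>q\<^sup>\<gamma> v\<^sup>\<gamma>)\<close>, and of the vertical lift, \<open>(0, X\<^sup>\<beta>)\<close>, in induced coordinates on
  the tangent bundle; the values do not depend on the chart.\<close>

definition complete_lift ::
  "('p, 'e::euclidean_space) atlas \<Rightarrow> ('p \<Rightarrow> ('p, 'e) tvec) \<Rightarrow> ('p \<Rightarrow> ('p, 'e) tvec \<Rightarrow> real) \<Rightarrow>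
   'p \<Rightarrow> ('p, 'e) tvec \<Rightarrow> real" where
  "complete_lift A X F q v = (let c = chart_at A q in
     frechet_derivative (bundle_rep A F c) (at (cmap c q, v c))
       (X q c, frechet_derivative (field_rep X c) (at (cmap c q)) (v c)))"

definition vertical_lift ::
  "('p, 'e::euclidean_space) atlas \<Rightarrow> ('p \<Rightarrow> ('p, 'e) tvec) \<Rightarrow> ('p \<Rightarrow> ('p, 'e) tvec \<Rightarrow> real) \<Rightarrow>
   'p \<Rightarrow> ('p, 'e) tvec \<Rightarrow> real" where
  "vertical_lift A X F q v = (let c = chart_at A q in
     frechet_derivative (bundle_rep A F c) (at (cmap c q, v c)) (0, X q c))"


section \<open>Lie groups and actions\<close>

definition lie_group ::
  "'e::euclidean_space set \<Rightarrow> 'g::{t2_space, second_countable_topology} monoid \<Rightarrow> ('g, 'e) atlas \<Rightarrow> bool" where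
  "lie_group V G A \<longleftrightarrow> group G \<and> carrier G = UNIV \<and> manifold V A \<and>
     smooth_map2 A A A (\<lambda>g h. g \<otimes>\<^bsub>G\<^esub> h) \<and> smooth_map A A (\<lambda>g. inv\<^bsub>G\<^esub> g)"

definition Ad :: "'g monoid \<Rightarrow> ('g, 'e::euclidean_space) atlas \<Rightarrow> 'g \<Rightarrow> ('g, 'e) tvec \<Rightarrow> ('g, 'e) tvec" where
  "Ad G A g = tangent_map A A (\<lambda>h. g \<otimes>\<^bsub>G\<^esub> h \<otimes>\<^bsub>G\<^esub> inv\<^bsub>G\<^esub> g) \<one>\<^bsub>G\<^esub>"

text \<open>The Lie algebra of a closed subgroup \<open>H\<close>: initial velocities of the one-parameter subgroups
  that stay in \<open>H\<close>.\<close>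

definition subgroup_algebra ::
  "'g::topological_space monoid \<Rightarrow> ('g, 'e::euclidean_space) atlas \<Rightarrow> 'g set \<Rightarrow> ('g, 'e) tvec set" where
  "subgroup_algebra G A H = {velocity A \<sigma> 0 | \<sigma>.
     (\<forall>s t. \<sigma> (s + t) = \<sigma> s \<otimes>\<^bsub>G\<^esub> \<sigma> t) \<and> smooth_into A UNIV \<sigma> \<and> range \<sigma> \<subseteq> H}"

definition smooth_action ::
  "'g::topological_space monoid \<Rightarrow> ('g, 'e::euclidean_space) atlas \<Rightarrow>
   ('q::topological_space, 'f::euclidean_space) atlas \<Rightarrow> ('g \<Rightarrow> 'q \<Rightarrow> 'q) \<Rightarrow> bool" where
  "smooth_action G A B \<phi> \<longleftrightarrow> group_action G UNIV \<phi> \<and> smooth_map2 A B B \<phi>"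

definition free_action :: "'g monoid \<Rightarrow> ('g \<Rightarrow> 'q \<Rightarrow> 'q) \<Rightarrow> bool" where
  "free_action G \<phi> \<longleftrightarrow> (\<forall>q. stabilizer G \<phi> q = {\<one>\<^bsub>G\<^esub>})"

definition proper_action :: "('g::topological_space \<Rightarrow> 'q::topological_space \<Rightarrow> 'q) \<Rightarrow> bool" where
  "proper_action \<phi> \<longleftrightarrow> proper_map euclidean euclidean (\<lambda>(h, q). (\<phi> h q, q))"

definition fund ::
  "'g monoid \<Rightarrow> ('g, 'e::euclidean_space) atlas \<Rightarrow> ('q, 'f::euclidean_space) atlas \<Rightarrow>
   ('g \<Rightarrow> 'q \<Rightarrow> 'q) \<Rightarrow> ('g, 'e) tvec \<Rightarrow> 'q \<Rightarrow> ('q, 'f) tvec" where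
  "fund G A B \<phi> \<xi> q = tangent_map A B (\<lambda>h. \<phi> h q) \<one>\<^bsub>G\<^esub> \<xi>"


section \<open>The data of Routh reduction\<close>

text \<open>All coordinates and frame components are indexed by one finite type \<open>'m\<close>, which is the
  disjoint union of three (possibly empty) sets: \<open>iN\<close> for the indices \<open>i, j\<close> on \<open>Q/G\<close>, \<open>iA\<close> for the
  indices of the isotropy algebra and \<open>iI\<close> for those of the complement. The manifold \<open>Q\<close> is modelled
  on \<open>real ^ 'm\<close>, and \<open>G\<close> on the subspace of the vectors supported on \<open>iA \<union> iI\<close>.\<close>

record ('g, 'q, 'm) routh_data =
  Gr :: "'g monoid"
  atG :: "('g, real ^ 'm::finite) atlas"
  atQ :: "('q, real ^ 'm) atlas"
  act :: "'g \<Rightarrow> 'q \<Rightarrow> 'q"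
  Lag :: "'q \<Rightarrow> ('q, real ^ 'm) tvec \<Rightarrow> real"
  conn :: "'q \<Rightarrow> ('q, real ^ 'm) tvec \<Rightarrow> ('g, real ^ 'm) tvec"
  mu :: "('g, real ^ 'm) tvec \<Rightarrow> real"
  iN :: "'m set"
  iA :: "'m set"
  iI :: "'m set"
  bas :: "'m \<Rightarrow> ('g, real ^ 'm) tvec"  \<comment> \<open>\<open>E\<^sub>a\<close>; only used for \<open>a \<in> iA \<union> iI\<close>\<close>
  baseU :: "'q set set"  \<comment> \<open>the open set \<open>U\<close> of orbits\<close>
  xorb :: "'q set \<Rightarrow> real ^ 'm"  \<comment> \<open>the coordinates \<open>x\<^sup>i\<close> on \<open>U\<close>, supported on \<open>iN\<close>\<close>
  grp :: "'q \<Rightarrow> 'g"  \<comment> \<open>the component in \<open>G\<close> of the trivialization over \<open>U\<close>\<close>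
  thG :: "('g, real ^ 'm) chart"  \<comment> \<open>the chart \<open>(\<theta>\<^sup>a)\<close> of \<open>G\<close>\<close>

definition iK :: "('g, 'q, 'm::finite) routh_data \<Rightarrow> 'm set" where
  "iK D = iA D \<union> iI D"

definition lieG :: "('g, 'q, 'm::finite) routh_data \<Rightarrow> ('g, real ^ 'm) tvec set" where
  "lieG D = tspace (coord_space (iK D)) (atG D) \<one>\<^bsub>Gr D\<^esub>"

definition TQ :: "('g, 'q, 'm::finite) routh_data \<Rightarrow> 'q \<Rightarrow> ('q, real ^ 'm) tvec set" where
  "TQ D q = tspace UNIV (atQ D) q"

abbreviation AdG :: "('g, 'q, 'm::finite) routh_data \<Rightarrow> 'g \<Rightarrow> ('g, real ^ 'm) tvec \<Rightarrow> ('g, real ^ 'm) tvec" where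
  "AdG D \<equiv> Ad (Gr D) (atG D)"

abbreviation fundQ :: "('g, 'q, 'm::finite) routh_data \<Rightarrow> ('g, real ^ 'm) tvec \<Rightarrow> 'q \<Rightarrow> ('q, real ^ 'm) tvec" where
  "fundQ D \<equiv> fund (Gr D) (atG D) (atQ D) (act D)"

definition actT :: "('g, 'q, 'm::finite) routh_data \<Rightarrow> 'g \<Rightarrow> 'q \<Rightarrow> ('q, real ^ 'm) tvec \<Rightarrow> ('q, real ^ 'm) tvec" where
  "actT D h q = tangent_map (atQ D) (atQ D) (act D h) q"

definition Gmu :: "('g, 'q, 'm::finite) routh_data \<Rightarrow> 'g set" where
  "Gmu D = {h. \<forall>\<xi>\<in>lieG D. mu D (AdG D h \<xi>) = mu D \<xi>}"

definition lieGmu :: "('g::topological_space, 'q, 'm::finite) routh_data \<Rightarrow> ('g, real ^ 'm) tvec set" where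
  "lieGmu D = subgroup_algebra (Gr D) (atG D) (Gmu D)"

definition compl :: "('g, 'q, 'm::finite) routh_data \<Rightarrow> ('g, real ^ 'm) tvec set" where
  "compl D = {lcomb r (bas D) | r. r \<in> coord_space (iI D)}"

definition smooth_lagrangian :: "('g, 'q::topological_space, 'm::finite) routh_data \<Rightarrow> bool" where
  "smooth_lagrangian D \<longleftrightarrow>
     (\<forall>c\<in>atQ D. smooth_on (bundle_rep (atQ D) (Lag D) c) ((cmap c ` cdom c) \<times> UNIV))"

definition invariant_lagrangian :: "('g, 'q, 'm::finite) routh_data \<Rightarrow> bool" where
  "invariant_lagrangian D \<longleftrightarrow>
     (\<forall>h q. \<forall>v\<in>TQ D q. Lag D (act D h q) (actT D h q v) = Lag D q v)"

definition principal_connection :: "('g, 'q, 'm::finite) routh_data \<Rightarrow> bool" where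
  "principal_connection D \<longleftrightarrow>
     (\<forall>q. \<forall>u\<in>TQ D q. conn D q u \<in> lieG D) \<and>
     (\<forall>q. \<forall>u\<in>TQ D q. \<forall>w\<in>TQ D q. \<forall>a b.
        conn D q (lcomb2 a u b w) = lcomb2 a (conn D q u) b (conn D q w)) \<and>
     (\<forall>q. \<forall>\<xi>\<in>lieG D. conn D q (fundQ D \<xi> q) = \<xi>) \<and>
     (\<forall>h q. \<forall>u\<in>TQ D q. conn D (act D h q) (actT D h q u) = AdG D h (conn D q u)) \<and>
     (\<forall>c\<in>atQ D. \<forall>d\<in>atG D. \<one>\<^bsub>Gr D\<^esub> \<in> cdom d \<longrightarrow>
        (\<forall>e. smooth_on (\<lambda>y. conn D (cinv c y) (coord_vec (atQ D) c (cinv c y) e) d) (cmap c ` cdom c)))"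

definition adapted_basis :: "('g::topological_space, 'q, 'm::finite) routh_data \<Rightarrow> bool" where
  "adapted_basis D \<longleftrightarrow> is_basis (iK D) (bas D) (lieG D) \<and> is_basis (iA D) (bas D) (lieGmu D) \<and>
     (\<forall>h\<in>Gmu D. AdG D h ` compl D \<subseteq> compl D)"

definition QU :: "('g, 'q, 'm::finite) routh_data \<Rightarrow> 'q set" where
  "QU D = {q. orbit (Gr D) (act D) q \<in> baseU D}"

definition xco :: "('g, 'q, 'm::finite) routh_data \<Rightarrow> 'q \<Rightarrow> real ^ 'm" where
  "xco D q = xorb D (orbit (Gr D) (act D) q)"

definition prodchart :: "('g, 'q, 'm::finite) routh_data \<Rightarrow> ('g, real ^ 'm) chart \<Rightarrow> ('q, real ^ 'm) chart" where
  "prodchart D d = ({q \<in> QU D. grp D q \<in> cdom d}, \<lambda>q. xco D q + cmap d (grp D q))"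

text \<open>\<open>(x, grp)\<close> identifies \<open>QU\<close> equivariantly with \<open>x(U) \<times> G\<close>, where \<open>G\<close> acts by left
  translations. That this is a diffeomorphism is expressed by the fact that each chart of \<open>G\<close> gives,
  together with \<open>x\<close>, a chart of \<open>Q\<close>. (As \<open>x\<close> and the charts of \<open>G\<close> have disjoint supports, the sum
  in \<open>prodchart\<close> is the juxtaposition of coordinates.)\<close>

definition trivialized :: "('g, 'q::topological_space, 'm::finite) routh_data \<Rightarrow> bool" where
  "trivialized D \<longleftrightarrow> baseU D \<subseteq> orbits (Gr D) UNIV (act D) \<and> open (QU D) \<and>
     xorb D ` baseU D \<subseteq> coord_space (iN D) \<and>
     (\<forall>h. \<forall>q\<in>QU D. grp D (act D h q) = h \<otimes>\<^bsub>Gr D\<^esub> grp D q) \<and>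
     (\<forall>d\<in>atG D. prodchart D d \<in> atQ D)"

abbreviation xth :: "('g, 'q, 'm::finite) routh_data \<Rightarrow> ('q, real ^ 'm) chart" where
  "xth D \<equiv> prodchart D (thG D)"

text \<open>The \<open>G\<^sub>\<mu>\<close>-orbits (for left translations) in \<open>G\<close> are given by \<open>\<theta>\<^sup>I = constant\<close>.\<close>

definition fibre_chart :: "('g, 'q, 'm::finite) routh_data \<Rightarrow> bool" where
  "fibre_chart D \<longleftrightarrow> thG D \<in> atG D \<and>
     (\<forall>g\<in>cdom (thG D). \<forall>g'\<in>cdom (thG D).
        (\<forall>I\<in>iI D. cmap (thG D) g $ I = cmap (thG D) g' $ I) \<longleftrightarrow> (\<exists>h\<in>Gmu D. g' = h \<otimes>\<^bsub>Gr D\<^esub> g))"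

definition Xh :: "('g, 'q, 'm::finite) routh_data \<Rightarrow> 'm \<Rightarrow> 'q \<Rightarrow> ('q, real ^ 'm) tvec" where
  "Xh D i q = (THE w. w \<in> TQ D q \<and> conn D q w = (\<lambda>c. 0) \<and> differential (atQ D) (xco D) q w = axis i 1)"

definition Etilde :: "('g, 'q, 'm::finite) routh_data \<Rightarrow> 'm \<Rightarrow> 'q \<Rightarrow> ('q, real ^ 'm) tvec" where
  "Etilde D a q = fundQ D (bas D a) q"

definition Ehat :: "('g, 'q, 'm::finite) routh_data \<Rightarrow> 'm \<Rightarrow> 'q \<Rightarrow> ('q, real ^ 'm) tvec" where
  "Ehat D a q = fundQ D (AdG D (grp D q) (bas D a)) q"

definition frame_tilde :: "('g, 'q, 'm::finite) routh_data \<Rightarrow> 'q \<Rightarrow> 'm \<Rightarrow> ('q, real ^ 'm) tvec" where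
  "frame_tilde D q = (\<lambda>\<alpha>. if \<alpha> \<in> iN D then Xh D \<alpha> q else Etilde D \<alpha> q)"

definition frame_hat :: "('g, 'q, 'm::finite) routh_data \<Rightarrow> 'q \<Rightarrow> 'm \<Rightarrow> ('q, real ^ 'm) tvec" where
  "frame_hat D q = (\<lambda>\<alpha>. if \<alpha> \<in> iN D then Xh D \<alpha> q else Ehat D \<alpha> q)"

definition Bcoef :: "('g, 'q, 'm::finite) routh_data \<Rightarrow> 'm \<Rightarrow> 'm \<Rightarrow> 'm \<Rightarrow> 'q \<Rightarrow> real" where
  "Bcoef D a i j q = comps (frame_tilde D q) (lie_bracket (atQ D) (Xh D i) (Xh D j) q) $ a"

definition muB :: "('g, 'q, 'm::finite) routh_data \<Rightarrow> 'm \<Rightarrow> 'm \<Rightarrow> 'q \<Rightarrow> real" where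
  "muB D i j q = (\<Sum>a\<in>iK D. mu D (bas D a) * Bcoef D a i j q)"

text \<open>The functions \<open>\<Lambda>\<^sup>a\<^sub>i\<close> and \<open>L\<^sup>b\<^sub>a\<close>, from the components of \<open>X\<^sub>i\<close> and \<open>\<hat>E\<^sub>a\<close> in the
  chart \<open>(x\<^sup>i, \<theta>\<^sup>a)\<close>.\<close>

definition Lam :: "('g, 'q, 'm::finite) routh_data \<Rightarrow> 'm \<Rightarrow> 'm \<Rightarrow> 'q \<Rightarrow> real" where
  "Lam D a i q = - (Xh D i q (xth D) $ a)"

definition Lco :: "('g, 'q, 'm::finite) routh_data \<Rightarrow> 'm \<Rightarrow> 'm \<Rightarrow> 'q \<Rightarrow> real" where
  "Lco D b a q = Ehat D a q (xth D) $ b"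

definition routhian :: "('g, 'q, 'm::finite) routh_data \<Rightarrow> 'q \<Rightarrow> ('q, real ^ 'm) tvec \<Rightarrow> real" where
  "routhian D q v = Lag D q v - (\<Sum>a\<in>iK D. mu D (bas D a) * comps (frame_tilde D q) v $ a)"


section \<open>The equations on \<open>M\<^sub>\<mu>\<close> and on its quotient\<close>

definition momentum :: "('g, 'q, 'm::finite) routh_data \<Rightarrow> 'q \<Rightarrow> (('q, real ^ 'm) tvec \<Rightarrow> real) \<Rightarrow>
    ('g, real ^ 'm) tvec \<Rightarrow> real" where
  "momentum D q p \<xi> = p (fundQ D \<xi> q)"

definition Mmu :: "('g, 'q, 'm::finite) routh_data \<Rightarrow>
    ('q \<times> ('q, real ^ 'm) tvec \<times> (('q, real ^ 'm) tvec \<Rightarrow> real)) set" where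
  "Mmu D = {(q, v, p). v \<in> TQ D q \<and> functional_on (TQ D q) p \<and>
     (\<forall>\<xi>\<in>lieG D. momentum D q p \<xi> = mu D \<xi>)}"

definition differentiable_curve :: "('g, 'q::topological_space, 'm::finite) routh_data \<Rightarrow> (real \<Rightarrow> 'q) \<Rightarrow>
    (real \<Rightarrow> ('q, real ^ 'm) tvec) \<Rightarrow> (real \<Rightarrow> ('q, real ^ 'm) tvec \<Rightarrow> real) \<Rightarrow> real \<Rightarrow> bool" where
  "differentiable_curve D q v p t \<longleftrightarrow> isCont q t \<and>
     (\<exists>c\<in>atQ D. q t \<in> cdom c \<and> (cmap c \<circ> q) differentiable (at t) \<and>
        (\<lambda>s. v s c) differentiable (at t) \<and>
        (\<forall>e. (\<lambda>s. p s (coord_vec (atQ D) c (q s) e)) differentiable (at t)))"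

text \<open>The implicit Lagrange-Routh equations for a curve in \<open>M\<^sub>\<mu>\<close>, on an open set \<open>T\<close> of times.\<close>

definition implicit_LR :: "('g, 'q::topological_space, 'm::finite) routh_data \<Rightarrow> real set \<Rightarrow> (real \<Rightarrow> 'q) \<Rightarrow>
    (real \<Rightarrow> ('q, real ^ 'm) tvec) \<Rightarrow> (real \<Rightarrow> ('q, real ^ 'm) tvec \<Rightarrow> real) \<Rightarrow> bool" where
  "implicit_LR D T q v p \<longleftrightarrow> (\<forall>t\<in>T.
     q t \<in> QU D \<and> (q t, v t, p t) \<in> Mmu D \<and> differentiable_curve D q v p t \<and>
     (\<forall>a\<in>iK D. comps (frame_hat D (q t)) (v t) $ a =
                comps (frame_hat D (q t)) (velocity (atQ D) q t) $ a) \<and>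
     (\<forall>a\<in>iK D. vertical_lift (atQ D) (Ehat D a) (routhian D) (q t) (v t) = 0) \<and>
     (\<forall>i\<in>iN D. comps (frame_hat D (q t)) (v t) $ i =
                comps (frame_hat D (q t)) (velocity (atQ D) q t) $ i) \<and>
     (\<forall>i\<in>iN D. vertical_lift (atQ D) (Xh D i) (routhian D) (q t) (v t) = p t (Xh D i (q t))) \<and>
     (\<forall>i\<in>iN D. ((\<lambda>s. p s (Xh D i (q s))) has_real_derivative
         complete_lift (atQ D) (Xh D i) (routhian D) (q t) (v t)
         - (\<Sum>j\<in>iN D. muB D i j (q t) * comps (frame_hat D (q t)) (v t) $ j)) (at t)))"

text \<open>The point of \<open>Q/G\<^sub>\<mu>\<close> below \<open>q\<close> has coordinates \<open>(y, \<eta>) = (x\<^sup>i, \<theta>\<^sup>I)\<close>; here \<open>y\<close> is supported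
  on \<open>iN\<close> and \<open>\<eta>\<close> on \<open>iI\<close>.\<close>

definition over :: "('g, 'q, 'm::finite) routh_data \<Rightarrow> real ^ 'm \<Rightarrow> real ^ 'm \<Rightarrow> 'q \<Rightarrow> bool" where
  "over D y \<eta> q \<longleftrightarrow> q \<in> cdom (xth D) \<and> xco D q = y \<and>
     (\<chi> I. if I \<in> iI D then cmap (thG D) (grp D q) $ I else 0) = \<eta>"

definition patch :: "('g, 'q, 'm::finite) routh_data \<Rightarrow> ((real ^ 'm) \<times> (real ^ 'm)) set" where
  "patch D = {(y, \<eta>). \<exists>q. over D y \<eta> q}"

text \<open>The point of \<open>M\<^sub>\<mu>/G\<^sub>\<mu>\<close> below \<open>(q, v, p)\<close> has coordinates
  \<open>(x\<^sup>i, \<theta>\<^sup>I, v\<^sup>i, \<hat>v\<^sup>a, p\<^sub>i)\<close> given by \<open>y\<close>, \<open>\<eta>\<close>, \<open>u\<close>, \<open>w\<close> and \<open>\<pi>\<close>.\<close>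

definition projects :: "('g, 'q, 'm::finite) routh_data \<Rightarrow> 'q \<Rightarrow> ('q, real ^ 'm) tvec \<Rightarrow>
    (('q, real ^ 'm) tvec \<Rightarrow> real) \<Rightarrow> real ^ 'm \<Rightarrow> real ^ 'm \<Rightarrow> real ^ 'm \<Rightarrow> real ^ 'm \<Rightarrow> real ^ 'm \<Rightarrow> bool" where
  "projects D q v p y \<eta> u w \<pi> \<longleftrightarrow> over D y \<eta> q \<and>
     (\<forall>i\<in>iN D. comps (frame_hat D q) v $ i = u $ i) \<and>
     (\<forall>a\<in>iK D. comps (frame_hat D q) v $ a = w $ a) \<and>
     (\<forall>i\<in>iN D. p (Xh D i q) = \<pi> $ i)"

text \<open>A curve in \<open>M\<^sub>\<mu>/G\<^sub>\<mu>\<close> solves the reduced equations if it is, locally in time, the projection of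
  a solution in \<open>M\<^sub>\<mu>\<close>. (Being a solution is a local property; only short time intervals are asked
  for since the reconstruction of \<open>\<theta>\<^sup>A\<close> may leave the coordinate domain.)\<close>

definition reduced_implicit_LR :: "('g, 'q::topological_space, 'm::finite) routh_data \<Rightarrow> real set \<Rightarrow>
    (real \<Rightarrow> real ^ 'm) \<Rightarrow> (real \<Rightarrow> real ^ 'm) \<Rightarrow> (real \<Rightarrow> real ^ 'm) \<Rightarrow> (real \<Rightarrow> real ^ 'm) \<Rightarrow>
    (real \<Rightarrow> real ^ 'm) \<Rightarrow> bool" where
  "reduced_implicit_LR D T x \<theta> v vh p \<longleftrightarrow> (\<forall>t0\<in>T. \<exists>T0 qc vc pc.
     open T0 \<and> t0 \<in> T0 \<and> T0 \<subseteq> T \<and> implicit_LR D T0 qc vc pc \<and>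
     (\<forall>t\<in>T0. projects D (qc t) (vc t) (pc t) (x t) (\<theta> t) (v t) (vh t) (p t)))"


section \<open>Induced functions in coordinates on the quotients\<close>

text \<open>A \<open>G\<^sub>\<mu>\<close>-invariant function on \<open>Q\<close> (or on \<open>TQ\<close>) induces a function of \<open>(x\<^sup>i, \<theta>\<^sup>I)\<close>
  (and \<open>v\<^sup>i, \<hat>v\<^sup>a\<close>), computed at any representative.\<close>

definition repr :: "('g, 'q, 'm::finite) routh_data \<Rightarrow> real ^ 'm \<Rightarrow> real ^ 'm \<Rightarrow> 'q" where
  "repr D y \<eta> = (SOME q. over D y \<eta> q)"

definition induced :: "('g, 'q, 'm::finite) routh_data \<Rightarrow> ('q \<Rightarrow> real) \<Rightarrow> real ^ 'm \<Rightarrow> real ^ 'm \<Rightarrow> real" where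
  "induced D f y \<eta> = f (repr D y \<eta>)"

definition red_routhian ::
  "('g, 'q, 'm::finite) routh_data \<Rightarrow> real ^ 'm \<Rightarrow> real ^ 'm \<Rightarrow> real ^ 'm \<Rightarrow> real ^ 'm \<Rightarrow> real" where
  "red_routhian D y \<eta> u w =
     routhian D (repr D y \<eta>) (lcomb (u + w) (frame_hat D (repr D y \<eta>)))"

definition pdiff :: "'m::finite \<Rightarrow> (real ^ 'm \<Rightarrow> real) \<Rightarrow> real ^ 'm \<Rightarrow> real" where
  "pdiff \<alpha> f y = deriv (\<lambda>s. f (y + s *\<^sub>R axis \<alpha> 1)) 0"

end

theory Submission
  imports Defs
begin

text \<open>A curve in \<open>M\<^sub>\<mu>/G\<^sub>\<mu>\<close> is lifted by solving the ordinary differential equation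
  \<open>d\<theta>\<^sup>A/dt = \<hat>v\<^sup>b L\<^sup>A\<^sub>b - v\<^sup>i \<Lambda>\<^sup>A\<^sub>i\<close> and by reading the other components of the lift off the
  frame \<open>{X\<^sub>i, \<hat>E\<^sub>a}\<close>. Since \<open>G\<^sub>\<mu>\<close> preserves this frame, the Routhian in quasi-velocities and the
  coefficients of the reduced equations may be evaluated at the lift instead of at a chosen
  representative. The velocity of the lift is then its own fibre component, and the algebraic
  equations are those for the vertical lifts. The complete lift of \<open>X\<^sub>i\<close> differs from the derivative
  along \<open>X\<^sub>i\<close> at constant quasi-velocities by the vertical lift of a vertical vector, which
  annihilates the Routhian along a solution.\<close>

section \<open>Functions of class \<open>C\<^sup>1\<close> and \<open>C\<^sup>2\<close>\<close>

text \<open>Two derivatives suffice. Charts, the action and the group multiplication are used as C^2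
  maps; the frame fields contain one derivative of them at the group identity and are therefore C^1,
  which is enough for a locally Lipschitz equation, for brackets and for complete lifts. The
  obstacle is that the data are full of choices. Tangent vectors are families over all charts, the
  lifts compute in \<open>chart_at\<close>, functions on the quotient are evaluated at a point
  picked by \<open>SOME\<close>, and the charts of the group may take values in a proper subspace,
  where derivatives are taken within a thin set. Everything is therefore transported to derivatives
  at a point in arbitrary charts. Over the trivialization a tangent vector is determined by two
  linear data, its x-components and its connection form, and identities between tangent vectors are
  checked on these. The momentum constraint holds by construction: the covector of the lift is
  \<open>mu\<close> of the connection form plus p_i dx^i. That the fields of the isotropy algebra
  have no \<theta>^I-component is what keeps their quasi-velocities out of the equation for
  \<theta>^I.\<close>

definition C1_on :: "('a::euclidean_space \<Rightarrow> 'b::real_normed_vector) \<Rightarrow> 'a set \<Rightarrow> bool" where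
  "C1_on f S \<longleftrightarrow> (\<exists>f'. (\<forall>y\<in>S. (f has_derivative f' y) (at y)) \<and> (\<forall>e. continuous_on S (\<lambda>y. f' y e)))"

definition C2_on :: "('a::euclidean_space \<Rightarrow> 'b::real_normed_vector) \<Rightarrow> 'a set \<Rightarrow> bool" where
  "C2_on f S \<longleftrightarrow> (\<exists>f'. (\<forall>y\<in>S. (f has_derivative f' y) (at y)) \<and> (\<forall>e. C1_on (\<lambda>y. f' y e) S))"

lemma C1_on_differentiable: "C1_on f S \<Longrightarrow> y \<in> S \<Longrightarrow> f differentiable (at y)"
  unfolding C1_on_def differentiable_def by blast

lemma C2_on_differentiable: "C2_on f S \<Longrightarrow> y \<in> S \<Longrightarrow> f differentiable (at y)"
  unfolding C2_on_def differentiable_def by blast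

lemma C1_on_continuous: "C1_on f S \<Longrightarrow> continuous_on S f"
  by (meson C1_on_differentiable continuous_at_imp_continuous_on differentiable_imp_continuous_within)

lemma C1_on_subset: "C1_on f S \<Longrightarrow> T \<subseteq> S \<Longrightarrow> C1_on f T"
  unfolding C1_on_def by (meson continuous_on_subset subsetD)

lemma C1_on_cong: assumes "open S" "\<And>y. y \<in> S \<Longrightarrow> f y = g y" "C1_on f S" shows "C1_on g S"
proof -
  have "(g has_derivative f') (at y)" if "y \<in> S" "(f has_derivative f') (at y)" for y f'
    using has_derivative_transform_within_open[OF that(2) assms(1) that(1)] assms(2) by simp
  then show ?thesis using assms(3) unfolding C1_on_def by metis
qed

lemma C2_on_cong: assumes "open S" "\<And>y. y \<in> S \<Longrightarrow> f y = g y" "C2_on f S" shows "C2_on g S"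
proof -
  have "(g has_derivative f') (at y)" if "y \<in> S" "(f has_derivative f') (at y)" for y f'
    using has_derivative_transform_within_open[OF that(2) assms(1) that(1)] assms(2) by simp
  then show ?thesis using assms(3) unfolding C2_on_def by metis
qed

lemma C1_on_linear: "bounded_linear f \<Longrightarrow> C1_on f S"
  unfolding C1_on_def by (rule exI[of _ "\<lambda>y. f"]) (auto simp: bounded_linear_imp_has_derivative)

lemma C1_on_const: "C1_on (\<lambda>y. c) S"
  unfolding C1_on_def by (rule exI[of _ "\<lambda>y e. 0"]) auto

lemma C1_on_add: assumes "C1_on f S" "C1_on g S" shows "C1_on (\<lambda>y. f y + g y) S"
proof -
  obtain f' g' where "\<forall>y\<in>S. (f has_derivative f' y) (at y)" "\<forall>e. continuous_on S (\<lambda>y. f' y e)"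
    "\<forall>y\<in>S. (g has_derivative g' y) (at y)" "\<forall>e. continuous_on S (\<lambda>y. g' y e)"
    using assms unfolding C1_on_def by auto
  then show ?thesis unfolding C1_on_def
    by (intro exI[of _ "\<lambda>y e. f' y e + g' y e"]) (auto intro!: derivative_eq_intros continuous_intros)
qed

lemma C1_on_sum: "(\<And>i. i \<in> I \<Longrightarrow> C1_on (f i) S) \<Longrightarrow> C1_on (\<lambda>y. \<Sum>i\<in>I. f i y) S"
  by (induction I rule: infinite_finite_induct) (auto simp: C1_on_const intro: C1_on_add)

lemma C1_on_scaleR:
  fixes f :: "'a::euclidean_space \<Rightarrow> real"
  assumes "C1_on f S" "C1_on g S" shows "C1_on (\<lambda>y. f y *\<^sub>R g y) S"
proof -
  obtain f' g' where "\<forall>y\<in>S. (f has_derivative f' y) (at y)" "\<forall>e. continuous_on S (\<lambda>y. f' y e)"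
    "\<forall>y\<in>S. (g has_derivative g' y) (at y)" "\<forall>e. continuous_on S (\<lambda>y. g' y e)"
    using assms unfolding C1_on_def by auto
  then show ?thesis unfolding C1_on_def
    using C1_on_continuous[OF assms(1)] C1_on_continuous[OF assms(2)]
    by (intro exI[of _ "\<lambda>y e. f y *\<^sub>R g' y e + f' y e *\<^sub>R g y"])
      (auto intro!: has_derivative_scaleR continuous_intros)
qed

text \<open>Derivatives are controlled here one fixed direction at a time. Expanding over the basis
  turns a direction that varies with the point into scalar coefficients, so that continuity and
  product rules apply.\<close>

lemma linear_sum_Basis:
  assumes "linear f" shows "f e = (\<Sum>b\<in>Basis. (e \<bullet> b) *\<^sub>R f b)"
proof -
  have "f (\<Sum>b\<in>Basis. (e \<bullet> b) *\<^sub>R b) = (\<Sum>b\<in>Basis. (e \<bullet> b) *\<^sub>R f b)"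
    by (simp add: linear_sum[OF assms] linear_scale[OF assms])
  then show ?thesis by (simp add: euclidean_representation)
qed

lemma C1_on_compose:
  fixes f :: "'a::euclidean_space \<Rightarrow> 'b::euclidean_space"
  assumes "C1_on g T" "C1_on f S" "f ` S \<subseteq> T" shows "C1_on (\<lambda>y. g (f y)) S"
proof -
  obtain f' where f: "\<And>y. y\<in>S \<Longrightarrow> (f has_derivative f' y) (at y)" "\<And>e. continuous_on S (\<lambda>y. f' y e)"
    using assms(2) unfolding C1_on_def by blast
  obtain g' where g: "\<And>y. y\<in>T \<Longrightarrow> (g has_derivative g' y) (at y)" "\<And>e. continuous_on T (\<lambda>y. g' y e)"
    using assms(1) unfolding C1_on_def by blast
  have d: "((\<lambda>y. g (f y)) has_derivative (\<lambda>e. g' (f y) (f' y e))) (at y)" if "y \<in> S" for y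
    using diff_chain_at[OF f(1)[OF that] g(1)] assms(3) that by (auto simp: o_def)
  have "continuous_on S (\<lambda>y. \<Sum>b\<in>Basis. (f' y e \<bullet> b) *\<^sub>R g' (f y) b)" for e
    by (intro continuous_intros f(2) continuous_on_compose2[OF g(2) C1_on_continuous[OF assms(2)]]
        assms(3))
  then have "continuous_on S (\<lambda>y. g' (f y) (f' y e))" for e
  proof (rule continuous_on_eq)
    fix y assume "y \<in> S"
    then have "linear (g' (f y))" using g(1) assms(3) has_derivative_linear by blast
    from linear_sum_Basis[OF this, of "f' y e"]
    show "(\<Sum>b\<in>Basis. (f' y e \<bullet> b) *\<^sub>R g' (f y) b) = g' (f y) (f' y e)" by simp
  qed
  with d show ?thesis unfolding C1_on_def by (intro exI[of _ "\<lambda>y e. g' (f y) (f' y e)"]) auto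
qed

text \<open>For an affine inner map the direction \<open>h e\<close> does not depend on the point,
  so the chain rule involves no second derivative of the inner map.\<close>

lemma C2_on_compose_affine:
  fixes h :: "'a::euclidean_space \<Rightarrow> 'b::euclidean_space"
  assumes "C2_on g T" "bounded_linear h" "(\<lambda>y. a + h y) ` S \<subseteq> T" shows "C2_on (\<lambda>y. g (a + h y)) S"
proof -
  obtain g' where g: "\<And>y. y\<in>T \<Longrightarrow> (g has_derivative g' y) (at y)" "\<And>e. C1_on (\<lambda>y. g' y e) T"
    using assms unfolding C2_on_def by auto
  have h: "((\<lambda>y. a + h y) has_derivative h) (at y)" for y
    using has_derivative_add[OF has_derivative_const bounded_linear_imp_has_derivative[OF assms(2)], of
        a] by simp
  have d: "((\<lambda>y. g (a + h y)) has_derivative (\<lambda>e. g' (a + h y) (h e))) (at y)" if "y \<in> S" for y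
    using diff_chain_at[OF h g(1)] assms(3) that by (auto simp: o_def)
  then show ?thesis unfolding C2_on_def
    using C1_on_compose[OF g(2) C1_on_add[OF C1_on_const C1_on_linear[OF assms(2)]] assms(3)]
    by (intro exI[of _ "\<lambda>y e. g' (a + h y) (h e)"]) auto
qed

lemma C2_on_compose_linear:
  fixes h :: "'a::euclidean_space \<Rightarrow> 'b::euclidean_space"
  assumes "C2_on g T" "bounded_linear h" "h ` S \<subseteq> T" shows "C2_on (\<lambda>y. g (h y)) S"
  using C2_on_compose_affine[OF assms(1,2), of 0 S] assms(3) by simp

lemma C2_on_frechet_derivative:
  assumes "C2_on f S" "open S" shows "C1_on (\<lambda>y. frechet_derivative f (at y) e) S"
proof -
  obtain f' where f: "\<And>y. y\<in>S \<Longrightarrow> (f has_derivative f' y) (at y)" "\<And>e. C1_on (\<lambda>y. f' y e) S"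
    using assms unfolding C2_on_def by auto
  then have "f' y e = frechet_derivative f (at y) e" if "y \<in> S" for y
    using frechet_derivative_at that by metis
  then show ?thesis by (rule C1_on_cong[OF assms(2) _ f(2)[of e]])
qed

text \<open>The first variable is differentiated at a fixed point and the result is regarded as a
  function of the second. With the group identity as that point, this is how the derivative of an
  orbit map and the left-invariant fields come to depend on the base point in a C^1 way.\<close>

lemma C2_on_partial:
  fixes f :: "'a::euclidean_space \<times> 'b::euclidean_space \<Rightarrow> 'c::real_normed_vector"
  assumes f: "C2_on f U" "open U"
  shows "C1_on (\<lambda>z. frechet_derivative (\<lambda>w. f (w, z)) (at w0) e) {z. (w0, z) \<in> U}"
proof -
  let ?j = "\<lambda>z. (w0, z)" and ?V = "{z. (w0, z) \<in> U}"
  have V: "open ?V" using open_vimage[OF f(2), of ?j] by (simp add: vimage_def continuous_intros)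
  have eq: "frechet_derivative f (at (w0, z)) (e, 0) = frechet_derivative (\<lambda>w. f (w, z)) (at w0) e"
    if "(w0, z) \<in> U" for z
  proof -
    have 1: "((\<lambda>w. (w, z)) has_derivative (\<lambda>e. (e, 0))) (at w0)"
      by (rule has_derivative_Pair[OF has_derivative_ident has_derivative_const])
    have 2: "(f has_derivative frechet_derivative f (at (w0, z))) (at (w0, z))"
      using C2_on_differentiable[OF f(1) that] unfolding frechet_derivative_works .
    from frechet_derivative_at[OF has_derivative_compose[OF 1 2]] show ?thesis by metis
  qed
  have j: "C1_on ?j ?V"
    using C1_on_add[OF C1_on_const C1_on_linear[OF bounded_linear_Pair[OF bounded_linear_zero
        bounded_linear_ident]],
        of "(w0, 0)" ?V] by simp
  show ?thesis
    by (rule C1_on_cong[OF V _ C1_on_compose[OF C2_on_frechet_derivative[OF f, of "(e, 0)"] j]]) (auto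
        simp: eq)
qed

text \<open>The local witnesses need not be chosen coherently: each is forced to agree with the
  Frechet derivative, which then serves as the global witness.\<close>

lemma C1_on_local:
  assumes "open S" "\<And>x. x \<in> S \<Longrightarrow> \<exists>T. open T \<and> x \<in> T \<and> C1_on f T"
  shows "C1_on f S"
proof -
  have "isCont (\<lambda>y. frechet_derivative f (at y) e) x \<and> f differentiable (at x)" if x: "x \<in> S" for x e
  proof -
    obtain T f' where T: "open T" "x \<in> T" "\<forall>y\<in>T. (f has_derivative f' y) (at y)" "\<forall>e. continuous_on T
        (\<lambda>y. f' y e)"
      using assms(2)[OF x] unfolding C1_on_def by blast
    have "frechet_derivative f (at y) e = f' y e" if "y \<in> T" for y
      using frechet_derivative_at[OF bspec[OF T(3) that]] by simp
    then have "continuous_on T (\<lambda>y. frechet_derivative f (at y) e)"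
      using T(4) by (simp cong: continuous_on_cong)
    moreover have "f differentiable (at x)" using T(2,3) by (intro differentiableI) (rule bspec)
    ultimately show ?thesis using T(1,2) by (simp add: continuous_on_eq_continuous_at)
  qed
  then show ?thesis unfolding C1_on_def
    by (intro exI[of _ "\<lambda>y. frechet_derivative f (at y)"])
      (auto simp: continuous_on_eq_continuous_at[OF assms(1)] frechet_derivative_works[symmetric])
qed

lemma Ck_on_imp_C2_on:
  fixes f :: "'a::euclidean_space \<Rightarrow> 'b::real_normed_vector"
  assumes "\<And>k. Ck_on k f S" shows "C2_on f S"
proof -
  have 1: "Ck_on 1 (\<lambda>y. frechet_derivative f (at y) e) S" and 0: "\<And>y. y \<in> S \<Longrightarrow> f differentiable (at y)"
      for e
    using assms[of 2] by (simp_all add: numeral_2_eq_2)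
  have "C1_on (\<lambda>y. frechet_derivative f (at y) e) S" for e
    using 1[of e] unfolding C1_on_def
    by (auto simp: frechet_derivative_works
        intro!: exI[of _ "\<lambda>z. frechet_derivative (\<lambda>y. frechet_derivative f (at y) e) (at z)"])
  then show ?thesis unfolding C2_on_def using 0
    by (auto simp: frechet_derivative_works intro!: exI[of _ "\<lambda>y. frechet_derivative f (at y)"])
qed

text \<open>The sum of the norms of the derivatives along the basis is continuous, hence bounded on
  a compact ball, and it dominates the operator norm; the mean value inequality on the convex ball
  gives the Lipschitz bound.\<close>

lemma C1_on_imp_lipschitz_nhd:
  assumes "C1_on f S" "open S" "x \<in> S"
  obtains r B where "r > 0" "cball x r \<subseteq> S" "B \<ge> 0"
    "\<And>y z. y \<in> cball x r \<Longrightarrow> z \<in> cball x r \<Longrightarrow> norm (f y - f z) \<le> B * norm (y - z)"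
proof -
  obtain f' where f: "\<And>y. y\<in>S \<Longrightarrow> (f has_derivative f' y) (at y)" "\<And>e. continuous_on S (\<lambda>y. f' y e)"
    using assms unfolding C1_on_def by auto
  obtain r where r: "r > 0" "cball x r \<subseteq> S" using assms open_contains_cball by blast
  define N where "N = (\<lambda>y. \<Sum>b\<in>Basis. norm (f' y b))"
  have "continuous_on (cball x r) N" unfolding N_def
    by (intro continuous_intros continuous_on_subset[OF f(2) r(2)])
  then have "bounded (N ` cball x r)" by (simp add: compact_continuous_image compact_imp_bounded)
  then obtain B where B: "\<And>y. y \<in> cball x r \<Longrightarrow> \<bar>N y\<bar> \<le> B"
    unfolding bounded_iff real_norm_def by (meson imageI)
  have N: "onorm (f' y) \<le> B" if "y \<in> cball x r" for y
    using onorm_componentwise[OF has_derivative_bounded_linear[OF f(1)]] B[OF that] r(2) that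
    unfolding N_def by fastforce
  have "B \<ge> 0" using B[of x] r by force
  moreover have "norm (f y - f z) \<le> B * norm (y - z)" if "y \<in> cball x r" "z \<in> cball x r" for y z
    by (rule differentiable_bound[OF convex_cball _ N that])
      (use f(1) r(2) has_derivative_at_withinI in blast)
  ultimately show ?thesis using that r by blast
qed

text \<open>The second difference is compared with the second derivative by the mean value theorem; since
  it is symmetric in the two directions, so is the limit.\<close>

lemma symmetric_second_frechet_derivative:
  fixes f :: "'a::real_normed_vector \<Rightarrow> 'b::real_normed_vector"
  assumes "open S" "x \<in> S" and f: "\<And>y. y \<in> S \<Longrightarrow> (f has_derivative f' y) (at y)"
    and fa: "((\<lambda>y. f' y a) has_derivative fa) (at x)" and fb: "((\<lambda>y. f' y b) has_derivative fb) (at x)"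
  shows "fa b = fb a"
proof -
  define D where "D = (\<lambda>a b s. f (x + s *\<^sub>R a + s *\<^sub>R b) - f (x + s *\<^sub>R a) - f (x + s *\<^sub>R b) + f x)"
  have key: "\<exists>d>0. \<forall>s. 0 < s \<and> s < d \<longrightarrow> norm (D a b s - (s * s) *\<^sub>R fa b) \<le> e * (s * s)"
    if "e > 0" and fa: "((\<lambda>y. f' y a) has_derivative fa) (at x)" for e a b fa
  proof -
    \<comment> \<open>A displacement along \<open>a\<close> and \<open>b\<close> with parameters in
      \<open>{0..s}\<close> has norm at most \<open>s * K\<close>; the summand 1 keeps
      \<open>K\<close> positive if both vectors vanish. The factor 2 in \<open>e'\<close> pays for
      the two values of \<open>f'\<close> compared below.\<close>
    define K where "K = norm a + norm b + 1"
    have K: "K > 0" using norm_ge_zero[of a] norm_ge_zero[of b] unfolding K_def by linarith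
    define e' where "e' = e / (2 * K)"
    have "e' > 0" using K \<open>e > 0\<close> by (simp add: e'_def)
    then obtain d1 where d1: "d1 > 0" "\<And>y. norm (y - x) < d1 \<Longrightarrow> norm (f' y a - f' x a - fa (y - x)) \<le> e'
        * norm (y - x)"
      using fa unfolding has_derivative_at_alt by blast
    obtain d2 where d2: "d2 > 0" "ball x d2 \<subseteq> S" using assms open_contains_ball by blast
    define d where "d = min d1 d2 / K"
    have "norm (D a b s - (s * s) *\<^sub>R fa b) \<le> e * (s * s)" if s: "0 < s" "s < d" for s
    proof -
      have sK: "s * K < d1" "s * K < d2" using s K by (auto simp: d_def pos_less_divide_eq)
      have small: "norm (u *\<^sub>R b + t *\<^sub>R a) \<le> s * K" if "t \<in> {0..s}" "u \<in> {0..s}" for t u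
      proof -
        have "norm (u *\<^sub>R b + t *\<^sub>R a) \<le> u * norm b + t * norm a"
          using norm_triangle_ineq[of "u *\<^sub>R b" "t *\<^sub>R a"] that by auto
        also have "\<dots> \<le> s * norm b + s * norm a" using that by (intro add_mono mult_right_mono) auto
        also have "\<dots> \<le> s * K" using s by (simp add: K_def algebra_simps)
        finally show ?thesis .
      qed
      \<comment> \<open>The difference of \<open>f\<close> between two opposite sides of the
        parallelogram, corrected by its expected linear growth. Thus \<open>g s - g 0\<close> is the
        error of the second difference, while the derivative of \<open>g\<close> is estimated by the
        differentiability of \<open>f'\<close> at \<open>x\<close>.\<close>
      define g where "g = (\<lambda>t. f (x + s *\<^sub>R b + t *\<^sub>R a) - f (x + t *\<^sub>R a) - (t * s) *\<^sub>R fa b)"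
      define g' where "g' = (\<lambda>t u. u *\<^sub>R (f' (x + s *\<^sub>R b + t *\<^sub>R a) a - f' (x + t *\<^sub>R a) a - s *\<^sub>R fa
          b))"
      have lin: "linear fa" using fa has_derivative_linear by blast
      have inS: "x + u *\<^sub>R b + t *\<^sub>R a \<in> S" if "t \<in> {0..s}" "u \<in> {0..s}" for t u
      proof -
        have "norm ((x + u *\<^sub>R b + t *\<^sub>R a) - x) < d2" using small[OF that] sK by (simp add: add.assoc)
        then have "dist x (x + u *\<^sub>R b + t *\<^sub>R a) < d2" by (simp only: dist_norm norm_minus_commute)
        then show ?thesis using d2 by auto
      qed
      have der: "(g has_derivative g' t) (at t within {0..s})" if t: "t \<in> {0..s}" for t
      proof -
        have 1: "((\<lambda>t. f (x + u *\<^sub>R b + t *\<^sub>R a)) has_derivative (\<lambda>v. f' (x + u *\<^sub>R b + t *\<^sub>R a) (v *\<^sub>R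
            a))) (at t within {0..s})"
          if "u \<in> {0..s}" for u
        proof -
          have "((\<lambda>t. x + u *\<^sub>R b + t *\<^sub>R a) has_derivative (\<lambda>v. v *\<^sub>R a)) (at t within {0..s})"
            by (auto intro!: derivative_eq_intros)
          from has_derivative_compose[OF this f[OF inS[OF t that]]] show ?thesis .
        qed
        have l: "linear (f' (x + u *\<^sub>R b + t *\<^sub>R a))" if "u \<in> {0..s}" for u
          using f[OF inS[OF t that]] has_derivative_linear by blast
        have 2: "((\<lambda>t. (t * s) *\<^sub>R fa b) has_derivative (\<lambda>v. (v * s) *\<^sub>R fa b)) (at t within {0..s})"
          by (auto intro!: derivative_eq_intros)
        have "g' t = (\<lambda>v. f' (x + s *\<^sub>R b + t *\<^sub>R a) (v *\<^sub>R a) - f' (x + 0 *\<^sub>R b + t *\<^sub>R a) (v *\<^sub>R a) -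
            (v * s) *\<^sub>R fa b)"
          using l[of s] l[of 0] s by (simp add: g'_def linear_scale algebra_simps)
        then show ?thesis unfolding g_def
          using has_derivative_diff[OF has_derivative_diff[OF 1[of s] 1[of 0]] 2] s by simp
      qed
      have bound: "onorm (g' t) \<le> e * s" if t: "t \<in> {0..s}" for t
      proof -
        have st: "s \<in> {0..s}" "0 \<in> {0..s}" using s by auto
        have A: "norm (f' (x + u *\<^sub>R b + t *\<^sub>R a) a - f' x a - fa (u *\<^sub>R b + t *\<^sub>R a)) \<le> e' * (s * K)"
            if "u \<in> {0..s}" for u
        proof -
          have "norm (u *\<^sub>R b + t *\<^sub>R a) < d1" using small[OF t that] sK by linarith
          then have "norm (f' (x + u *\<^sub>R b + t *\<^sub>R a) a - f' x a - fa (u *\<^sub>R b + t *\<^sub>R a)) \<le> e' * norm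
              (u *\<^sub>R b + t *\<^sub>R a)"
            using d1(2)[of "x + u *\<^sub>R b + t *\<^sub>R a"] by (simp add: add.assoc)
          also have "\<dots> \<le> e' * (s * K)" using small[OF t that] \<open>e' > 0\<close> by (intro mult_left_mono) auto
          finally show ?thesis .
        qed
        have "f' (x + s *\<^sub>R b + t *\<^sub>R a) a - f' (x + t *\<^sub>R a) a - s *\<^sub>R fa b
           = (f' (x + s *\<^sub>R b + t *\<^sub>R a) a - f' x a - fa (s *\<^sub>R b + t *\<^sub>R a))
           - (f' (x + 0 *\<^sub>R b + t *\<^sub>R a) a - f' x a - fa (0 *\<^sub>R b + t *\<^sub>R a))"
          by (simp add: linear_add[OF lin] linear_scale[OF lin])
        then have "norm (f' (x + s *\<^sub>R b + t *\<^sub>R a) a - f' (x + t *\<^sub>R a) a - s *\<^sub>R fa b) \<le> e' * (s * K)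
            + e' * (s * K)"
          using order_trans[OF norm_triangle_ineq4 add_mono[OF A[OF st(1)] A[OF st(2)]]] by (simp only:)
        also have "\<dots> = e * s" using K by (simp add: e'_def)
        finally show ?thesis unfolding g'_def
          by (intro onorm_le) (simp add: mult.commute mult_left_mono)
      qed
      have "norm (g s - g 0) \<le> e * s * norm (s - 0)"
        by (rule differentiable_bound[OF _ der bound]) (use s in auto)
      moreover have "g s - g 0 = D a b s - (s * s) *\<^sub>R fa b" by (simp add: g_def D_def algebra_simps)
      ultimately show ?thesis using s by (simp add: mult.assoc)
    qed
    moreover have "d > 0" using d1 d2 K by (simp add: d_def)
    ultimately show ?thesis by blast
  qed
  have "norm (fa b - fb a) \<le> e" if "e > 0" for e
  proof -
    have "e / 2 > 0" using that by simp
    obtain d1 where d1: "d1 > 0" "\<And>s. 0 < s \<and> s < d1 \<Longrightarrow> norm (D a b s - (s * s) *\<^sub>R fa b) \<le> (e/2) * (s *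
        s)"
      using key[OF \<open>e / 2 > 0\<close> fa] by blast
    obtain d2 where d2: "d2 > 0" "\<And>s. 0 < s \<and> s < d2 \<Longrightarrow> norm (D b a s - (s * s) *\<^sub>R fb a) \<le> (e/2) * (s *
        s)"
      using key[OF \<open>e / 2 > 0\<close> fb] by blast
    define s where "s = min d1 d2 / 2"
    have s: "0 < s" "s < d1" "s < d2" using d1(1) d2(1) by (auto simp: s_def)
    have "D a b s = D b a s" by (simp add: D_def algebra_simps)
    then have "(s * s) *\<^sub>R (fa b - fb a) = (D b a s - (s * s) *\<^sub>R fb a) - (D a b s - (s * s) *\<^sub>R fa b)"
      by (simp add: algebra_simps)
    then have "norm ((s * s) *\<^sub>R (fa b - fb a)) \<le> e * (s * s)"
      using d1(2)[of s] d2(2)[of s] s norm_triangle_ineq4[of "D b a s - (s * s) *\<^sub>R fb a" "D a b s - (s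
          * s) *\<^sub>R fa b"]
      by simp
    then show ?thesis using s by (simp add: mult.commute)
  qed
  then have "norm (fa b - fb a) \<le> 0" by (rule field_le_epsilon[of _ 0, simplified])
  then show ?thesis by simp
qed

lemma C2_on_imp_C1_on: assumes "C2_on f S" shows "C1_on f S"
proof -
  obtain f' where f: "\<forall>y\<in>S. (f has_derivative f' y) (at y)" "\<forall>e. C1_on (\<lambda>y. f' y e) S"
    using assms unfolding C2_on_def by (elim exE conjE)
  show ?thesis unfolding C1_on_def
    by (rule exI[of _ f'], intro conjI f(1) allI C1_on_continuous f(2)[rule_format])
qed

lemma C1_on_diff: assumes "C1_on f S" "C1_on g S" shows "C1_on (\<lambda>y. f y - g y) S"
  using C1_on_add[OF assms(1) C1_on_scaleR[OF C1_on_const assms(2)], of "-1"] by simp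

lemma C1_on_inner:
  fixes f :: "'a::euclidean_space \<Rightarrow> 'b::euclidean_space"
  assumes "C1_on f S" shows "C1_on (\<lambda>y. f y \<bullet> b) S"
  by (rule C1_on_compose[OF C1_on_linear[OF bounded_linear_inner_left] assms subset_UNIV])

lemma smooth_on_imp_C1_on: assumes f: "smooth_on f S" and S: "open S" shows "C1_on f S"
proof (rule C1_on_local[OF S])
  fix x assume "x \<in> S"
  from bspec[OF f[unfolded smooth_on_def] this] obtain T F where
    T: "open T" "x \<in> T" "\<forall>k. Ck_on k F T" "\<forall>z\<in>S \<inter> T. F z = f z" by (elim exE conjE)
  have "C1_on F (S \<inter> T)"
    by (rule C1_on_subset[OF C2_on_imp_C1_on[OF Ck_on_imp_C2_on[OF T(3)[rule_format]]]]) simp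
  then have "C1_on f (S \<inter> T)"
    by (rule C1_on_cong[OF open_Int[OF S T(1)], rotated]) (use T(4) in blast)
  then show "\<exists>T. open T \<and> x \<in> T \<and> C1_on f T" using S T(1,2) \<open>x \<in> S\<close>
      by (intro exI[of _ "S \<inter> T"]) (simp add: open_Int)
qed

section \<open>Ordinary differential equations\<close>

text \<open>The contraction principle is applied to bounded continuous functions on the whole line,
  among which those with values in the ball form a closed set. Only a short interval matters:
  outside it the integral operator is frozen at its end values by the clamping map
  \<open>cl\<close>.\<close>

theorem picard_lindelof:
  fixes f :: "real \<Rightarrow> 'a::euclidean_space \<Rightarrow> 'a"
  assumes a: "a > 0" and r: "r > 0"
    and cont: "continuous_on ({t0 - a..t0 + a} \<times> cball x0 r) (\<lambda>(t, x). f t x)"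
    and lip: "\<And>t x y. \<lbrakk>t \<in> {t0 - a..t0 + a}; x \<in> cball x0 r; y \<in> cball x0 r\<rbrakk> \<Longrightarrow>
      norm (f t x - f t y) \<le> B * norm (x - y)"
  obtains d z where "0 < d" "d \<le> a" "z t0 = x0"
    "\<And>t. t \<in> {t0 - d<..<t0 + d} \<Longrightarrow> z t \<in> cball x0 r \<and> (z has_vector_derivative f t (z t)) (at t)"
proof -
  have "bounded ((\<lambda>(t, x). f t x) ` ({t0 - a..t0 + a} \<times> cball x0 r))"
    by (intro compact_imp_bounded compact_continuous_image cont compact_Times) auto
  then obtain M0 where M0: "\<And>t x. t \<in> {t0 - a..t0 + a} \<Longrightarrow> x \<in> cball x0 r \<Longrightarrow> norm (f t x) \<le> M0"
    unfolding bounded_iff by fastforce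
  define M where "M = \<bar>M0\<bar> + 1"
  have M: "M > 0" "\<And>t x. t \<in> {t0 - a..t0 + a} \<Longrightarrow> x \<in> cball x0 r \<Longrightarrow> norm (f t x) \<le> M"
    using M0 by (auto simp: M_def intro: order_trans[OF M0] )
  \<comment> \<open>The three bounds keep the times in the given interval, keep the integral curve
    in the ball (\<open>M * d \<le> r\<close>), and make the operator a contraction with factor 1/2.
    As \<open>B\<close> has no sign, \<open>\<bar>B\<bar> + 1\<close> guards the division.\<close>
  define d where "d = min a (min (r / M) (1 / (2 * (\<bar>B\<bar> + 1))))"
  have d: "d > 0" "d \<le> a" using a r M by (auto simp: d_def)
  have "d \<le> r / M" by (simp add: d_def)
  then have dM: "M * d \<le> r" using M by (simp add: pos_le_divide_eq mult.commute)
  have "d \<le> 1 / (2 * (\<bar>B\<bar> + 1))" by (simp add: d_def)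
  then have "d * (2 * (\<bar>B\<bar> + 1)) \<le> 1" by (subst (asm) pos_le_divide_eq) auto
  then have dB: "\<bar>B\<bar> * d \<le> 1 / 2" using d(1) by (simp add: algebra_simps)
  define I where "I = {t0 - d..t0 + d}"
  have I: "t \<in> {t0 - a..t0 + a}" "\<bar>t - t0\<bar> \<le> d" if "t \<in> I" for t using that d by (auto simp: I_def)
  have t0I: "t0 \<in> I" using d by (auto simp: I_def)
  define S where "S = PiC (UNIV :: real set) (\<lambda>_. cball x0 r)"
  have S: "apply_bcontfun g s \<in> cball x0 r" if "g \<in> S" for g s
    using that by (auto simp: S_def mem_PiC_iff)
  define h where "h = (\<lambda>g s. f s (apply_bcontfun g s))"
  have hc: "continuous_on I (h g)" if "g \<in> S" for g
  proof -
    have "continuous_on I (\<lambda>s. (\<lambda>(t, x). f t x) (s, apply_bcontfun g s))"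
      by (rule continuous_on_compose2[OF cont])
        (use S[OF that] I in \<open>auto intro!: continuous_intros continuous_on_apply_bcontfun\<close>)
    then show ?thesis by (simp add: h_def)
  qed
  \<comment> \<open>Integration starts at \<open>t0 - d\<close>, so that on \<open>I\<close> the
    upper limit is never below the lower one; \<open>W\<close> subtracts the value at
    \<open>t0\<close> to restore the initial condition.\<close>
  define F where "F = (\<lambda>g t. integral {t0 - d..t} (h g))"
  have Fd: "(F g has_vector_derivative h g t) (at t within I)" if "g \<in> S" "t \<in> I" for g t
    using integral_has_vector_derivative[of "t0 - d" "t0 + d" "h g" t] hc[OF that(1)] that(2)
    by (simp add: F_def I_def)
  have Fdiff: "norm ((F g t - F g' t) - (F g t0 - F g' t0)) \<le> C * d"
    if "g \<in> S" "g' \<in> S" "t \<in> I" and C: "\<And>s. s \<in> I \<Longrightarrow> norm (h g s - h g' s) \<le> C" for g g' t C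
  proof -
    have "norm ((F g t - F g' t) - (F g t0 - F g' t0)) \<le> C * norm (t - t0)"
    proof (rule differentiable_bound[of I])
      show "((\<lambda>t. F g t - F g' t) has_derivative (\<lambda>u. u *\<^sub>R (h g s - h g' s))) (at s within I)"
          if "s \<in> I" for s
        using has_vector_derivative_diff[OF Fd[OF \<open>g \<in> S\<close> that] Fd[OF \<open>g' \<in> S\<close> that]]
        by (simp add: has_vector_derivative_def)
      show "onorm (\<lambda>u. u *\<^sub>R (h g s - h g' s)) \<le> C" if "s \<in> I" for s
        by (rule onorm_le) (use mult_left_mono[OF C[OF that] abs_ge_zero] in \<open>simp add: mult.commute[of
            C]\<close>)
    qed (use that t0I in \<open>auto simp: I_def\<close>)
    also have "\<dots> \<le> C * d" using I[OF \<open>t \<in> I\<close>] order_trans[OF norm_ge_zero C[OF t0I]]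
      by (intro mult_left_mono) auto
    finally show ?thesis .
  qed
  have Fbound: "norm (F g t - F g t0) \<le> r" if "g \<in> S" "t \<in> I" for g t
  proof -
    have "norm (F g t - F g t0) \<le> M * norm (t - t0)"
    proof (rule differentiable_bound[of I])
      show "(F g has_derivative (\<lambda>u. u *\<^sub>R h g s)) (at s within I)" if "s \<in> I" for s
        using Fd[OF \<open>g \<in> S\<close> that] by (simp add: has_vector_derivative_def)
      show "onorm (\<lambda>u. u *\<^sub>R h g s) \<le> M" if "s \<in> I" for s
        by (rule onorm_le) (use mult_left_mono[OF M(2)[OF I(1)[OF that] S[OF \<open>g \<in> S\<close>]] abs_ge_zero] in
            \<open>simp add: h_def mult.commute[of M]\<close>)
    qed (use that t0I in \<open>auto simp: I_def\<close>)
    also have "\<dots> \<le> M * d" using I[OF \<open>t \<in> I\<close>] M by (intro mult_left_mono) auto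
    finally show ?thesis using dM by linarith
  qed
  define cl where "cl = (\<lambda>t. max (t0 - d) (min (t0 + d) t))"
  have cl: "cl t \<in> I" "continuous_on UNIV cl" for t
    using d by (auto simp: cl_def I_def intro!: continuous_intros)
  have cl_id: "cl t = t" if "t \<in> I" for t using that by (auto simp: cl_def I_def)
  define W where "W = (\<lambda>g t. x0 + (F g (cl t) - F g t0))"
  have W: "W g \<in> bcontfun" if "g \<in> S" for g
  proof (rule bcontfun_normI[of _ "norm x0 + r"])
    have "continuous_on I (F g)"
      using Fd[OF that] by (meson continuous_on_eq_continuous_within has_vector_derivative_continuous)
    then have "continuous_on UNIV (\<lambda>t. F g (cl t))"
      by (rule continuous_on_compose2[OF _ cl(2)]) (use cl(1) in auto)
    then show "continuous_on UNIV (W g)" unfolding W_def by (intro continuous_intros)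
    show "norm (W g t) \<le> norm x0 + r" for t
      unfolding W_def using norm_triangle_ineq[of x0] Fbound[OF that cl(1)[of t]] by (smt (verit))
  qed
  define Ph where "Ph = (\<lambda>g. Bcontfun (W g))"
  have Ph: "apply_bcontfun (Ph g) = W g" if "g \<in> S" for g
    using W[OF that] by (simp add: Ph_def Bcontfun_inverse)
  have "\<exists>!g\<in>S. Ph g = g"
  proof (rule Banach_fix[where c = "1/2"])
    show "complete S" unfolding S_def complete_eq_closed by (rule closed_PiC) auto
    have "apply_bcontfun (const_bcontfun x0) s \<in> cball x0 r" for s using r
        by (simp add: const_bcontfun.rep_eq)
    then have "const_bcontfun x0 \<in> S" by (auto simp: S_def mem_PiC_iff)
    then show "S \<noteq> {}" by auto
    show "Ph ` S \<subseteq> S" using Fbound[OF _ cl(1)] Ph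
      by (auto simp: S_def mem_PiC_iff W_def dist_norm norm_minus_commute)
    show "dist (Ph g) (Ph g') \<le> 1 / 2 * dist g g'" if g: "g \<in> S" "g' \<in> S" for g g'
    proof (rule dist_bound)
      fix t
      have "norm (h g s - h g' s) \<le> \<bar>B\<bar> * dist g g'" if "s \<in> I" for s
      proof -
        have "norm (h g s - h g' s) \<le> B * norm (apply_bcontfun g s - apply_bcontfun g' s)"
          unfolding h_def using lip[OF I(1)[OF that] S[OF g(1)] S[OF g(2)]] .
        also have "\<dots> \<le> \<bar>B\<bar> * dist g g'"
          using dist_bounded[of g s g'] by (intro mult_mono) (auto simp: dist_norm)
        finally show ?thesis .
      qed
      from Fdiff[OF g cl(1)[of t] this]
      have "dist (Ph g t) (Ph g' t) \<le> \<bar>B\<bar> * dist g g' * d"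
        using Ph[OF g(1)] Ph[OF g(2)] by (simp add: W_def dist_norm algebra_simps)
      also have "\<dots> = (\<bar>B\<bar> * d) * dist g g'" by simp
      also have "\<dots> \<le> 1 / 2 * dist g g'" using dB by (intro mult_right_mono) auto
      finally show "dist (Ph g t) (Ph g' t) \<le> 1 / 2 * dist g g'" .
    qed
  qed auto
  then obtain g where g: "g \<in> S" "Ph g = g" by blast
  define z where "z = apply_bcontfun g"
  have z: "z = W g" using Ph[OF g(1)] g(2) by (simp add: z_def)
  show ?thesis
  proof (rule that[of d z])
    show "z t0 = x0" unfolding z by (simp add: W_def cl_id t0I)
    fix t assume t: "t \<in> {t0 - d<..<t0 + d}"
    have int: "t \<in> interior I" using t by (simp add: I_def)
    then have "(F g has_vector_derivative h g t) (at t)"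
      using Fd[OF g(1), of t] interior_subset has_vector_derivative_within_open at_within_interior
          by (metis subsetD)
    then have "((\<lambda>s. x0 + (F g s - F g t0)) has_vector_derivative h g t) (at t)"
      by (auto intro!: derivative_eq_intros)
    then have "(z has_vector_derivative h g t) (at t)" unfolding has_vector_derivative_def
      by (rule has_derivative_transform_within_open[where s = "{t0 - d<..<t0 + d}"])
        (use t cl_id in \<open>auto simp: z W_def I_def\<close>)
    then show "z t \<in> cball x0 r \<and> (z has_vector_derivative f t (z t)) (at t)"
      using S[OF g(1)] by (simp add: z_def h_def)
  qed (use d in auto)
qed

section \<open>Maps in charts\<close>

definition proj :: "'m::finite set \<Rightarrow> real ^ 'm \<Rightarrow> real ^ 'm" where
  "proj K y = (\<chi> \<alpha>. if \<alpha> \<in> K then y $ \<alpha> else 0)"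

lemma proj_nth [simp]: "proj K y $ \<alpha> = (if \<alpha> \<in> K then y $ \<alpha> else 0)"
  by (simp add: proj_def)

lemma proj_in_coord_space [simp]: "proj K y \<in> coord_space K"
  by (simp add: coord_space_def)

lemma proj_id [simp]: "y \<in> coord_space K \<Longrightarrow> proj K y = y"
  by (auto simp: coord_space_def vec_eq_iff)

lemma proj_UNIV [simp]: "proj UNIV y = y"
  by (simp add: vec_eq_iff)

lemma coord_space_UNIV [simp]: "coord_space UNIV = UNIV"
  by (simp add: coord_space_def)

lemma linear_proj: "linear (proj K)"
  by (rule linearI) (auto simp: vec_eq_iff)

lemma bounded_linear_proj: "bounded_linear (proj K)"
  using linear_proj linear_conv_bounded_linear by blast

lemma proj_add: "proj K (x + y) = proj K x + proj K y"
  by (rule linear_add[OF linear_proj])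

lemma proj_zero [simp]: "proj K 0 = 0"
  by (rule linear_0[OF linear_proj])

lemma continuous_on_proj [continuous_intros]: "continuous_on S f \<Longrightarrow> continuous_on S (\<lambda>x. proj K (f x))"
  by (rule bounded_linear.continuous_on[OF bounded_linear_proj])

lemma subspace_coord_space: "subspace (coord_space K)"
  by (simp add: subspace_def coord_space_def)

text \<open>The cylinder over the image of the chart: it is open in the whole space even where that
  image is open only in \<open>coord_space K\<close>.\<close>

definition vdom :: "'m::finite set \<Rightarrow> ('p, real ^ 'm) chart \<Rightarrow> (real ^ 'm) set" where
  "vdom K c = {y. proj K y \<in> cmap c ` cdom c}"

text \<open>The inverse of a chart with values in \<open>coord_space K\<close>, extended to an open set of the whole
  space. In this way all derivatives become derivatives at a point.\<close>

definition pull :: "'m::finite set \<Rightarrow> ('p, real ^ 'm) chart \<Rightarrow> real ^ 'm \<Rightarrow> 'p" where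
  "pull K c y = cinv c (proj K y)"

lemma pull_UNIV [simp]: "pull UNIV c y = cinv c y"
  by (simp add: pull_def)

lemma vdom_UNIV [simp]: "vdom UNIV c = cmap c ` cdom c"
  by (simp add: vdom_def)

lemma pull_proj [simp]: "pull K c (proj K y) = pull K c y"
  by (simp add: pull_def)

lemma pull_in_cdom [simp]: "y \<in> vdom K c \<Longrightarrow> pull K c y \<in> cdom c"
  by (simp add: vdom_def pull_def inv_into_into)

lemma cmap_pull [simp]: "y \<in> vdom K c \<Longrightarrow> cmap c (pull K c y) = proj K y"
  by (simp add: vdom_def pull_def f_inv_into_f)

lemma manifold_is_chart: "manifold V A \<Longrightarrow> c \<in> A \<Longrightarrow> is_chart V c"
  unfolding manifold_def by blast

lemma manifold_compatible: "manifold V A \<Longrightarrow> c \<in> A \<Longrightarrow> d \<in> A \<Longrightarrow> compatible c d"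
  unfolding manifold_def by blast

lemma is_chart_open: "is_chart V c \<Longrightarrow> open (cdom c)"
  by (simp add: is_chart_def)

lemma is_chart_image: "is_chart V c \<Longrightarrow> p \<in> cdom c \<Longrightarrow> cmap c p \<in> V"
  unfolding is_chart_def by (metis image_eqI in_mono openin_imp_subset)

lemma is_chart_cinv: "is_chart V c \<Longrightarrow> p \<in> cdom c \<Longrightarrow> cinv c (cmap c p) = p"
  by (simp add: is_chart_def)

lemma is_chart_pull: "is_chart (coord_space K) c \<Longrightarrow> p \<in> cdom c \<Longrightarrow> pull K c (cmap c p) = p"
  by (simp add: pull_def is_chart_image is_chart_cinv)

lemma is_chart_vdom: "is_chart (coord_space K) c \<Longrightarrow> p \<in> cdom c \<Longrightarrow> cmap c p \<in> vdom K c"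
  by (simp add: vdom_def is_chart_image)

lemma is_chart_continuous_inv: "is_chart V c \<Longrightarrow> continuous_on (cmap c ` cdom c) (cinv c)"
  by (simp add: is_chart_def homeomorphism_def)

lemma is_chart_open_vdom: assumes "is_chart (coord_space K) c" shows "open (vdom K c)"
proof -
  obtain W where "open W" "cmap c ` cdom c = coord_space K \<inter> W"
    using assms unfolding is_chart_def openin_open by blast
  then have "vdom K c = proj K -` W" by (auto simp: vdom_def)
  with \<open>open W\<close> show ?thesis
    using continuous_open_vimage[of W "proj K"]
    by (simp add: bounded_linear_proj linear_continuous_at)
qed

lemma manifold_chart_at: assumes "manifold V A" shows "chart_at A p \<in> A" "p \<in> cdom (chart_at A p)"
proof -
  have "\<exists>c. c \<in> A \<and> p \<in> cdom c" using assms unfolding manifold_def by blast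
  then show "chart_at A p \<in> A" "p \<in> cdom (chart_at A p)"
    unfolding chart_at_def by (metis (mono_tags, lifting) someI_ex)+
qed

text \<open>Smoothness on a thin set \<open>S\<close> only provides a smooth extension. Composing
  with a linear \<open>h\<close> that maps an open set into \<open>S\<close> makes the choice of
  extension invisible and leaves a C^2 map on an open set. In the applications \<open>h\<close> is a
  projection or a pair of projections.\<close>

lemma smooth_into_C2_on:
  fixes h :: "'a::euclidean_space \<Rightarrow> 'b::euclidean_space"
    and B :: "('r::topological_space, 'e::euclidean_space) atlas"
  assumes f: "smooth_into B S f" and d: "d \<in> B" "open (cdom d)"
    and h: "bounded_linear h" and W: "open W" "h ` W \<subseteq> S" "w \<in> W" "f (h w) \<in> cdom d"
  shows "\<exists>U. open U \<and> w \<in> U \<and> U \<subseteq> W \<and> (\<forall>y\<in>U. f (h y) \<in> cdom d) \<and>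
    C2_on (\<lambda>y. cmap d (f (h y))) U"
proof -
  have hw: "h w \<in> {y \<in> S. f y \<in> cdom d}" using W by auto
  have "smooth_on (cmap d \<circ> f) {y \<in> S. f y \<in> cdom d}"
    using f d(1) by (simp add: smooth_into_def)
  from bspec[OF this[unfolded smooth_on_def] hw]
  obtain T F where T: "open T" "h w \<in> T" and F: "\<forall>k. Ck_on k F T"
    "\<forall>z\<in>{y \<in> S. f y \<in> cdom d} \<inter> T. F z = (cmap d \<circ> f) z" by blast
  define U where "U = W \<inter> h -` T \<inter> (W \<inter> (\<lambda>y. f (h y)) -` cdom d)"
  have ch: "continuous_on W h" using h linear_continuous_on by blast
  have "continuous_on W (\<lambda>y. f (h y))"
    by (rule continuous_on_compose2[OF _ ch W(2)]) (use f in \<open>auto simp: smooth_into_def\<close>)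
  then have "open U" unfolding U_def
    by (intro open_Int continuous_open_preimage ch W T d)
  moreover have "C2_on (\<lambda>y. cmap d (f (h y))) U"
  proof (rule C2_on_cong[OF \<open>open U\<close>])
    show "C2_on (\<lambda>y. F (h y)) U"
      by (rule C2_on_compose_linear[OF Ck_on_imp_C2_on[OF F(1)[rule_format]] h]) (auto simp: U_def)
    show "F (h y) = cmap d (f (h y))" if "y \<in> U" for y
      using bspec[OF F(2), of "h y"] that W(2) by (auto simp: U_def)
  qed
  moreover have "w \<in> U" "U \<subseteq> W" "\<forall>y\<in>U. f (h y) \<in> cdom d" using W T by (auto simp: U_def)
  ultimately show ?thesis by (intro exI[of _ U] conjI)
qed

section \<open>Differentiability and the chain rule in charts\<close>

text \<open>The eventuality clause is essential because chart maps and their inverses are total: it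
  ensures that near \<open>p\<close> the coordinate expression is not computed from values outside
  the charts.\<close>

definition mdiff ::
  "'m::finite set \<Rightarrow> ('p, real ^ 'm) atlas \<Rightarrow> ('r, real ^ 'm) atlas \<Rightarrow> ('p \<Rightarrow> 'r) \<Rightarrow> 'p \<Rightarrow> bool" where
  "mdiff K A B f p \<longleftrightarrow> (\<forall>c\<in>A. \<forall>d\<in>B. p \<in> cdom c \<longrightarrow> f p \<in> cdom d \<longrightarrow>
     (\<forall>\<^sub>F y in nhds (cmap c p). y \<in> vdom K c \<and> f (pull K c y) \<in> cdom d) \<and>
     (\<lambda>y. cmap d (f (pull K c y))) differentiable (at (cmap c p)))"

definition mder ::
  "'m::finite set \<Rightarrow> ('p, real ^ 'm) chart \<Rightarrow> ('r, real ^ 'm) chart \<Rightarrow> ('p \<Rightarrow> 'r) \<Rightarrow> 'p \<Rightarrow> real ^ 'm \<Rightarrow> real ^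
      'm" where
  "mder K c d f p = frechet_derivative (\<lambda>y. cmap d (f (pull K c y))) (at (cmap c p))"

lemma mdiffI:
  assumes "\<And>c d. \<lbrakk>c \<in> A; d \<in> B; p \<in> cdom c; f p \<in> cdom d\<rbrakk> \<Longrightarrow>
    \<exists>U. open U \<and> cmap c p \<in> U \<and> U \<subseteq> vdom K c \<and> (\<forall>y\<in>U. f (pull K c y) \<in> cdom d) \<and>
      C2_on (\<lambda>y. cmap d (f (pull K c y))) U"
  shows "mdiff K A B f p"
  unfolding mdiff_def eventually_nhds using assms by (meson C2_on_differentiable subsetD)

lemma mdiff_mder:
  assumes "mdiff K A B f p" "c \<in> A" "d \<in> B" "p \<in> cdom c" "f p \<in> cdom d"
  shows "((\<lambda>y. cmap d (f (pull K c y))) has_derivative mder K c d f p) (at (cmap c p))"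
  using assms unfolding mdiff_def mder_def frechet_derivative_works by blast

lemma mder_linear:
  assumes "mdiff K A B f p" "c \<in> A" "d \<in> B" "p \<in> cdom c" "f p \<in> cdom d"
  shows "linear (mder K c d f p)"
  using mdiff_mder[OF assms] has_derivative_linear by blast

lemma mdiff_eventually:
  assumes "mdiff K A B f p" "c \<in> A" "d \<in> B" "p \<in> cdom c" "f p \<in> cdom d"
  shows "\<forall>\<^sub>F y in nhds (cmap c p). y \<in> vdom K c \<and> f (pull K c y) \<in> cdom d"
  using assms unfolding mdiff_def by blast

lemma has_derivative_transform_nhds:
  assumes "(f has_derivative f') (at x)" "\<forall>\<^sub>F y in nhds x. f y = g y"
  shows "(g has_derivative f') (at x)"
proof -
  obtain U where "open U" "x \<in> U" "\<And>y. y \<in> U \<Longrightarrow> f y = g y"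
    using assms(2) unfolding eventually_nhds by blast
  then show ?thesis using has_derivative_transform_within_open[OF assms(1)] by blast
qed

lemma mder_eqI:
  assumes "(F has_derivative F') (at (cmap c p))" "\<forall>\<^sub>F y in nhds (cmap c p). F y = cmap d (f (pull K c
      y))"
  shows "mder K c d f p = F'"
  unfolding mder_def using frechet_derivative_at[OF has_derivative_transform_nhds[OF assms]] by simp

text \<open>Near the point the values of a chart of \<open>B\<close> are fixed by
  \<open>proj K'\<close>, hence so is the derivative.\<close>

lemma mder_in_coord_space:
  assumes f: "mdiff K A B f p" "c \<in> A" "d \<in> B" "p \<in> cdom c" "f p \<in> cdom d"
    and B: "manifold (coord_space K') B"
  shows "mder K c d f p e \<in> coord_space K'"
proof -
  have "mder K c d f p = (\<lambda>e. proj K' (mder K c d f p e))"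
  proof (rule mder_eqI)
    show "((\<lambda>y. proj K' (cmap d (f (pull K c y)))) has_derivative (\<lambda>e. proj K' (mder K c d f p e))) (at
        (cmap c p))"
      by (rule bounded_linear.has_derivative[OF bounded_linear_proj mdiff_mder[OF f]])
    show "\<forall>\<^sub>F y in nhds (cmap c p). proj K' (cmap d (f (pull K c y))) = cmap d (f (pull K c y))"
      using mdiff_eventually[OF f]
      by eventually_elim (simp add: is_chart_image[OF manifold_is_chart[OF B f(3)]])
  qed
  then show ?thesis by (metis proj_in_coord_space)
qed

lemma mder_proj:
  assumes f: "mdiff K A B f p" "c \<in> A" "d \<in> B" "p \<in> cdom c" "f p \<in> cdom d"
    and A: "manifold (coord_space K) A"
  shows "mder K c d f p (proj K e) = mder K c d f p e"
proof -
  have p: "proj K (cmap c p) = cmap c p"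
    using is_chart_image[OF manifold_is_chart[OF A f(2)] f(4)] by simp
  have "mder K c d f p = (\<lambda>e. mder K c d f p (proj K e))"
  proof (rule mder_eqI)
    have 1: "((\<lambda>y. cmap d (f (pull K c y))) has_derivative mder K c d f p) (at (proj K (cmap c p)))"
      using mdiff_mder[OF f] p by simp
    from has_derivative_compose[OF bounded_linear_imp_has_derivative[OF bounded_linear_proj] this]
    show "((\<lambda>y. cmap d (f (pull K c y))) has_derivative (\<lambda>e. mder K c d f p (proj K e))) (at (cmap c
        p))"
      by simp
  qed simp
  then show ?thesis by metis
qed

text \<open>Differentiability makes the coordinate expression of \<open>f\<close> continuous, which
  carries the neighbourhood on which \<open>g\<close> is controlled back to the first chart. The
  middle chart in the second part is arbitrary: with an identity map it is the rule for changing
  charts in \<open>mder\<close>.\<close>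

lemma mdiff_compose:
  assumes f: "mdiff K A B f p" and g: "mdiff K' B C g (f p)"
    and A: "manifold (coord_space K) A" and B: "manifold (coord_space K') B"
  shows "mdiff K A C (\<lambda>x. g (f x)) p"
    and "\<lbrakk>c \<in> A; d \<in> B; e \<in> C; p \<in> cdom c; f p \<in> cdom d; g (f p) \<in> cdom e\<rbrakk> \<Longrightarrow>
      mder K c e (\<lambda>x. g (f x)) p = (\<lambda>v. mder K' d e g (f p) (mder K c d f p v))"
proof -
  have main: "(\<forall>\<^sub>F y in nhds (cmap c p). y \<in> vdom K c \<and> g (f (pull K c y)) \<in> cdom e) \<and>
    ((\<lambda>y. cmap e (g (f (pull K c y)))) has_derivative (\<lambda>v. mder K' d e g (f p) (mder K c d f p v))) (at
        (cmap c p))"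
    if c: "c \<in> A" "d \<in> B" "e \<in> C" "p \<in> cdom c" "f p \<in> cdom d" "g (f p) \<in> cdom e" for c d e
  proof -
    have cc: "is_chart (coord_space K) c" and cd: "is_chart (coord_space K') d"
      using manifold_is_chart A B c by blast+
    have p: "pull K c (cmap c p) = p" by (rule is_chart_pull[OF cc c(4)])
    note F = mdiff_mder[OF f c(1,2,4,5)]
    note G = mdiff_mder[OF g c(2,3,5,6)]
    have ev: "\<forall>\<^sub>F y in nhds (cmap c p). y \<in> vdom K c \<and> f (pull K c y) \<in> cdom d"
      by (rule mdiff_eventually[OF f c(1,2,4,5)])
    have "((\<lambda>y. cmap d (f (pull K c y))) \<longlongrightarrow> cmap d (f (pull K c (cmap c p)))) (nhds (cmap c p))"
      using has_derivative_continuous[OF F] unfolding isCont_def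
      by (subst tendsto_at_iff_tendsto_nhds[symmetric])
    then have lim: "filterlim (\<lambda>y. cmap d (f (pull K c y))) (nhds (cmap d (f p))) (nhds (cmap c p))"
      by (simp add: p)
    have inv: "pull K' d (cmap d (f (pull K c y))) = f (pull K c y)" if "f (pull K c y) \<in> cdom d" for y
      by (rule is_chart_pull[OF cd that])
    have 1: "\<forall>\<^sub>F y in nhds (cmap c p). y \<in> vdom K c \<and> g (f (pull K c y)) \<in> cdom e"
      using ev eventually_compose_filterlim[OF mdiff_eventually[OF g c(2,3,5,6)] lim]
      by eventually_elim (simp add: inv)
    have "((\<lambda>y. cmap e (g (pull K' d y))) has_derivative mder K' d e g (f p)) (at (cmap d (f (pull K c
        (cmap c p)))))"
      using G by (simp add: p)
    from has_derivative_compose[OF F this]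
    have 2: "((\<lambda>y. cmap e (g (f (pull K c y)))) has_derivative (\<lambda>v. mder K' d e g (f p) (mder K c d f p
        v))) (at (cmap c p))"
      by (rule has_derivative_transform_nhds) (use ev in \<open>eventually_elim, simp add: inv\<close>)
    from 1 2 show ?thesis by blast
  qed
  have "\<exists>d\<in>B. f p \<in> cdom d" using manifold_chart_at[OF B, of "f p"] by blast
  then show "mdiff K A C (\<lambda>x. g (f x)) p" using main unfolding mdiff_def differentiable_def by blast
  show "\<lbrakk>c \<in> A; d \<in> B; e \<in> C; p \<in> cdom c; f p \<in> cdom d; g (f p) \<in> cdom e\<rbrakk> \<Longrightarrow>
      mder K c e (\<lambda>x. g (f x)) p = (\<lambda>v. mder K' d e g (f p) (mder K c d f p v))"
    using frechet_derivative_at[OF main[THEN conjunct2]] by (simp add: mder_def)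
qed

lemma manifold_smooth_into:
  assumes A: "manifold V A" "c \<in> A" shows "smooth_into A (cmap c ` cdom c) (cinv c)"
  unfolding smooth_into_def
proof (intro conjI ballI)
  have ch: "is_chart V c" using manifold_is_chart A by blast
  show "continuous_on (cmap c ` cdom c) (cinv c)" by (rule is_chart_continuous_inv[OF ch])
  fix d assume "d \<in> A"
  have "{y \<in> cmap c ` cdom c. cinv c y \<in> cdom d} = cmap c ` (cdom c \<inter> cdom d)"
    using is_chart_cinv[OF ch] by auto
  then show "smooth_on (cmap d \<circ> cinv c) {y \<in> cmap c ` cdom c. cinv c y \<in> cdom d}"
    using manifold_compatible[OF A \<open>d \<in> A\<close>] by (simp add: compatible_def)
qed

lemma transition_C2_on:
  assumes A: "manifold (coord_space K) A" and c: "c \<in> A" "d \<in> A" "p \<in> cdom c" "p \<in> cdom d"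
  shows "\<exists>U. open U \<and> cmap c p \<in> U \<and> U \<subseteq> vdom K c \<and> (\<forall>y\<in>U. pull K c y \<in> cdom d) \<and>
      C2_on (\<lambda>y. cmap d (pull K c y)) U"
proof -
  note cc = manifold_is_chart[OF A c(1)] and cd = manifold_is_chart[OF A c(2)]
  have h: "proj K ` vdom K c \<subseteq> cmap c ` cdom c" by (auto simp: vdom_def)
  have p: "cinv c (proj K (cmap c p)) \<in> cdom d" using is_chart_pull[OF cc c(3)] c(4)
      by (simp add: pull_def)
  show ?thesis unfolding pull_def
    by (rule smooth_into_C2_on[OF manifold_smooth_into[OF A c(1)] c(2) is_chart_open[OF cd]
        bounded_linear_proj
        is_chart_open_vdom[OF cc] h is_chart_vdom[OF cc c(3)] p])
qed

lemma mdiff_id: assumes A: "manifold (coord_space K) A" shows "mdiff K A A (\<lambda>x. x) p"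
  by (rule mdiffI) (rule transition_C2_on[OF A])

text \<open>Joint regularity is retained, not merely regularity in each variable: the derivative in
  one variable will have to depend differentiably on the other.\<close>

lemma smooth_map2_C2_on:
  assumes A: "manifold (coord_space K) A" and A': "manifold (coord_space K') A'" and B: "manifold V B"
    and f: "smooth_map2 A A' B f"
    and c: "c \<in> A" "c' \<in> A'" "d \<in> B" "p \<in> cdom c" "p' \<in> cdom c'" "f p p' \<in> cdom d"
  shows "\<exists>U. open U \<and> (cmap c p, cmap c' p') \<in> U \<and> U \<subseteq> vdom K c \<times> vdom K' c' \<and>
    (\<forall>(y, z)\<in>U. f (pull K c y) (pull K' c' z) \<in> cdom d) \<and>
    C2_on (\<lambda>(y, z). cmap d (f (pull K c y) (pull K' c' z))) U"
proof -
  note cc = manifold_is_chart[OF A c(1)] and cc' = manifold_is_chart[OF A' c(2)]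
    and cd = manifold_is_chart[OF B c(3)]
  define h :: "(real ^ 'a) \<times> (real ^ 'c) \<Rightarrow> _" where "h = (\<lambda>x. (proj K (fst x), proj K' (snd x)))"
  have hl: "bounded_linear h" unfolding h_def
    by (intro bounded_linear_Pair bounded_linear_compose[OF bounded_linear_proj] bounded_linear_fst
        bounded_linear_snd)
  let ?f = "\<lambda>(y, z). f (cinv c y) (cinv c' z)"
  have hs: "h ` (vdom K c \<times> vdom K' c') \<subseteq> (cmap c ` cdom c) \<times> (cmap c' ` cdom c')"
    by (auto simp: vdom_def h_def)
  have W: "open (vdom K c \<times> vdom K' c')" by (intro open_Times is_chart_open_vdom cc cc')
  have p: "(cmap c p, cmap c' p') \<in> vdom K c \<times> vdom K' c'"
    using is_chart_vdom[OF cc c(4)] is_chart_vdom[OF cc' c(5)] by simp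
  have q: "?f (h (cmap c p, cmap c' p')) \<in> cdom d"
    using is_chart_pull[OF cc c(4)] is_chart_pull[OF cc' c(5)] c(6) by (simp add: h_def pull_def)
  have "smooth_into B ((cmap c ` cdom c) \<times> (cmap c' ` cdom c')) ?f"
    using f c by (simp add: smooth_map2_def)
  from smooth_into_C2_on[OF this c(3) is_chart_open[OF cd] hl W hs p q]
  obtain U where U: "open U" "(cmap c p, cmap c' p') \<in> U" "U \<subseteq> vdom K c \<times> vdom K' c'"
    "\<forall>y\<in>U. ?f (h y) \<in> cdom d" "C2_on (\<lambda>y. cmap d (?f (h y))) U" by (elim exE conjE)
  have "(\<lambda>(y, z). cmap d (f (pull K c y) (pull K' c' z))) = (\<lambda>y. cmap d (?f (h y)))"
    by (auto simp: h_def pull_def fun_eq_iff)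
  moreover have "\<forall>(y, z)\<in>U. f (pull K c y) (pull K' c' z) \<in> cdom d"
    using U(4) by (auto simp: h_def pull_def)
  ultimately show ?thesis using U by (intro exI[of _ U] conjI) simp_all
qed

section \<open>Tangent vectors in charts\<close>

text \<open>Within a thin set a Frechet derivative is not unique in directions transverse to it, so
  agreement can be claimed only for \<open>e\<close> in the subspace. There it follows by composing
  with the projection, which gives a derivative at a point, where uniqueness holds.\<close>

lemma frechet_derivative_within_eq:
  fixes g :: "real ^ 'm::finite \<Rightarrow> 'b::real_normed_vector"
  assumes g: "((\<lambda>y. g (proj K y)) has_derivative D) (at x)" and S: "\<forall>\<^sub>F y in nhds x. proj K y \<in> S"
    and "S \<subseteq> coord_space K" "x \<in> S" "e \<in> coord_space K"
  shows "frechet_derivative g (at x within S) e = D e"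
proof -
  let ?F = "frechet_derivative g (at x within S)"
  have "(g has_derivative D) (at x within S)"
    by (rule has_derivative_transform[OF \<open>x \<in> S\<close> _ has_derivative_at_withinI[OF g]])
      (use assms(3) in auto)
  then have "g differentiable (at x within S)" by (rule differentiableI)
  then have F: "(g has_derivative ?F) (at x within S)" by (simp only: frechet_derivative_works)
  obtain U where U: "open U" "x \<in> U" "\<And>y. y \<in> U \<Longrightarrow> proj K y \<in> S"
    using S unfolding eventually_nhds by blast
  have x: "proj K x = x" using assms(3,4) by auto
  have "(g has_derivative ?F) (at (proj K x) within proj K ` U)"
    unfolding x by (rule has_derivative_subset[OF F]) (use U in auto)
  from diff_chain_within[OF bounded_linear_imp_has_derivative[OF bounded_linear_proj] this]
  have "(g \<circ> proj K has_derivative ?F \<circ> proj K) (at x)" unfolding at_within_open[OF U(2,1)] .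
  then have "((\<lambda>y. g (proj K y)) has_derivative (\<lambda>e. ?F (proj K e))) (at x)" by (simp only: o_def)
  from fun_cong[OF has_derivative_unique[OF this g], of e] have "?F (proj K e) = D e" .
  then show ?thesis using assms by simp
qed

lemma mder_within:
  assumes A: "manifold (coord_space K) A" and f: "mdiff K A B f p"
    and c: "c \<in> A" "d \<in> B" "p \<in> cdom c" "f p \<in> cdom d" and e: "e \<in> coord_space K"
  shows "frechet_derivative (cmap d \<circ> f \<circ> cinv c) (at (cmap c p) within cmap c ` {r \<in> cdom c. f r \<in>
      cdom d}) e =
    mder K c d f p e"
proof (rule frechet_derivative_within_eq[OF _ _ _ _ e])
  note ch = manifold_is_chart[OF A c(1)]
  show "((\<lambda>y. (cmap d \<circ> f \<circ> cinv c) (proj K y)) has_derivative mder K c d f p) (at (cmap c p))"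
    using mdiff_mder[OF f c] by (simp add: pull_def)
  show "\<forall>\<^sub>F y in nhds (cmap c p). proj K y \<in> cmap c ` {r \<in> cdom c. f r \<in> cdom d}"
    using mdiff_eventually[OF f c]
  proof eventually_elim
    case (elim y)
    then have "cmap c (pull K c y) = proj K y" "pull K c y \<in> {r \<in> cdom c. f r \<in> cdom d}" by auto
    then show ?case by (metis imageI)
  qed
qed (use c is_chart_image[OF manifold_is_chart[OF A c(1)]] in auto)

lemma trans_deriv_eq_mder:
  assumes A: "manifold (coord_space K) A" and c: "c \<in> A" "d \<in> A" "p \<in> cdom c" "p \<in> cdom d"
    and e: "e \<in> coord_space K"
  shows "trans_deriv c d p e = mder K c d (\<lambda>x. x) p e"
proof -
  have "cmap d \<circ> (\<lambda>x. x) \<circ> cinv c = cmap d \<circ> cinv c" "{r \<in> cdom c. r \<in> cdom d} = cdom c \<inter> cdom d"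
      by auto
  then show ?thesis using mder_within[OF A mdiff_id[OF A] c e] by (simp add: trans_deriv_def)
qed

lemma mder_id_self:
  assumes A: "manifold (coord_space K) A" and c: "c \<in> A" "p \<in> cdom c"
  shows "mder K c c (\<lambda>x. x) p e = proj K e"
proof -
  have "mder K c c (\<lambda>x. x) p = proj K"
  proof (rule mder_eqI[OF bounded_linear_imp_has_derivative[OF bounded_linear_proj]])
    show "\<forall>\<^sub>F y in nhds (cmap c p). proj K y = cmap c (pull K c y)"
      using mdiff_eventually[OF mdiff_id[OF A] c(1,1,2,2)] by eventually_elim simp
  qed
  then show ?thesis by simp
qed

lemma tspace_coord: "w \<in> tspace V A p \<Longrightarrow> c \<in> A \<Longrightarrow> p \<in> cdom c \<Longrightarrow> w c \<in> V"
  unfolding tspace_def mem_Collect_eq by blast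

lemma tspace_outside: "w \<in> tspace V A p \<Longrightarrow> c \<notin> A \<or> p \<notin> cdom c \<Longrightarrow> w c = 0"
  unfolding tspace_def mem_Collect_eq by blast

lemma tspace_trans:
  assumes A: "manifold (coord_space K) A" and w: "w \<in> tspace (coord_space K) A p"
    and c: "c \<in> A" "d \<in> A" "p \<in> cdom c" "p \<in> cdom d"
  shows "w d = mder K c d (\<lambda>x. x) p (w c)"
proof -
  have "w d = trans_deriv c d p (w c)" using w c unfolding tspace_def mem_Collect_eq by blast
  then show ?thesis using trans_deriv_eq_mder[OF A c tspace_coord[OF w c(1,3)]] by simp
qed

lemma tspaceI:
  assumes A: "manifold (coord_space K) A"
    and 0: "\<And>c. c \<notin> A \<or> p \<notin> cdom c \<Longrightarrow> w c = 0"
    and 1: "\<And>c. c \<in> A \<Longrightarrow> p \<in> cdom c \<Longrightarrow> w c \<in> coord_space K"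
    and 2: "\<And>c d. \<lbrakk>c \<in> A; d \<in> A; p \<in> cdom c; p \<in> cdom d\<rbrakk> \<Longrightarrow> w d = mder K c d (\<lambda>x. x) p (w c)"
  shows "w \<in> tspace (coord_space K) A p"
  unfolding tspace_def mem_Collect_eq
proof (intro conjI allI ballI impI)
  show "w d = trans_deriv c d p (w c)" if "c \<in> A" "p \<in> cdom c" "d \<in> A" "p \<in> cdom d" for c d
    using 2[OF that(1,3,2,4)] trans_deriv_eq_mder[OF A that(1,3,2,4) 1[OF that(1,2)]] by simp
qed (use 0 1 in blast)+

lemma tspace_eqI:
  assumes A: "manifold (coord_space K) A" and w: "w \<in> tspace (coord_space K) A p" "w' \<in> tspace
      (coord_space K) A p"
    and c: "c \<in> A" "p \<in> cdom c" "w c = w' c"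
  shows "w = w'"
proof
  fix d show "w d = w' d"
  proof (cases "d \<in> A \<and> p \<in> cdom d")
    case True
    then show ?thesis using tspace_trans[OF A w(1), of c d] tspace_trans[OF A w(2), of c d] c by simp
  next
    case False
    then have "d \<notin> A \<or> p \<notin> cdom d" by blast
    from tspace_outside[OF w(1) this] tspace_outside[OF w(2) this] show ?thesis by simp
  qed
qed

lemma coord_vec_self:
  assumes A: "manifold (coord_space K) A" and c: "c \<in> A" "p \<in> cdom c" and e: "e \<in> coord_space K"
  shows "coord_vec A c p e c = e"
  using trans_deriv_eq_mder[OF A c(1,1,2,2) e] mder_id_self[OF A c] c e by (simp add: coord_vec_def)

lemma coord_vec_in_tspace:
  assumes A: "manifold (coord_space K) A" and c: "c \<in> A" "p \<in> cdom c" and e: "e \<in> coord_space K"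
  shows "coord_vec A c p e \<in> tspace (coord_space K) A p"
proof (rule tspaceI[OF A])
  note i = mdiff_id[OF A, of p]
  have cv: "coord_vec A c p e d = mder K c d (\<lambda>x. x) p e" if "d \<in> A" "p \<in> cdom d" for d
    using trans_deriv_eq_mder[OF A c(1) that(1) c(2) that(2) e] that by (simp add: coord_vec_def)
  show "coord_vec A c p e d = 0" if "d \<notin> A \<or> p \<notin> cdom d" for d using that by (auto simp: coord_vec_def)
  show "coord_vec A c p e d \<in> coord_space K" if "d \<in> A" "p \<in> cdom d" for d
    unfolding cv[OF that] by (rule mder_in_coord_space[OF i c(1) that(1) c(2) that(2) A])
  show "coord_vec A c p e d' = mder K d d' (\<lambda>x. x) p (coord_vec A c p e d)"
    if "d \<in> A" "d' \<in> A" "p \<in> cdom d" "p \<in> cdom d'" for d d'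
    using mdiff_compose(2)[OF i i A A c(1) that(1,2) c(2) that(3,4)] that by (simp add: cv)
qed

lemma tspace_eq_coord_vec:
  assumes A: "manifold (coord_space K) A" and c: "c \<in> A" "p \<in> cdom c"
    and w: "w \<in> tspace (coord_space K) A p"
  shows "w = coord_vec A c p (w c)"
  by (rule tspace_eqI[OF A w coord_vec_in_tspace[OF A c tspace_coord[OF w c]] c])
    (simp add: coord_vec_self[OF A c tspace_coord[OF w c]])

lemma tspace_lcomb2:
  assumes A: "manifold (coord_space K) A"
    and w: "w \<in> tspace (coord_space K) A p" "w' \<in> tspace (coord_space K) A p"
  shows "lcomb2 a w b w' \<in> tspace (coord_space K) A p"
proof (rule tspaceI[OF A])
  show "lcomb2 a w b w' c = 0" if "c \<notin> A \<or> p \<notin> cdom c" for c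
    using tspace_outside[OF w(1) that] tspace_outside[OF w(2) that] by (simp add: lcomb2_def)
  show "lcomb2 a w b w' c \<in> coord_space K" if "c \<in> A" "p \<in> cdom c" for c
    using tspace_coord[OF w(1) that] tspace_coord[OF w(2) that] subspace_coord_space[of K]
    by (simp add: lcomb2_def subspace_add subspace_scale)
  show "lcomb2 a w b w' d = mder K c d (\<lambda>x. x) p (lcomb2 a w b w' c)"
    if "c \<in> A" "d \<in> A" "p \<in> cdom c" "p \<in> cdom d" for c d
    using tspace_trans[OF A w(1) that] tspace_trans[OF A w(2) that] mder_linear[OF mdiff_id[OF A] that]
    by (simp add: lcomb2_def linear_add linear_scale)
qed

lemma zero_in_tspace: assumes A: "manifold (coord_space K) A" shows "(\<lambda>c. 0) \<in> tspace (coord_space K) A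
    p"
  by (rule tspaceI[OF A]) (auto simp: coord_space_def linear_0[OF mder_linear[OF mdiff_id[OF A]]])

text \<open>The alternative \<open>r $ \<alpha> = 0\<close> admits families that are prescribed only
  on part of the index type, such as \<open>bas\<close> outside \<open>iK\<close>.\<close>

lemma lcomb_in_tspace:
  assumes A: "manifold (coord_space K) A"
    and F: "\<And>\<alpha>. r $ \<alpha> = 0 \<or> F \<alpha> \<in> tspace (coord_space K) A p"
  shows "lcomb r F \<in> tspace (coord_space K) A p"
proof -
  have "(\<lambda>c. \<Sum>\<alpha>\<in>I. (r $ \<alpha>) *\<^sub>R F \<alpha> c) \<in> tspace (coord_space K) A p" if "finite I" for I
    using that
  proof (induction I)
    case empty
    then show ?case using zero_in_tspace[OF A] by simp
  next
    case (insert \<alpha> I)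
    let ?s = "\<lambda>c. \<Sum>\<alpha>\<in>I. (r $ \<alpha>) *\<^sub>R F \<alpha> c"
    have "(\<lambda>c. \<Sum>\<alpha>\<in>insert \<alpha> I. (r $ \<alpha>) *\<^sub>R F \<alpha> c) =
      (if r $ \<alpha> = 0 then ?s else lcomb2 (r $ \<alpha>) (F \<alpha>) 1 ?s)"
      using insert.hyps by (auto simp: lcomb2_def fun_eq_iff)
    then show ?case using F[of \<alpha>] insert.IH tspace_lcomb2[OF A] by auto
  qed
  then show ?thesis by (simp add: lcomb_def)
qed

section \<open>Tangent maps, differentials and velocities\<close>

text \<open>Removes the dependence on \<open>chart_at\<close>: the transition derivative produced by
  the chain rule is the one in the transformation law of \<open>w\<close>, so any chart around
  \<open>p\<close> computes the tangent map.\<close>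

lemma tangent_map_eq_mder:
  assumes A: "manifold (coord_space K) A" and f: "mdiff K A B f p"
    and w: "w \<in> tspace (coord_space K) A p"
    and c: "c \<in> A" "d \<in> B" "p \<in> cdom c" "f p \<in> cdom d"
  shows "tangent_map A B f p w d = mder K c d f p (w c)"
proof -
  let ?c = "chart_at A p"
  note c0 = manifold_chart_at[OF A, of p]
  have "tangent_map A B f p w d = mder K ?c d f p (w ?c)"
    using mder_within[OF A f c0(1) c(2) c0(2) c(4) tspace_coord[OF w c0]] c
    by (simp add: tangent_map_def Let_def)
  also have "\<dots> = mder K c d f p (w c)"
    using mdiff_compose(2)[OF mdiff_id[OF A] f A A c(1) c0(1) c(2,3) c0(2) c(4)]
      tspace_trans[OF A w c(1) c0(1) c(3) c0(2)] by simp
  finally show ?thesis .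
qed

lemma tangent_map_in_tspace:
  assumes A: "manifold (coord_space K) A" and B: "manifold (coord_space K') B" and f: "mdiff K A B f p"
    and w: "w \<in> tspace (coord_space K) A p"
  shows "tangent_map A B f p w \<in> tspace (coord_space K') B (f p)"
proof (rule tspaceI[OF B])
  note c0 = manifold_chart_at[OF A, of p]
  show "tangent_map A B f p w d = 0" if "d \<notin> B \<or> f p \<notin> cdom d" for d
    using that by (auto simp: tangent_map_def)
  show "tangent_map A B f p w d \<in> coord_space K'" if "d \<in> B" "f p \<in> cdom d" for d
    using tangent_map_eq_mder[OF A f w c0(1) that(1) c0(2) that(2)]
      mder_in_coord_space[OF f c0(1) that(1) c0(2) that(2) B] by simp
  show "tangent_map A B f p w d' = mder K' d d' (\<lambda>x. x) (f p) (tangent_map A B f p w d)"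
    if d: "d \<in> B" "d' \<in> B" "f p \<in> cdom d" "f p \<in> cdom d'" for d d'
    using mdiff_compose(2)[OF f mdiff_id[OF B] A B c0(1) d(1,2) c0(2) d(3,4)]
      tangent_map_eq_mder[OF A f w c0(1) d(1) c0(2) d(3)] tangent_map_eq_mder[OF A f w c0(1) d(2) c0(2)
          d(4)]
    by simp
qed

lemma tangent_map_lcomb2:
  assumes A: "manifold (coord_space K) A" and f: "mdiff K A B f p"
    and w: "w \<in> tspace (coord_space K) A p" "w' \<in> tspace (coord_space K) A p"
  shows "tangent_map A B f p (lcomb2 a w b w') = lcomb2 a (tangent_map A B f p w) b (tangent_map A B f
      p w')"
proof
  fix d
  note c0 = manifold_chart_at[OF A, of p]
  show "tangent_map A B f p (lcomb2 a w b w') d = lcomb2 a (tangent_map A B f p w) b (tangent_map A B f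
      p w') d"
  proof (cases "d \<in> B \<and> f p \<in> cdom d")
    case True
    then show ?thesis
      using tangent_map_eq_mder[OF A f w(1) c0(1) _ c0(2)] tangent_map_eq_mder[OF A f w(2) c0(1) _
          c0(2)]
        tangent_map_eq_mder[OF A f tspace_lcomb2[OF A w] c0(1) _ c0(2)] mder_linear[OF f c0(1) _ c0(2)]
      by (simp add: lcomb2_def linear_add linear_scale)
  next
    case False
    then show ?thesis by (auto simp: tangent_map_def lcomb2_def)
  qed
qed

lemma tangent_map_compose:
  assumes A: "manifold (coord_space K) A" and B: "manifold (coord_space K') B"
    and f: "mdiff K A B f p" and g: "mdiff K' B C g (f p)" and w: "w \<in> tspace (coord_space K) A p"
  shows "tangent_map A C (\<lambda>x. g (f x)) p w = tangent_map B C g (f p) (tangent_map A B f p w)"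
proof
  fix e
  note c0 = manifold_chart_at[OF A, of p] and d0 = manifold_chart_at[OF B, of "f p"]
  show "tangent_map A C (\<lambda>x. g (f x)) p w e = tangent_map B C g (f p) (tangent_map A B f p w) e"
  proof (cases "e \<in> C \<and> g (f p) \<in> cdom e")
    case True
    then have e: "e \<in> C" "g (f p) \<in> cdom e" by auto
    show ?thesis
      using tangent_map_eq_mder[OF A mdiff_compose(1)[OF f g A B] w c0(1) e(1) c0(2) e(2)]
        tangent_map_eq_mder[OF B g tangent_map_in_tspace[OF A B f w] d0(1) e(1) d0(2) e(2)]
        tangent_map_eq_mder[OF A f w c0(1) d0(1) c0(2) d0(2)]
        mdiff_compose(2)[OF f g A B c0(1) d0(1) e(1) c0(2) d0(2) e(2)]
      by simp
  next
    case False
    then show ?thesis by (auto simp: tangent_map_def)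
  qed
qed

lemma tangent_map_id:
  assumes A: "manifold (coord_space K) A" and w: "w \<in> tspace (coord_space K) A p"
  shows "tangent_map A A (\<lambda>x. x) p w = w"
proof (rule tspace_eqI[OF A tangent_map_in_tspace[OF A A mdiff_id[OF A] w] w manifold_chart_at[OF A]])
  note c0 = manifold_chart_at[OF A, of p]
  show "tangent_map A A (\<lambda>x. x) p w (chart_at A p) = w (chart_at A p)"
    using tangent_map_eq_mder[OF A mdiff_id[OF A] w c0(1,1,2,2)] mder_id_self[OF A c0] tspace_coord[OF
        w c0]
    by simp
qed

lemma transition_has_derivative:
  fixes A :: "('p::{t2_space, second_countable_topology}, real ^ 'm::finite) atlas"
  assumes A: "manifold UNIV A" and c: "c \<in> A" "d \<in> A" "p \<in> cdom c" "p \<in> cdom d"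
  shows "((\<lambda>y. cmap d (cinv c y)) has_derivative mder UNIV c d (\<lambda>x. x) p) (at (cmap c p))"
    "\<forall>\<^sub>F y in nhds (cmap c p). y \<in> cmap c ` cdom c \<and> cinv c y \<in> cdom c \<and> cmap c (cinv c y) = y \<and> cinv c
        y \<in> cdom d"
proof -
  note A' = A[folded coord_space_UNIV]
  show "((\<lambda>y. cmap d (cinv c y)) has_derivative mder UNIV c d (\<lambda>x. x) p) (at (cmap c p))"
    using mdiff_mder[OF mdiff_id[OF A'] c] by simp
  show "\<forall>\<^sub>F y in nhds (cmap c p). y \<in> cmap c ` cdom c \<and> cinv c y \<in> cdom c \<and> cmap c (cinv c y) = y \<and>
      cinv c y \<in> cdom d"
    using mdiff_eventually[OF mdiff_id[OF A'] c]
        by eventually_elim (auto simp: inv_into_into f_inv_into_f)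
qed

lemma open_chart_image:
  fixes A :: "('p::{t2_space, second_countable_topology}, real ^ 'm::finite) atlas"
  assumes A: "manifold UNIV A" and c: "c \<in> A" shows "open (cmap c ` cdom c)"
  using is_chart_open_vdom[of UNIV c] manifold_is_chart[OF A c] by simp

lemma differential_eq:
  fixes A :: "('p::{t2_space, second_countable_topology}, real ^ 'm::finite) atlas"
  assumes A: "manifold UNIV A" and c: "c \<in> A" "p \<in> cdom c" and w: "w \<in> tspace UNIV A p"
    and f: "((\<lambda>y. f (cinv c y)) has_derivative F) (at (cmap c p))"
  shows "differential A f p w = F (w c)"
proof -
  let ?c = "chart_at A p"
  note c0 = manifold_chart_at[OF A, of p]
  note ch = manifold_is_chart[OF A c(1)] manifold_is_chart[OF A c0(1)]
  have "cinv ?c (cmap ?c p) = p" by (rule is_chart_cinv[OF ch(2) c0(2)])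
  then have "((\<lambda>y. f (cinv c y)) has_derivative F) (at (cmap c (cinv ?c (cmap ?c p))))" using f by simp
  from has_derivative_compose[OF transition_has_derivative(1)[OF A c0(1) c(1) c0(2) c(2)] this]
  have "((\<lambda>y. f (cinv ?c y)) has_derivative (\<lambda>e. F (mder UNIV ?c c (\<lambda>x. x) p e))) (at (cmap ?c p))"
  proof (rule has_derivative_transform_nhds)
    show "\<forall>\<^sub>F y in nhds (cmap ?c p). f (cinv c (cmap c (cinv ?c y))) = f (cinv ?c y)"
      using transition_has_derivative(2)[OF A c0(1) c(1) c0(2) c(2)]
      by eventually_elim (simp add: is_chart_cinv[OF ch(1)])
  qed
  note D = frechet_derivative_at[OF this, symmetric]
  have W: "w c = mder UNIV ?c c (\<lambda>x. x) p (w ?c)"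
    by (rule tspace_trans[of UNIV A w p]) (use A w c c0 in auto)
  have "at (cmap ?c p) within cmap ?c ` cdom ?c = at (cmap ?c p)"
    by (rule at_within_open[OF imageI[OF c0(2)] open_chart_image[OF A c0(1)]])
  then show ?thesis by (simp add: differential_def Let_def o_def D W)
qed

text \<open>One chart suffices, since transition maps carry the derivative to all others. Continuity
  is asked for separately because \<open>cmap c\<close> is total: differentiability of the
  coordinate expression alone does not keep \<open>\<sigma>\<close> in the domain of the
  chart.\<close>

lemma velocity_eq:
  fixes A :: "('p::{t2_space, second_countable_topology}, real ^ 'm::finite) atlas"
  assumes A: "manifold UNIV A" and c: "c \<in> A" "\<sigma> t \<in> cdom c" and \<sigma>: "isCont \<sigma> t"
    and D: "((\<lambda>s. cmap c (\<sigma> s)) has_vector_derivative e) (at t)"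
  shows "velocity A \<sigma> t = coord_vec A c (\<sigma> t) e"
proof
  fix d
  show "velocity A \<sigma> t d = coord_vec A c (\<sigma> t) e d"
  proof (cases "d \<in> A \<and> \<sigma> t \<in> cdom d")
    case True
    then have d: "d \<in> A" "\<sigma> t \<in> cdom d" by auto
    note ch = manifold_is_chart[OF A c(1)]
    have "(\<sigma> \<longlongrightarrow> \<sigma> t) (nhds t)"
      using \<sigma> unfolding isCont_def by (subst tendsto_at_iff_tendsto_nhds[symmetric])
    then have "\<forall>\<^sub>F s in nhds t. \<sigma> s \<in> cdom c"
      by (rule topological_tendstoD[OF _ is_chart_open[OF ch] c(2)])
    then have ev: "\<forall>\<^sub>F s in nhds t. cmap d (cinv c (cmap c (\<sigma> s))) = cmap d (\<sigma> s)"
      by eventually_elim (simp add: is_chart_cinv[OF ch])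
    have "((\<lambda>s. cmap d (cinv c (cmap c (\<sigma> s)))) has_derivative (\<lambda>h. mder UNIV c d (\<lambda>x. x) (\<sigma> t) (h *\<^sub>R
        e))) (at t)"
      using has_derivative_compose[OF D[unfolded has_vector_derivative_def]
          transition_has_derivative(1)[OF A c(1) d(1) c(2) d(2)]] .
    from has_derivative_transform_nhds[OF this ev]
    have "((\<lambda>s. cmap d (\<sigma> s)) has_vector_derivative mder UNIV c d (\<lambda>x. x) (\<sigma> t) e) (at t)"
      using mder_linear[OF mdiff_id[of UNIV A "\<sigma> t"] c(1) d(1) c(2) d(2)] A
      by (simp add: has_vector_derivative_def linear_scale)
    then show ?thesis
      using trans_deriv_eq_mder[of UNIV A c d "\<sigma> t" e] A c d
      by (simp add: velocity_def coord_vec_def o_def vector_derivative_at)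
  next
    case False
    then show ?thesis by (auto simp: velocity_def coord_vec_def)
  qed
qed

section \<open>The Lie bracket is a tangent vector\<close>

lemma eventually_chart:
  fixes A :: "('p::{t2_space, second_countable_topology}, real ^ 'm::finite) atlas"
  assumes A: "manifold UNIV A" and c: "c \<in> A" "q \<in> cdom c" and W: "open W" "q \<in> W"
  shows "\<forall>\<^sub>F y in nhds (cmap c q). cinv c y \<in> W"
proof -
  note ch = manifold_is_chart[OF A c(1)]
  have "open (cmap c ` cdom c \<inter> cinv c -` W)"
    by (rule continuous_open_preimage[OF is_chart_continuous_inv[OF ch] open_chart_image[OF A c(1)]
        W(1)])
  moreover have "cmap c q \<in> cmap c ` cdom c \<inter> cinv c -` W"
    using c W is_chart_cinv[OF ch c(2)] by auto
  ultimately show ?thesis unfolding eventually_nhds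
      by (intro exI[of _ "cmap c ` cdom c \<inter> cinv c -` W"]) simp
qed

definition mder2 ::
  "('p, real ^ 'm::finite) chart \<Rightarrow> ('r, real ^ 'm) chart \<Rightarrow> ('p \<Rightarrow> 'r) \<Rightarrow> 'p \<Rightarrow> real ^ 'm \<Rightarrow> real ^ 'm \<Rightarrow>
      real ^ 'm" where
  "mder2 c d f p e =
    frechet_derivative (\<lambda>y. frechet_derivative (\<lambda>y. cmap d (f (cinv c y))) (at y) e) (at (cmap c p))"

lemma mder2:
  assumes U: "open U" "cmap c p \<in> U" and C2: "C2_on (\<lambda>y. cmap d (f (cinv c y))) U"
  shows "((\<lambda>y. frechet_derivative (\<lambda>y. cmap d (f (cinv c y))) (at y) e) has_derivative mder2 c d f p e)
      (at (cmap c p))"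
    and "mder2 c d f p a b = mder2 c d f p b a"
    and "(\<Sum>b\<in>Basis. (e \<bullet> b) *\<^sub>R mder2 c d f p b v) = mder2 c d f p e v"
proof -
  let ?f = "\<lambda>y. cmap d (f (cinv c y))"
  have D: "((\<lambda>y. frechet_derivative ?f (at y) e) has_derivative mder2 c d f p e) (at (cmap c p))" for e
    using C1_on_differentiable[OF C2_on_frechet_derivative[OF C2 U(1)] U(2), of e]
    unfolding mder2_def frechet_derivative_works .
  show "((\<lambda>y. frechet_derivative ?f (at y) e) has_derivative mder2 c d f p e) (at (cmap c p))"
      by (rule D)
  have f: "(?f has_derivative frechet_derivative ?f (at y)) (at y)" if "y \<in> U" for y
    using C2_on_differentiable[OF C2 that] unfolding frechet_derivative_works .
  have sym: "mder2 c d f p a b = mder2 c d f p b a" for a b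
    by (rule symmetric_second_frechet_derivative[OF U f D D])
  then show "mder2 c d f p a b = mder2 c d f p b a" .
  show "(\<Sum>b\<in>Basis. (e \<bullet> b) *\<^sub>R mder2 c d f p b v) = mder2 c d f p e v"
    \<comment> \<open>Linearity of \<open>mder2\<close> is evident only in its last argument, which
      is the direction of a derivative; symmetry moves it to the argument that is expanded.\<close>
    using linear_sum_Basis[OF has_derivative_linear[OF D], of v e] sym[of v] by simp
qed

text \<open>The fields \<open>X\<close> and \<open>X'\<close> are related by the diffeomorphism \<open>f\<close>. The case of the identity is the
  change of charts; for the action of a group element it gives the equivariance of brackets.\<close>

lemma field_rep_related:
  fixes A :: "('p::{t2_space, second_countable_topology}, real ^ 'm::finite) atlas"
  assumes A: "manifold UNIV A" and c: "c \<in> A" "d \<in> A" "q \<in> cdom c" "f q \<in> cdom d"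
    and f: "\<forall>r. mdiff UNIV A A f r" and g: "\<forall>r. mdiff UNIV A A g r"
        and inv: "\<forall>r. g (f r) = r" "\<forall>r. f (g r) = r"
    and C2: "\<exists>U. open U \<and> cmap c q \<in> U \<and> C2_on (\<lambda>y. cmap d (f (cinv c y))) U"
    and W: "open W" "q \<in> W"
    and X: "\<forall>r\<in>W. r \<in> cdom c \<longrightarrow> f r \<in> cdom d \<longrightarrow> X' (f r) d = mder UNIV c d f r (X r c)"
    and D: "(field_rep X c has_derivative D) (at (cmap c q))"
  shows "\<exists>D'. (field_rep X' d has_derivative D') (at (cmap d (f q))) \<and>
    (\<forall>v. D' (mder UNIV c d f q v) = mder UNIV c d f q (D v) + mder2 c d f q (X q c) v)"
proof -
  note A' = A[folded coord_space_UNIV]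
  let ?f = "\<lambda>y. cmap d (f (cinv c y))"
  let ?M = "mder UNIV c d f q" and ?M' = "mder UNIV d c g (f q)"
  note chc = manifold_is_chart[OF A c(1)] and chd = manifold_is_chart[OF A c(2)]
  have q: "cinv c (cmap c q) = q" "cinv d (cmap d (f q)) = f q"
    using is_chart_cinv[OF chc c(3)] is_chart_cinv[OF chd c(4)] .
  have gq: "g (f q) \<in> cdom c" using c inv by simp
  obtain U where U: "open U" "cmap c q \<in> U" "C2_on ?f U" using C2 by (elim exE conjE)
  \<comment> \<open>The image of \<open>X\<close> under the derivative of \<open>f\<close>, as a
    function of the coordinates of the source point. Expanding over the basis makes it a sum of
    products, whose differentiation produces the second derivative \<open>mder2\<close>.\<close>
  define H where "H = (\<lambda>y. \<Sum>b\<in>Basis. (field_rep X c y \<bullet> b) *\<^sub>R frechet_derivative ?f (at y) b)"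
  define H' where "H' = (\<lambda>v. ?M (D v) + mder2 c d f q (X q c) v)"
  have M0: "frechet_derivative ?f (at (cmap c q)) = ?M" by (simp add: mder_def)
  have Mlin: "linear ?M" by (rule mder_linear[OF f[rule_format] c])
  have "(H has_derivative (\<lambda>v. \<Sum>b\<in>Basis. (field_rep X c (cmap c q) \<bullet> b) *\<^sub>R mder2 c d f q b v
      + (D v \<bullet> b) *\<^sub>R frechet_derivative ?f (at (cmap c q)) b)) (at (cmap c q))"
    unfolding H_def
    by (intro has_derivative_sum has_derivative_scaleR has_derivative_inner_left D mder2(1)[OF U])
  moreover have "(\<lambda>v. \<Sum>b\<in>Basis. (field_rep X c (cmap c q) \<bullet> b) *\<^sub>R mder2 c d f q b v
      + (D v \<bullet> b) *\<^sub>R frechet_derivative ?f (at (cmap c q)) b) = H'"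
    using mder2(3)[OF U, of "X q c"] linear_sum_Basis[OF Mlin, symmetric]
    by (simp add: H'_def sum.distrib M0 field_rep_def q add.commute)
  ultimately have H: "(H has_derivative H') (at (cmap c (g (cinv d (cmap d (f q))))))"
      by (simp only: q inv)
  have G: "((\<lambda>z. cmap c (g (cinv d z))) has_derivative ?M') (at (cmap d (f q)))"
    using mdiff_mder[OF g[rule_format] c(2,1,4) gq] by (simp only: pull_UNIV)
  have "((\<lambda>z. H (cmap c (g (cinv d z)))) has_derivative (\<lambda>v. H' (?M' v))) (at (cmap d (f q)))"
    by (rule has_derivative_compose[OF G H])
  then have "(field_rep X' d has_derivative (\<lambda>v. H' (?M' v))) (at (cmap d (f q)))"
  proof (rule has_derivative_transform_nhds)
    have "((\<lambda>z. cmap c (g (cinv d z))) \<longlongrightarrow> cmap c (g (cinv d (cmap d (f q))))) (nhds (cmap d (f q)))"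
      using has_derivative_continuous[OF G] unfolding isCont_def
      by (subst tendsto_at_iff_tendsto_nhds[symmetric])
    then have lim: "filterlim (\<lambda>z. cmap c (g (cinv d z))) (nhds (cmap c q)) (nhds (cmap d (f q)))"
      by (simp add: q inv)
    show "\<forall>\<^sub>F z in nhds (cmap d (f q)). H (cmap c (g (cinv d z))) = field_rep X' d z"
      using mdiff_eventually[OF g[rule_format] c(2,1,4) gq] eventually_compose_filterlim[OF
          eventually_chart[OF A c(1,3) W] lim]
    proof eventually_elim
      case (elim z)
      let ?r = "g (cinv d z)"
      have fr: "f ?r = cinv d z" using inv by simp
      have r: "?r \<in> cdom c" "f ?r \<in> cdom d" using elim by (simp_all add: inv inv_into_into)
      have i: "cinv c (cmap c ?r) = ?r" by (rule is_chart_cinv[OF chc r(1)])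
      then have W: "?r \<in> W" using elim by simp
      have lin: "linear (mder UNIV c d f ?r)" by (rule mder_linear[OF f[rule_format] c(1,2) r])
      have "X' (f ?r) d = mder UNIV c d f ?r (X ?r c)" using X W r by blast
      also have "\<dots> = H (cmap c ?r)"
        using linear_sum_Basis[OF lin, of "X ?r c"] by (simp add: H_def field_rep_def i mder_def)
      finally show ?case by (simp add: field_rep_def inv)
    qed
  qed
  \<comment> \<open>The derivative found so far is expressed through the inverse map
    \<open>g\<close>; since \<open>g (f x) = x\<close>, it becomes explicit on directions of the
    form \<open>?M v\<close>.\<close>
  moreover have "?M' (?M v) = v" for v
  proof -
    have "mder UNIV c c (\<lambda>x. g (f x)) q = (\<lambda>v. ?M' (?M v))"
      by (rule mdiff_compose(2)[OF f[rule_format] g[rule_format] A' A' c(1,2,1,3,4) gq])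
    moreover have "(\<lambda>x. g (f x)) = (\<lambda>x. x)" using inv by simp
    ultimately show ?thesis using fun_cong[of _ _ v] mder_id_self[OF A' c(1,3), of v] by simp
  qed
  ultimately show ?thesis by (intro exI[of _ "\<lambda>v. H' (?M' v)"]) (simp add: H'_def)
qed

text \<open>The second-derivative terms in the transformation of the two fields are
  \<open>mder2\<close> in \<open>X, Y\<close> and in \<open>Y, X\<close>; by symmetry they cancel in
  the bracket.\<close>

lemma lie_bracket_related:
  fixes A :: "('p::{t2_space, second_countable_topology}, real ^ 'm::finite) atlas"
  assumes A: "manifold UNIV A" and c: "c \<in> A" "d \<in> A" "q \<in> cdom c" "f q \<in> cdom d"
    and f: "\<forall>r. mdiff UNIV A A f r" and g: "\<forall>r. mdiff UNIV A A g r"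
        and inv: "\<forall>r. g (f r) = r" "\<forall>r. f (g r) = r"
    and C2: "\<exists>U. open U \<and> cmap c q \<in> U \<and> C2_on (\<lambda>y. cmap d (f (cinv c y))) U"
    and W: "open W" "q \<in> W"
    and X: "\<forall>r\<in>W. r \<in> cdom c \<longrightarrow> f r \<in> cdom d \<longrightarrow> X' (f r) d = mder UNIV c d f r (X r c)"
      "field_rep X c differentiable (at (cmap c q))"
    and Y: "\<forall>r\<in>W. r \<in> cdom c \<longrightarrow> f r \<in> cdom d \<longrightarrow> Y' (f r) d = mder UNIV c d f r (Y r c)"
      "field_rep Y c differentiable (at (cmap c q))"
  shows "lie_bracket A X' Y' (f q) d = mder UNIV c d f q (lie_bracket A X Y q c)"
proof -
  let ?M = "mder UNIV c d f q"
  note rel = field_rep_related[OF A c f g inv C2 W]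
  obtain U where U: "open U" "cmap c q \<in> U" "C2_on (\<lambda>y. cmap d (f (cinv c y))) U" using C2
      by (elim exE conjE)
  obtain DX where DX: "(field_rep X' d has_derivative DX) (at (cmap d (f q)))"
    "\<forall>v. DX (?M v) = ?M (frechet_derivative (field_rep X c) (at (cmap c q)) v) + mder2 c d f q (X q c)
        v"
    using rel[where X = X and X' = X', OF X(1) X(2)[unfolded frechet_derivative_works]]
        by (elim exE conjE)
  obtain DY where DY: "(field_rep Y' d has_derivative DY) (at (cmap d (f q)))"
    "\<forall>v. DY (?M v) = ?M (frechet_derivative (field_rep Y c) (at (cmap c q)) v) + mder2 c d f q (Y q c)
        v"
    using rel[where X = Y and X' = Y', OF Y(1) Y(2)[unfolded frechet_derivative_works]]
        by (elim exE conjE)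
  have XY: "X' (f q) d = ?M (X q c)" "Y' (f q) d = ?M (Y q c)"
    using X(1) Y(1) W(2) c by blast+
  show ?thesis
    using c mder2(2)[OF U, of "X q c" "Y q c"] linear_diff[OF mder_linear[OF f[rule_format] c]]
    by (simp add: lie_bracket_def XY DX(2)[rule_format] DY(2)[rule_format] frechet_derivative_at[OF
        DX(1), symmetric]
        frechet_derivative_at[OF DY(1), symmetric])
qed

lemma transition_nhd:
  fixes A :: "('p::{t2_space, second_countable_topology}, real ^ 'm::finite) atlas"
  assumes A: "manifold UNIV A" and c: "c \<in> A" "d \<in> A" "p \<in> cdom c" "p \<in> cdom d"
  shows "\<exists>U. open U \<and> cmap c p \<in> U \<and> C2_on (\<lambda>y. cmap d (cinv c y)) U"
  using transition_C2_on[OF A[folded coord_space_UNIV] c] unfolding vdom_UNIV pull_UNIV by blast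

lemma field_rep_differentiable_change:
  fixes A :: "('p::{t2_space, second_countable_topology}, real ^ 'm::finite) atlas"
  assumes A: "manifold UNIV A" and c: "c \<in> A" "d \<in> A" "q \<in> cdom c" "q \<in> cdom d"
    and W: "open W" "q \<in> W" and X: "\<forall>r\<in>W. X r \<in> tspace UNIV A r"
    and D: "field_rep X c differentiable (at (cmap c q))"
  shows "field_rep X d differentiable (at (cmap d q))"
proof -
  note A' = A[folded coord_space_UNIV]
  have i: "\<forall>r. mdiff UNIV A A (\<lambda>x. x) r" using mdiff_id[OF A'] by blast
  have X': "\<forall>r\<in>W. r \<in> cdom c \<longrightarrow> r \<in> cdom d \<longrightarrow> X r d = mder UNIV c d (\<lambda>x. x) r (X r c)"
    using tspace_trans[OF A' _ c(1,2)] X by simp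
  show ?thesis
    using field_rep_related[where f = "\<lambda>x. x" and g = "\<lambda>x. x" and X = X
        and X' = X, OF A c i i _ _ transition_nhd[OF A c] W X'
        D[unfolded frechet_derivative_works]] by (auto intro: differentiableI)
qed

text \<open>The coordinate formula of the bracket obeys the transformation law because any vector
  field is related to itself by the identity map.\<close>

lemma lie_bracket_in_tspace:
  fixes A :: "('p::{t2_space, second_countable_topology}, real ^ 'm::finite) atlas"
  assumes A: "manifold UNIV A" and c: "c \<in> A" "q \<in> cdom c" and W: "open W" "q \<in> W"
    and X: "\<forall>r\<in>W. X r \<in> tspace UNIV A r" "field_rep X c differentiable (at (cmap c q))"
    and Y: "\<forall>r\<in>W. Y r \<in> tspace UNIV A r" "field_rep Y c differentiable (at (cmap c q))"
  shows "lie_bracket A X Y q \<in> tspace UNIV A q"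
proof -
  note A' = A[folded coord_space_UNIV]
  have i: "\<forall>r. mdiff UNIV A A (\<lambda>x. x) r" using mdiff_id[OF A'] by blast
  have "lie_bracket A X Y q \<in> tspace (coord_space UNIV) A q"
  proof (rule tspaceI[OF A'])
    show "lie_bracket A X Y q d = 0" if "d \<notin> A \<or> q \<notin> cdom d" for d using that
        by (auto simp: lie_bracket_def)
    fix d e assume d: "d \<in> A" "e \<in> A" "q \<in> cdom d" "q \<in> cdom e"
    have "\<forall>r\<in>W. r \<in> cdom d \<longrightarrow> r \<in> cdom e \<longrightarrow> X r e = mder UNIV d e (\<lambda>x. x) r (X r d)"
      "\<forall>r\<in>W. r \<in> cdom d \<longrightarrow> r \<in> cdom e \<longrightarrow> Y r e = mder UNIV d e (\<lambda>x. x) r (Y r d)"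
      using tspace_trans[OF A' _ d(1,2)] X(1) Y(1) by simp_all
    then show "lie_bracket A X Y q e = mder UNIV d e (\<lambda>x. x) q (lie_bracket A X Y q d)"
      using lie_bracket_related[where f = "\<lambda>x. x" and g = "\<lambda>x. x" and X = X and X' = X and Y = Y
          and Y' = Y, OF A d i i _ _ transition_nhd[OF A d] W _
        field_rep_differentiable_change[OF A c(1) d(1) c(2) d(3) W X] _
        field_rep_differentiable_change[OF A c(1) d(1) c(2) d(3) W Y]] by simp
  qed simp
  then show ?thesis by simp
qed

section \<open>Linearity on finite combinations, partial maps and derivatives along lines\<close>

lemma lcomb_hom:
  fixes F :: "'k::finite \<Rightarrow> ('p::{t2_space, second_countable_topology}, real ^ 'm::finite) tvec"
  assumes A: "manifold (coord_space K) A"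
    and T: "\<forall>u\<in>tspace (coord_space K) A p. \<forall>w\<in>tspace (coord_space K) A p. \<forall>a b.
      T (lcomb2 a u b w) = lcomb2 a (T u) b (T w)"
    and F: "\<And>\<alpha>. r $ \<alpha> = 0 \<or> F \<alpha> \<in> tspace (coord_space K) A p"
  shows "T (lcomb r F) = lcomb r (\<lambda>\<alpha>. T (F \<alpha>))"
proof -
  let ?S = "tspace (coord_space K) A p"
  have "(\<lambda>c. \<Sum>\<alpha>\<in>I. (r $ \<alpha>) *\<^sub>R F \<alpha> c) \<in> ?S \<and>
    T (\<lambda>c. \<Sum>\<alpha>\<in>I. (r $ \<alpha>) *\<^sub>R F \<alpha> c) = (\<lambda>c. \<Sum>\<alpha>\<in>I. (r $ \<alpha>) *\<^sub>R T (F \<alpha>) c)" if "finite I" for I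
    using that
  proof (induction I)
    case empty
    note z = zero_in_tspace[OF A, of p]
    \<comment> \<open>The empty sum is the zero vector, and linearity with both coefficients 0 shows
      that \<open>T\<close> maps it to zero.\<close>
    have "T (lcomb2 0 (\<lambda>c. 0) 0 (\<lambda>c. 0)) = lcomb2 0 (T (\<lambda>c. 0)) 0 (T (\<lambda>c. 0))" using T z by blast
    with z show ?case by (simp add: lcomb2_def)
  next
    case (insert \<alpha> I)
    let ?s = "\<lambda>c. \<Sum>\<alpha>\<in>I. (r $ \<alpha>) *\<^sub>R F \<alpha> c"
    show ?case
    proof (cases "r $ \<alpha> = 0")
      case True
      then show ?thesis using insert by simp
    next
      case False
      then have "F \<alpha> \<in> ?S" using F by blast
      moreover have "?s \<in> ?S" using insert by blast
      ultimately have "T (lcomb2 (r $ \<alpha>) (F \<alpha>) 1 ?s) = lcomb2 (r $ \<alpha>) (T (F \<alpha>)) 1 (T ?s)"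
        "lcomb2 (r $ \<alpha>) (F \<alpha>) 1 ?s \<in> ?S"
        using T tspace_lcomb2[OF A] by blast+
      then show ?thesis using insert by (simp add: lcomb2_def)
    qed
  qed
  from this[OF finite] show ?thesis by (simp add: lcomb_def)
qed

lemma functional_on_lcomb:
  fixes F :: "'k::finite \<Rightarrow> ('p::{t2_space, second_countable_topology}, real ^ 'm::finite) tvec"
  assumes A: "manifold (coord_space K) A" and T: "functional_on (tspace (coord_space K) A p) f"
    and F: "\<And>\<alpha>. r $ \<alpha> = 0 \<or> F \<alpha> \<in> tspace (coord_space K) A p"
  shows "f (lcomb r F) = (\<Sum>\<alpha>\<in>UNIV. r $ \<alpha> * f (F \<alpha>))"
proof -
  \<comment> \<open>Real values are viewed as constant families over a dummy chart type, so that the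
    result for vector-valued maps applies to functionals.\<close>
  let ?S = "tspace (coord_space K) A p" and ?T = "\<lambda>u (c :: (unit, real) chart). f u"
  have "\<forall>u\<in>?S. \<forall>w\<in>?S. \<forall>a b. ?T (lcomb2 a u b w) = lcomb2 a (?T u) b (?T w)"
    using T unfolding functional_on_def by (simp add: lcomb2_def)
  from lcomb_hom[where T = ?T, OF A this F] show ?thesis by (simp add: lcomb_def fun_eq_iff)
qed

lemma proj_sum_axis: "proj K r = (\<Sum>\<alpha>\<in>K. (r $ \<alpha>) *\<^sub>R axis \<alpha> 1)"
  by (auto simp: vec_eq_iff axis_def if_distrib[of "\<lambda>x. _ * x"] cong: if_cong)

lemma mdiff_smooth_map2:
  assumes A: "manifold (coord_space K) A" and A': "manifold (coord_space K') A'" and B: "manifold V B"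
    and f: "smooth_map2 A A' B f"
  shows "mdiff K A B (\<lambda>x. f x p') p" "mdiff K' A' B (\<lambda>x. f p x) p'"
proof -
  note c0 = manifold_chart_at[OF A, of p] and c0' = manifold_chart_at[OF A', of p']
  show "mdiff K A B (\<lambda>x. f x p') p" unfolding mdiff_def
  proof (intro ballI impI)
    fix c d assume c: "c \<in> A" "d \<in> B" "p \<in> cdom c" "f p p' \<in> cdom d"
    let ?c' = "chart_at A' p'"
    obtain U where U: "open U" "(cmap c p, cmap ?c' p') \<in> U" "U \<subseteq> vdom K c \<times> vdom K' ?c'"
      "\<forall>(y, z)\<in>U. f (pull K c y) (pull K' ?c' z) \<in> cdom d"
      "C2_on (\<lambda>(y, z). cmap d (f (pull K c y) (pull K' ?c' z))) U"
      using smooth_map2_C2_on[OF A A' B f c(1) c0'(1) c(2,3) c0'(2) c(4)] by (elim exE conjE)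
    have p': "pull K' ?c' (cmap ?c' p') = p'"
        by (rule is_chart_pull[OF manifold_is_chart[OF A' c0'(1)] c0'(2)])
    let ?j = "\<lambda>y. (y, cmap ?c' p')"
    have "?j differentiable (at (cmap c p))"
      by (rule differentiableI[OF has_derivative_Pair[OF has_derivative_ident has_derivative_const]])
    from differentiable_chain_at[OF this C2_on_differentiable[OF U(5,2)]]
    have "(\<lambda>y. cmap d (f (pull K c y) p')) differentiable (at (cmap c p))" by (simp add: o_def p')
    moreover have "open (?j -` U)" by (rule open_vimage[OF U(1)]) (intro continuous_intros)
    moreover have "y \<in> vdom K c \<and> f (pull K c y) p' \<in> cdom d" if "y \<in> ?j -` U" for y
      using that U(3,4) p' by force
    ultimately show "(\<forall>\<^sub>F y in nhds (cmap c p). y \<in> vdom K c \<and> f (pull K c y) p' \<in> cdom d) \<and>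
      (\<lambda>y. cmap d (f (pull K c y) p')) differentiable (at (cmap c p))"
      using U(2) unfolding eventually_nhds by (intro conjI exI[of _ "?j -` U"]) simp_all
  qed
  show "mdiff K' A' B (\<lambda>x. f p x) p'" unfolding mdiff_def
  proof (intro ballI impI)
    fix c d assume c: "c \<in> A'" "d \<in> B" "p' \<in> cdom c" "f p p' \<in> cdom d"
    let ?c = "chart_at A p"
    obtain U where U: "open U" "(cmap ?c p, cmap c p') \<in> U" "U \<subseteq> vdom K ?c \<times> vdom K' c"
      "\<forall>(y, z)\<in>U. f (pull K ?c y) (pull K' c z) \<in> cdom d"
      "C2_on (\<lambda>(y, z). cmap d (f (pull K ?c y) (pull K' c z))) U"
      using smooth_map2_C2_on[OF A A' B f c0(1) c(1,2) c0(2) c(3,4)] by (elim exE conjE)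
    have p: "pull K ?c (cmap ?c p) = p" by (rule is_chart_pull[OF manifold_is_chart[OF A c0(1)] c0(2)])
    let ?j = "\<lambda>y. (cmap ?c p, y)"
    have "?j differentiable (at (cmap c p'))"
      by (rule differentiableI[OF has_derivative_Pair[OF has_derivative_const has_derivative_ident]])
    from differentiable_chain_at[OF this C2_on_differentiable[OF U(5,2)]]
    have "(\<lambda>y. cmap d (f p (pull K' c y))) differentiable (at (cmap c p'))" by (simp add: o_def p)
    moreover have "open (?j -` U)" by (rule open_vimage[OF U(1)]) (intro continuous_intros)
    moreover have "y \<in> vdom K' c \<and> f p (pull K' c y) \<in> cdom d" if "y \<in> ?j -` U" for y
      using that U(3,4) p by force
    ultimately show "(\<forall>\<^sub>F y in nhds (cmap c p'). y \<in> vdom K' c \<and> f p (pull K' c y) \<in> cdom d) \<and>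
      (\<lambda>y. cmap d (f p (pull K' c y))) differentiable (at (cmap c p'))"
      using U(2) unfolding eventually_nhds by (intro conjI exI[of _ "?j -` U"]) simp_all
  qed
qed

lemma lcomb_add_axis: "lcomb (r + s *\<^sub>R axis \<alpha> 1) F c = lcomb r F c + s *\<^sub>R F \<alpha> c"
proof -
  have "(\<Sum>\<beta>\<in>UNIV. (s * axis \<alpha> 1 $ \<beta>) *\<^sub>R F \<beta> c) = (\<Sum>\<beta>\<in>UNIV. if \<beta> = \<alpha> then s *\<^sub>R F \<beta> c else 0)"
    by (intro sum.cong) (auto simp: axis_def)
  then show ?thesis by (simp add: lcomb_def scaleR_left_distrib sum.distrib)
qed

lemma lcomb_axis: "lcomb (axis \<alpha> 1) F c = F \<alpha> c"
  using lcomb_add_axis[of 0 1 \<alpha> F c] by (simp add: lcomb_def)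

lemma has_derivative_along_line:
  assumes "(f has_derivative F) (at x)"
  shows "((\<lambda>s. f (x + s *\<^sub>R a)) has_real_derivative F a) (at 0)"
proof -
  have 1: "((\<lambda>s. x + s *\<^sub>R a) has_derivative (\<lambda>h. h *\<^sub>R a)) (at 0)"
    by (auto intro!: derivative_eq_intros)
  have "(f has_derivative F) (at (x + 0 *\<^sub>R a))" using assms by simp
  from has_derivative_compose[OF 1 this] show ?thesis
    by (simp add: has_field_derivative_def linear_scale[OF has_derivative_linear[OF assms]]
        mult.commute[of _ "F a"])
qed

lemma DERIV_eventually:
  assumes "(f has_real_derivative L) (at t)" "\<forall>\<^sub>F s in nhds t. f s = g s"
  shows "(g has_real_derivative L) (at t)"
  using has_derivative_transform_nhds[OF _ assms(2)] assms(1) unfolding has_field_derivative_def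
      by blast

lemma norm_proj_le: "norm (proj K y) \<le> norm y"
  by (rule norm_le_componentwise_cart) simp

text \<open>A curve in the subspace equals its own projection, so its derivative is fixed by the
  projection too. This also passes from the componentwise \<open>deriv\<close> of the equations to a
  vector derivative.\<close>

lemma has_vector_derivative_coord_space:
  fixes x :: "real \<Rightarrow> real ^ 'm::finite"
  assumes T: "open T" "t \<in> T" and x: "\<And>s. s \<in> T \<Longrightarrow> x s \<in> coord_space K" "x differentiable_on T"
  obtains x' where "(x has_vector_derivative x') (at t)" "x' \<in> coord_space K" "\<And>i. deriv (\<lambda>s. x s $ i)
      t = x' $ i"
proof -
  have "x differentiable (at t)" using x(2) T by (simp add: differentiable_on_eq_differentiable_at)
  then obtain x' where d: "(x has_vector_derivative x') (at t)"
    using vector_derivative_works by blast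
  have p: "((\<lambda>s. proj K (x s)) has_vector_derivative proj K x') (at t)"
    by (rule bounded_linear.has_vector_derivative[OF bounded_linear_proj d])
  have "(x has_vector_derivative proj K x') (at t)"
    using has_derivative_transform_within_open[OF p[unfolded has_vector_derivative_def] T] x(1)
    by (simp add: has_vector_derivative_def)
  then have "proj K x' = x'" by (rule vector_derivative_unique_at[OF _ d])
  then have "x' \<in> coord_space K" by (metis proj_in_coord_space)
  moreover have "deriv (\<lambda>s. x s $ i) t = x' $ i" for i
    using bounded_linear.has_vector_derivative[OF bounded_linear_vec_nth d, of i]
    by (intro DERIV_imp_deriv) (simp add: has_real_derivative_iff_has_vector_derivative)
  ultimately show thesis using d that by blast
qed

lemma differentiable_transform_nhds:
  "f differentiable (at x) \<Longrightarrow> \<forall>\<^sub>F y in nhds x. f y = g y \<Longrightarrow> g differentiable (at x)"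
  unfolding differentiable_def using has_derivative_transform_nhds by blast

section \<open>The frames\<close>

locale routh =
  fixes D :: "('g::{t2_space, second_countable_topology}, 'q::{t2_space, second_countable_topology},
               'm::finite) routh_data"
  assumes indices: "iN D \<union> iA D \<union> iI D = UNIV" "iN D \<inter> iA D = {}" "iN D \<inter> iI D = {}" "iA D \<inter> iI D = {}"
    and G: "lie_group (coord_space (iK D)) (Gr D) (atG D)"
    and Q: "manifold UNIV (atQ D)"
    and action: "smooth_action (Gr D) (atG D) (atQ D) (act D)"
    and lagrangian: "smooth_lagrangian D" "invariant_lagrangian D"
    and connection: "principal_connection D"
    and mu: "functional_on (lieG D) (mu D)"
    and basis: "adapted_basis D"
    and local_triv: "trivialized D"
    and fibre_coords: "fibre_chart D"
begin

section \<open>The group, its action and the trivialization\<close>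

lemma iN_iK: "\<alpha> \<in> iN D \<longleftrightarrow> \<alpha> \<notin> iK D"
  using indices by (auto simp: iK_def)

lemma mG: "manifold (coord_space (iK D)) (atG D)"
  using G by (simp add: lie_group_def)

lemma mQ: "manifold (coord_space UNIV) (atQ D)"
  using Q by simp

lemma group_Gr: "group (Gr D)" "carrier (Gr D) = UNIV"
  using G by (simp_all add: lie_group_def)

lemma group_simps:
  "g \<otimes>\<^bsub>Gr D\<^esub> (h \<otimes>\<^bsub>Gr D\<^esub> k) = g \<otimes>\<^bsub>Gr D\<^esub> h \<otimes>\<^bsub>Gr D\<^esub> k" (is ?t1) "\<one>\<^bsub>Gr D\<^esub> \<otimes>\<^bsub>Gr D\<^esub> g = g"
      (is ?t2) "g \<otimes>\<^bsub>Gr D\<^esub> \<one>\<^bsub>Gr D\<^esub> = g" (is ?t3)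
  "g \<otimes>\<^bsub>Gr D\<^esub> inv\<^bsub>Gr D\<^esub> g = \<one>\<^bsub>Gr D\<^esub>" (is ?t4) "inv\<^bsub>Gr D\<^esub> g \<otimes>\<^bsub>Gr D\<^esub> g = \<one>\<^bsub>Gr D\<^esub>" (is ?t5)
  "inv\<^bsub>Gr D\<^esub> (inv\<^bsub>Gr D\<^esub> g) = g" (is ?t6)
  "inv\<^bsub>Gr D\<^esub> (g \<otimes>\<^bsub>Gr D\<^esub> h) = inv\<^bsub>Gr D\<^esub> h \<otimes>\<^bsub>Gr D\<^esub> inv\<^bsub>Gr D\<^esub> g" (is ?t7) "inv\<^bsub>Gr D\<^esub> \<one>\<^bsub>Gr D\<^esub> = \<one>\<^bsub>Gr D\<^esub>"
      (is ?t8)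
proof -
  note g = group_Gr(1) and m = group.is_monoid[OF group_Gr(1)]
  show ?t1 ?t2 ?t3 ?t4 ?t5 ?t6 ?t7 ?t8
    by (simp_all add: group_Gr(2) monoid.m_assoc[OF m] monoid.l_one[OF m] monoid.r_one[OF m]
        group.r_inv[OF g] group.l_inv[OF g] group.inv_inv[OF g] group.inv_mult_group[OF g]
            monoid.inv_one[OF m])
qed

lemma act_simps: "act D \<one>\<^bsub>Gr D\<^esub> q = q" "act D g (act D h q) = act D (g \<otimes>\<^bsub>Gr D\<^esub> h) q"
proof -
  interpret group_action "Gr D" UNIV "act D" using action by (simp add: smooth_action_def)
  show "act D \<one>\<^bsub>Gr D\<^esub> q = q" using fun_cong[OF id_eq_one, of q] by simp
  show "act D g (act D h q) = act D (g \<otimes>\<^bsub>Gr D\<^esub> h) q"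
    using composition_rule[of q g h] group_Gr(2) by simp
qed

lemma act_inverse: "act D (inv\<^bsub>Gr D\<^esub> h) (act D h q) = q" "act D h (act D (inv\<^bsub>Gr D\<^esub> h) q) = q"
  by (simp_all add: act_simps group_simps)

lemma orbit_act: "orbit (Gr D) (act D) (act D h q) = orbit (Gr D) (act D) q"
proof -
  have "\<exists>k. act D g q = act D (k \<otimes>\<^bsub>Gr D\<^esub> h) q" for g
    by (rule exI[of _ "g \<otimes>\<^bsub>Gr D\<^esub> inv\<^bsub>Gr D\<^esub> h"]) (simp add: group_simps(1)[symmetric] group_simps)
  then show ?thesis by (auto simp: orbit_def group_Gr act_simps)
qed

lemma QU_act: "act D h q \<in> QU D \<longleftrightarrow> q \<in> QU D"
  by (simp add: QU_def orbit_act)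

lemma xco_act: "xco D (act D h q) = xco D q"
  by (simp add: xco_def orbit_act)

lemma grp_act: "q \<in> QU D \<Longrightarrow> grp D (act D h q) = h \<otimes>\<^bsub>Gr D\<^esub> grp D q"
  using local_triv by (simp add: trivialized_def)

lemma thG_atG: "thG D \<in> atG D"
  using fibre_coords by (simp add: fibre_chart_def)

lemma xth_atQ: "xth D \<in> atQ D"
  using local_triv thG_atG unfolding trivialized_def by blast

lemma cdom_xth: "q \<in> cdom (xth D) \<longleftrightarrow> q \<in> QU D \<and> grp D q \<in> cdom (thG D)"
  by (simp add: prodchart_def)

lemma cmap_xth: "cmap (xth D) q = xco D q + cmap (thG D) (grp D q)"
  by (simp add: prodchart_def)

lemma xco_coord: assumes "q \<in> QU D" shows "xco D q \<in> coord_space (iN D)"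
  using local_triv assms by (auto simp: trivialized_def QU_def xco_def)

lemma thG_coord: "g \<in> cdom (thG D) \<Longrightarrow> cmap (thG D) g \<in> coord_space (iK D)"
  by (rule is_chart_image[OF manifold_is_chart[OF mG thG_atG]])

lemma proj_disjoint: "K \<inter> J = {} \<Longrightarrow> y \<in> coord_space J \<Longrightarrow> proj K y = 0"
  by (auto simp: vec_eq_iff coord_space_def)

lemma proj_iN_iK: "proj (iN D) y + proj (iK D) y = y"
  by (simp add: vec_eq_iff iN_iK)

lemma coord_iN_iK: "y \<in> coord_space (iK D) \<Longrightarrow> proj (iN D) y = 0" "y \<in> coord_space (iN D) \<Longrightarrow> proj (iK D) y
    = 0"
  by (rule proj_disjoint; auto simp: iN_iK)+

lemma proj_xth:
  assumes "q \<in> cdom (xth D)"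
  shows "proj (iN D) (cmap (xth D) q) = xco D q" "proj (iK D) (cmap (xth D) q) = cmap (thG D) (grp D q)"
  using assms xco_coord[of q] thG_coord[of "grp D q"] coord_iN_iK
  by (simp_all add: cdom_xth cmap_xth proj_add)

lemma open_xth: "open (cdom (xth D))" "open (cmap (xth D) ` cdom (xth D))"
  using is_chart_open[OF manifold_is_chart[OF Q xth_atQ]] open_chart_image[OF Q xth_atQ] .

lemma cinv_xth: "q \<in> cdom (xth D) \<Longrightarrow> cinv (xth D) (cmap (xth D) q) = q"
  by (rule is_chart_cinv[OF manifold_is_chart[OF Q xth_atQ]])

lemma cinv_xth_image:
  "y \<in> cmap (xth D) ` cdom (xth D) \<Longrightarrow> cinv (xth D) y \<in> cdom (xth D)"
  "y \<in> cmap (xth D) ` cdom (xth D) \<Longrightarrow> cmap (xth D) (cinv (xth D) y) = y"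
  by (simp_all add: inv_into_into f_inv_into_f)

lemma TQ_tspace: "TQ D q = tspace (coord_space UNIV) (atQ D) q"
  by (simp add: TQ_def)

section \<open>Linearity and equivariance of generators, \<open>Ad\<close> and the connection
  form\<close>

lemma lcomb2_TQ: "u \<in> TQ D q \<Longrightarrow> w \<in> TQ D q \<Longrightarrow> lcomb2 a u b w \<in> TQ D q"
  unfolding TQ_tspace by (rule tspace_lcomb2[OF mQ])

lemma lcomb2_lieG: "u \<in> lieG D \<Longrightarrow> w \<in> lieG D \<Longrightarrow> lcomb2 a u b w \<in> lieG D"
  unfolding lieG_def by (rule tspace_lcomb2[OF mG])

lemma coord_vec_TQ: "c \<in> atQ D \<Longrightarrow> q \<in> cdom c \<Longrightarrow> coord_vec (atQ D) c q e \<in> TQ D q"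
  "c \<in> atQ D \<Longrightarrow> q \<in> cdom c \<Longrightarrow> coord_vec (atQ D) c q e c = e"
  using coord_vec_in_tspace[OF mQ, of c q e] coord_vec_self[OF mQ, of c q e] by (simp_all add: TQ_def)

lemma TQ_eqI: "w \<in> TQ D q \<Longrightarrow> w' \<in> TQ D q \<Longrightarrow> c \<in> atQ D \<Longrightarrow> q \<in> cdom c \<Longrightarrow> w c = w' c \<Longrightarrow> w = w'"
  unfolding TQ_tspace by (rule tspace_eqI[OF mQ])

lemma smooth_act: "smooth_map2 (atG D) (atQ D) (atQ D) (act D)"
  using action by (simp add: smooth_action_def)

lemma smooth_mult: "smooth_map2 (atG D) (atG D) (atG D) (\<lambda>g h. g \<otimes>\<^bsub>Gr D\<^esub> h)"
  using G by (simp add: lie_group_def)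

lemma mdiff_act: "mdiff UNIV (atQ D) (atQ D) (act D h) q" "mdiff (iK D) (atG D) (atQ D) (\<lambda>h. act D h q)
    h"
  using mdiff_smooth_map2[OF mG mQ Q smooth_act] by auto

lemma mdiff_mult: "mdiff (iK D) (atG D) (atG D) (\<lambda>h. g \<otimes>\<^bsub>Gr D\<^esub> h) h" "mdiff (iK D) (atG D) (atG D) (\<lambda>h.
    h \<otimes>\<^bsub>Gr D\<^esub> g) h"
  using mdiff_smooth_map2[OF mG mG mG smooth_mult] by auto

lemma mdiff_conj: "mdiff (iK D) (atG D) (atG D) (\<lambda>h. g \<otimes>\<^bsub>Gr D\<^esub> h \<otimes>\<^bsub>Gr D\<^esub> inv\<^bsub>Gr D\<^esub> g) h"
  by (rule mdiff_compose(1)[OF mdiff_mult(1) mdiff_mult(2) mG mG])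

lemma conj_one: "g \<otimes>\<^bsub>Gr D\<^esub> \<one>\<^bsub>Gr D\<^esub> \<otimes>\<^bsub>Gr D\<^esub> inv\<^bsub>Gr D\<^esub> g = \<one>\<^bsub>Gr D\<^esub>"
  by (simp add: group_simps)

lemma actT_TQ: "w \<in> TQ D q \<Longrightarrow> actT D h q w \<in> TQ D (act D h q)"
  unfolding TQ_tspace actT_def by (rule tangent_map_in_tspace[OF mQ mQ mdiff_act(1)])

lemma actT_lcomb2: "u \<in> TQ D q \<Longrightarrow> w \<in> TQ D q \<Longrightarrow>
    actT D h q (lcomb2 a u b w) = lcomb2 a (actT D h q u) b (actT D h q w)"
  unfolding TQ_tspace actT_def by (rule tangent_map_lcomb2[OF mQ mdiff_act(1)])

lemma fund_TQ: "\<xi> \<in> lieG D \<Longrightarrow> fundQ D \<xi> q \<in> TQ D q"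
  using tangent_map_in_tspace[OF mG mQ mdiff_act(2)[of q "\<one>\<^bsub>Gr D\<^esub>"], of \<xi>]
  unfolding TQ_tspace lieG_def fund_def by (simp only: act_simps)

lemma fund_lcomb2: "\<xi> \<in> lieG D \<Longrightarrow> \<eta> \<in> lieG D \<Longrightarrow> fundQ D (lcomb2 a \<xi> b \<eta>) q = lcomb2 a (fundQ D \<xi> q) b
    (fundQ D \<eta> q)"
  unfolding lieG_def fund_def by (rule tangent_map_lcomb2[OF mG mdiff_act(2)])

lemma Ad_lieG: "\<xi> \<in> lieG D \<Longrightarrow> AdG D h \<xi> \<in> lieG D"
  using tangent_map_in_tspace[OF mG mG mdiff_conj[of h "\<one>\<^bsub>Gr D\<^esub>"], of \<xi>]
  unfolding lieG_def Ad_def by (simp only: conj_one)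

lemma Ad_lcomb2: "\<xi> \<in> lieG D \<Longrightarrow> \<eta> \<in> lieG D \<Longrightarrow> AdG D h (lcomb2 a \<xi> b \<eta>) = lcomb2 a (AdG D h \<xi>) b (AdG D h
    \<eta>)"
  unfolding lieG_def Ad_def by (rule tangent_map_lcomb2[OF mG mdiff_conj])

lemma Ad_mult: assumes "\<xi> \<in> lieG D" shows "AdG D g (AdG D h \<xi>) = AdG D (g \<otimes>\<^bsub>Gr D\<^esub> h) \<xi>"
proof -
  let ?c = "\<lambda>g x. g \<otimes>\<^bsub>Gr D\<^esub> x \<otimes>\<^bsub>Gr D\<^esub> inv\<^bsub>Gr D\<^esub> g"
  have "tangent_map (atG D) (atG D) (\<lambda>x. ?c g (?c h x)) \<one>\<^bsub>Gr D\<^esub> \<xi> =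
    tangent_map (atG D) (atG D) (?c g) (?c h \<one>\<^bsub>Gr D\<^esub>) (tangent_map (atG D) (atG D) (?c h) \<one>\<^bsub>Gr D\<^esub> \<xi>)"
    by (rule tangent_map_compose[OF mG mG mdiff_conj mdiff_conj assms[unfolded lieG_def]])
  moreover have "(\<lambda>x. ?c g (?c h x)) = ?c (g \<otimes>\<^bsub>Gr D\<^esub> h)" by (simp add: group_simps)
  ultimately show ?thesis by (simp only: Ad_def conj_one)
qed

lemma Ad_one: assumes "\<xi> \<in> lieG D" shows "AdG D \<one>\<^bsub>Gr D\<^esub> \<xi> = \<xi>"
  using tangent_map_id[OF mG assms[unfolded lieG_def]] by (simp add: Ad_def group_simps)

lemma Ad_inverse: assumes "\<xi> \<in> lieG D" shows "AdG D (inv\<^bsub>Gr D\<^esub> g) (AdG D g \<xi>) = \<xi>" "AdG D g (AdG D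
    (inv\<^bsub>Gr D\<^esub> g) \<xi>) = \<xi>"
  using assms by (simp_all add: Ad_mult Ad_one group_simps)

lemma conn_lieG: "u \<in> TQ D q \<Longrightarrow> conn D q u \<in> lieG D"
  using connection unfolding principal_connection_def by blast

lemma conn_lcomb2: "u \<in> TQ D q \<Longrightarrow> w \<in> TQ D q \<Longrightarrow> conn D q (lcomb2 a u b w) = lcomb2 a (conn D q u) b (conn
    D q w)"
  using connection unfolding principal_connection_def by blast

lemma conn_fund: "\<xi> \<in> lieG D \<Longrightarrow> conn D q (fundQ D \<xi> q) = \<xi>"
  using connection unfolding principal_connection_def by blast

lemma conn_actT: "u \<in> TQ D q \<Longrightarrow> conn D (act D h q) (actT D h q u) = AdG D h (conn D q u)"
  using connection unfolding principal_connection_def by blast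

lemma conn_lcomb: "(\<And>\<alpha>. F \<alpha> \<in> TQ D q) \<Longrightarrow> conn D q (lcomb r F) = lcomb r (\<lambda>\<alpha>. conn D q (F \<alpha>))"
  by (rule lcomb_hom[where T = "conn D q" and p = q
      and F = F, OF mQ]) (unfold TQ_tspace[symmetric], simp_all add: conn_lcomb2)

lemma conn_zero: "conn D q (\<lambda>c. 0) = (\<lambda>c. 0)"
  using conn_lcomb2[of "\<lambda>c. 0" q "\<lambda>c. 0" 0 0] zero_in_tspace[OF mQ, of q]
      by (simp add: lcomb2_def TQ_tspace)

lemma Ad_zero: "AdG D h (\<lambda>c. 0) = (\<lambda>c. 0)"
  using Ad_lcomb2[of "\<lambda>c. 0" "\<lambda>c. 0" h 0 0] zero_in_tspace[OF mG] by (simp add: lcomb2_def lieG_def)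

lemma mu_zero: "mu D (\<lambda>c. 0) = 0"
proof -
  have z: "(\<lambda>c. 0) \<in> lieG D" using zero_in_tspace[OF mG] by (simp add: lieG_def)
  with mu have "mu D (lcomb2 0 (\<lambda>c. 0) 0 (\<lambda>c. 0)) = 0 * mu D (\<lambda>c. 0) + 0 * mu D (\<lambda>c. 0)"
    unfolding functional_on_def by blast
  then show ?thesis by (simp add: lcomb2_def)
qed

text \<open>One fixed chart around the identity in which all elements of the Lie algebra are read,
  so that the connection form becomes a vector-valued function.\<close>

definition kap :: "('g, real ^ 'm) chart" where "kap = chart_at (atG D) \<one>\<^bsub>Gr D\<^esub>"

lemma kap: "kap \<in> atG D" "\<one>\<^bsub>Gr D\<^esub> \<in> cdom kap"
  unfolding kap_def by (rule manifold_chart_at[OF mG])+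

lemma fund_xth:
  assumes "\<xi> \<in> lieG D" "q \<in> cdom (xth D)"
  shows "fundQ D \<xi> q (xth D) = mder (iK D) kap (xth D) (\<lambda>h. act D h q) \<one>\<^bsub>Gr D\<^esub> (\<xi> kap)"
  unfolding fund_def
  by (rule tangent_map_eq_mder[OF mG mdiff_act(2) assms(1)[unfolded lieG_def] kap(1) xth_atQ kap(2)])
    (simp add: act_simps assms)

section \<open>Vertical and horizontal vectors over the trivialization\<close>

text \<open>The coordinates x are functions of the orbit, so the iN-part of the orbit map in
  coordinates is constant.\<close>

lemma orbit_map_vertical:
  assumes q: "q \<in> cdom (xth D)"
  shows "proj (iN D) (mder (iK D) kap (xth D) (\<lambda>h. act D h q) \<one>\<^bsub>Gr D\<^esub> e) = 0"
proof -
  have q1: "act D \<one>\<^bsub>Gr D\<^esub> q \<in> cdom (xth D)" using q by (simp add: act_simps)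
  note * = mdiff_act(2)[of q "\<one>\<^bsub>Gr D\<^esub>"] kap(1) xth_atQ kap(2) q1
  have 1: "((\<lambda>y. proj (iN D) (cmap (xth D) (act D (pull (iK D) kap y) q))) has_derivative
      (\<lambda>e. proj (iN D) (mder (iK D) kap (xth D) (\<lambda>h. act D h q) \<one>\<^bsub>Gr D\<^esub> e))) (at (cmap kap \<one>\<^bsub>Gr D\<^esub>))"
    by (rule bounded_linear.has_derivative[OF bounded_linear_proj mdiff_mder[OF *]])
  have "\<forall>\<^sub>F y in nhds (cmap kap \<one>\<^bsub>Gr D\<^esub>).
      proj (iN D) (cmap (xth D) (act D (pull (iK D) kap y) q)) = xco D q"
    using mdiff_eventually[OF *] by eventually_elim (simp add: proj_xth xco_act)
  from has_derivative_transform_nhds[OF 1 this]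
  have "((\<lambda>y. xco D q) has_derivative
      (\<lambda>e. proj (iN D) (mder (iK D) kap (xth D) (\<lambda>h. act D h q) \<one>\<^bsub>Gr D\<^esub> e))) (at (cmap kap \<one>\<^bsub>Gr D\<^esub>))" .
  from has_derivative_unique[OF this has_derivative_const] show ?thesis by (rule fun_cong)
qed

lemma fund_vertical: "\<xi> \<in> lieG D \<Longrightarrow> q \<in> cdom (xth D) \<Longrightarrow> proj (iN D) (fundQ D \<xi> q (xth D)) = 0"
  by (simp add: fund_xth orbit_map_vertical)

lemma TQ_zero: "(\<lambda>c. 0) \<in> TQ D q"
  using zero_in_tspace[OF mQ] by (simp add: TQ_def)

text \<open>The infinitesimal generators at \<open>q\<close> are injective functions of the Lie algebra because the
  connection form is a left inverse; hence, by dimension, they exhaust the vertical vectors.\<close>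

lemma vertical_imp_fund:
  assumes q: "q \<in> cdom (xth D)" and w: "w \<in> TQ D q" "proj (iN D) (w (xth D)) = 0"
  obtains \<xi> where "\<xi> \<in> lieG D" "w = fundQ D \<xi> q"
proof -
  let ?m = "mder (iK D) kap (xth D) (\<lambda>h. act D h q) \<one>\<^bsub>Gr D\<^esub>"
  have q1: "act D \<one>\<^bsub>Gr D\<^esub> q \<in> cdom (xth D)" using q by (simp add: act_simps)
  note * = mdiff_act(2)[of q "\<one>\<^bsub>Gr D\<^esub>"] kap(1) xth_atQ kap(2) q1
  have lin: "linear ?m" by (rule mder_linear[OF *])
  \<comment> \<open>The derivative of the orbit map is padded by the projection to the x-directions.
    This gives an endomorphism of the whole model space, for which injectivity implies
    surjectivity.\<close>
  define f where "f = (\<lambda>e. ?m e + proj (iN D) e)"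
  have flin: "linear f" unfolding f_def by (intro linear_compose_add lin linear_proj)
  define \<xi> where "\<xi> = (\<lambda>e. coord_vec (atG D) kap \<one>\<^bsub>Gr D\<^esub> (proj (iK D) e))"
  have \<xi>: "\<xi> e \<in> lieG D" "\<xi> e kap = proj (iK D) e" for e
    unfolding \<xi>_def lieG_def by (rule coord_vec_in_tspace[OF mG kap] coord_vec_self[OF mG kap], simp)+
  have fund: "fundQ D (\<xi> e) q (xth D) = ?m e" for e
    using fund_xth[OF \<xi>(1) q] mder_proj[OF * mG] by (simp add: \<xi>(2))
  have pf: "proj (iN D) (f e) = proj (iN D) e" for e
    by (simp add: f_def proj_add orbit_map_vertical[OF q])
  have "e = 0" if "f e = 0" for e
  proof -
    have 1: "proj (iN D) e = 0" using pf[of e] that by simp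
    then have "fundQ D (\<xi> e) q (xth D) = 0" using that fund by (simp add: f_def)
    then have "fundQ D (\<xi> e) q = (\<lambda>c. 0)"
      by (intro TQ_eqI[OF fund_TQ[OF \<xi>(1)] TQ_zero xth_atQ q])
    then have "\<xi> e = (\<lambda>c. 0)" using conn_fund[OF \<xi>(1), of q e] conn_zero by simp
    then have "proj (iK D) e = 0" using \<xi>(2)[of e] by simp
    then show ?thesis using 1 proj_iN_iK[of e] by simp
  qed
  then have "inj f" by (simp add: linear_injective_0[OF flin])
  then have "surj f" by (intro linear_injective_imp_surjective[OF flin]) simp_all
  then obtain e where e: "w (xth D) = f e" by (metis surjD)
  then have "proj (iN D) e = 0" using pf[of e] w(2) by simp
  then have "w = fundQ D (\<xi> e) q"
    using e fund by (intro TQ_eqI[OF w(1) fund_TQ[OF \<xi>(1)] xth_atQ q]) (simp add: f_def)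
  with \<xi>(1) show thesis by (rule that)
qed

lemma vertical_horizontal_zero:
  assumes q: "q \<in> cdom (xth D)" and w: "w \<in> TQ D q" "proj (iN D) (w (xth D)) = 0" "conn D q w = (\<lambda>c. 0)"
  shows "w = (\<lambda>c. 0)"
proof -
  obtain \<xi> where \<xi>: "\<xi> \<in> lieG D" "w = fundQ D \<xi> q" by (rule vertical_imp_fund[OF q w(1,2)])
  then have "\<xi> = (\<lambda>c. 0)" using conn_fund[OF \<xi>(1), of q] w(3) by simp
  \<comment> \<open>Linearity with both coefficients 0, at the element 0 of the Lie algebra, shows
    that its generator is the zero vector.\<close>
  then have "fundQ D \<xi> q = lcomb2 0 (fundQ D \<xi> q) 0 (fundQ D \<xi> q)"
    using fund_lcomb2[OF \<xi>(1,1), of 0 0 q] by (simp add: lcomb2_def)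
  then show ?thesis using \<xi> by (simp add: lcomb2_def)
qed

text \<open>The x-components and the connection form together separate tangent vectors. The
  uniqueness of horizontal lifts, of frame components and the equivariance of the frame all rest on
  this.\<close>

lemma TQ_eqI_conn:
  assumes q: "q \<in> cdom (xth D)" and w: "w \<in> TQ D q" "w' \<in> TQ D q"
    and eq: "proj (iN D) (w (xth D)) = proj (iN D) (w' (xth D))" "conn D q w = conn D q w'"
  shows "w = w'"
proof -
  have "lcomb2 1 w (-1) w' = (\<lambda>c. 0)"
  proof (rule vertical_horizontal_zero[OF q lcomb2_TQ[OF w]])
    show "proj (iN D) (lcomb2 1 w (-1) w' (xth D)) = 0"
      using eq(1) by (simp add: lcomb2_def linear_diff[OF linear_proj])
    show "conn D q (lcomb2 1 w (-1) w') = (\<lambda>c. 0)"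
      unfolding conn_lcomb2[OF w] eq(2) by (simp add: lcomb2_def)
  qed
  then show ?thesis by (simp add: lcomb2_def fun_eq_iff)
qed

lemma differential_xco:
  assumes q: "q \<in> cdom (xth D)" and w: "w \<in> TQ D q"
  shows "differential (atQ D) (xco D) q w = proj (iN D) (w (xth D))"
proof (rule differential_eq[OF Q xth_atQ q w[unfolded TQ_def]])
  show "((\<lambda>y. xco D (cinv (xth D) y)) has_derivative proj (iN D)) (at (cmap (xth D) q))"
  proof (rule has_derivative_transform_nhds[OF bounded_linear_imp_has_derivative[OF
      bounded_linear_proj]])
    show "\<forall>\<^sub>F y in nhds (cmap (xth D) q). proj (iN D) y = xco D (cinv (xth D) y)"
      using transition_has_derivative(2)[OF Q xth_atQ xth_atQ q q]
      by eventually_elim (metis proj_xth(1))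
  qed
qed

text \<open>Subtracting from a coordinate vector the generator of its connection form makes it
  horizontal and leaves the x-components alone, because generators are vertical.\<close>

lemma Xh_ex1:
  assumes q: "q \<in> cdom (xth D)" and i: "i \<in> iN D"
  shows "\<exists>!w. w \<in> TQ D q \<and> conn D q w = (\<lambda>c. 0) \<and> differential (atQ D) (xco D) q w = axis i 1"
proof (rule ex_ex1I)
  define u where "u = coord_vec (atQ D) (xth D) q (axis i 1)"
  have u: "u \<in> TQ D q" "u (xth D) = axis i 1" using coord_vec_TQ[OF xth_atQ q] by (simp_all add: u_def)
  define w where "w = lcomb2 1 u (-1) (fundQ D (conn D q u) q)"
  have c: "conn D q u \<in> lieG D" by (rule conn_lieG[OF u(1)])
  note f = fund_TQ[OF c, of q]
  have w: "w \<in> TQ D q" unfolding w_def by (rule lcomb2_TQ[OF u(1) f])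
  moreover have "conn D q w = (\<lambda>c. 0)"
    unfolding w_def conn_lcomb2[OF u(1) f] conn_fund[OF c] by (simp add: lcomb2_def)
  moreover have "proj (iN D) (axis i 1) = axis i 1" using i by (auto simp: vec_eq_iff axis_def)
  then have "proj (iN D) (w (xth D)) = axis i 1"
    using fund_vertical[OF c q] by (simp add: w_def lcomb2_def linear_diff[OF linear_proj] u(2))
  ultimately show "\<exists>w. w \<in> TQ D q \<and> conn D q w = (\<lambda>c. 0) \<and> differential (atQ D) (xco D) q w = axis i 1"
    using differential_xco[OF q w] by metis
next
  fix w w'
  assume "w \<in> TQ D q \<and> conn D q w = (\<lambda>c. 0) \<and> differential (atQ D) (xco D) q w = axis i 1"
    "w' \<in> TQ D q \<and> conn D q w' = (\<lambda>c. 0) \<and> differential (atQ D) (xco D) q w' = axis i 1"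
  then show "w = w'" using TQ_eqI_conn[OF q, of w w'] differential_xco[OF q, of w] differential_xco[OF
      q, of w'] by simp
qed

lemma Xh:
  assumes q: "q \<in> cdom (xth D)" and i: "i \<in> iN D"
  shows "Xh D i q \<in> TQ D q" "conn D q (Xh D i q) = (\<lambda>c. 0)" "proj (iN D) (Xh D i q (xth D)) = axis i 1"
  using theI'[OF Xh_ex1[OF q i]] differential_xco[OF q, of "Xh D i q"] by (simp_all add: Xh_def)

lemma bas_lieG: "a \<in> iK D \<Longrightarrow> bas D a \<in> lieG D"
  using basis by (simp add: adapted_basis_def is_basis_def)

text \<open>The two moving frames are treated simultaneously: \<open>B\<close> is the basis of the Lie algebra whose
  infinitesimal generators complete the horizontal lifts to a frame at \<open>q\<close>.\<close>

definition frame :: "('m \<Rightarrow> ('g, real ^ 'm) tvec) \<Rightarrow> 'q \<Rightarrow> 'm \<Rightarrow> ('q, real ^ 'm) tvec" where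
  "frame B q = (\<lambda>\<alpha>. if \<alpha> \<in> iN D then Xh D \<alpha> q else fundQ D (B \<alpha>) q)"

section \<open>Components with respect to a moving frame\<close>

lemma frame_TQ:
  assumes q: "q \<in> cdom (xth D)" and B: "\<forall>a\<in>iK D. B a \<in> lieG D"
  shows "frame B q \<alpha> \<in> TQ D q"
  using Xh(1)[OF q] fund_TQ B by (simp add: frame_def iN_iK)

lemma frame_dx:
  assumes q: "q \<in> cdom (xth D)" and B: "\<forall>a\<in>iK D. B a \<in> lieG D"
  shows "proj (iN D) (lcomb r (frame B q) (xth D)) = proj (iN D) r"
proof -
  have f: "proj (iN D) (frame B q \<alpha> (xth D)) = (if \<alpha> \<in> iN D then axis \<alpha> 1 else 0)" for \<alpha>
    using Xh(3)[OF q] fund_vertical[OF _ q] B by (simp add: frame_def iN_iK)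
  have "proj (iN D) (lcomb r (frame B q) (xth D)) = (\<Sum>\<alpha>\<in>UNIV. r $ \<alpha> *\<^sub>R (if \<alpha> \<in> iN D then axis \<alpha> 1 else
      0))"
    by (simp only: lcomb_def linear_sum[OF linear_proj] linear_scale[OF linear_proj] f)
  also have "\<dots> = (\<Sum>\<alpha>\<in>UNIV. if \<alpha> \<in> iN D then r $ \<alpha> *\<^sub>R axis \<alpha> 1 else 0)"
    by (intro sum.cong) auto
  also have "\<dots> = (\<Sum>\<alpha>\<in>iN D. r $ \<alpha> *\<^sub>R axis \<alpha> 1)" by (simp add: sum.inter_restrict[symmetric])
  finally show ?thesis by (simp add: proj_sum_axis)
qed

lemma frame_conn:
  assumes q: "q \<in> cdom (xth D)" and B: "\<forall>a\<in>iK D. B a \<in> lieG D"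
  shows "conn D q (lcomb r (frame B q)) = lcomb (proj (iK D) r) B"
proof -
  have "conn D q (frame B q \<alpha>) = (if \<alpha> \<in> iN D then (\<lambda>c. 0) else B \<alpha>)" for \<alpha>
    using Xh(2)[OF q] conn_fund B by (simp add: frame_def iN_iK)
  then have "conn D q (lcomb r (frame B q)) = lcomb r (\<lambda>\<alpha>. if \<alpha> \<in> iN D then (\<lambda>c. 0) else B \<alpha>)"
    using conn_lcomb[where F = "frame B q" and q = q and r = r, OF frame_TQ[OF q B]] by simp
  also have "\<dots> = lcomb (proj (iK D) r) B"
    unfolding lcomb_def by (intro ext sum.cong) (auto simp: iN_iK)
  finally show ?thesis .
qed

text \<open>The iN-coefficients are forced by the x-components, and the iK-coefficients by the
  connection form, which kills the horizontal lifts and returns \<open>B\<close> from its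
  generators.\<close>

lemma frame_ex1:
  assumes q: "q \<in> cdom (xth D)" and B: "is_basis (iK D) B (lieG D)" and w: "w \<in> TQ D q"
  shows "\<exists>!r. w = lcomb r (frame B q)"
proof (rule ex_ex1I)
  have BG: "\<forall>a\<in>iK D. B a \<in> lieG D" using B by (simp add: is_basis_def)
  have ex1: "\<exists>!s. s \<in> coord_space (iK D) \<and> conn D q w = lcomb s B"
    using B conn_lieG[OF w] by (simp add: is_basis_def)
  then obtain s where s: "s \<in> coord_space (iK D)" "conn D q w = lcomb s B" by blast
  define r where "r = proj (iN D) (w (xth D)) + s"
  have "proj (iN D) r = proj (iN D) (w (xth D))"
    by (simp add: r_def proj_add coord_iN_iK(1)[OF s(1)])
  moreover have "proj (iK D) r = s"
    using coord_iN_iK(2)[OF proj_in_coord_space] s(1) by (simp add: r_def proj_add)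
  moreover have "lcomb r (frame B q) \<in> TQ D q"
    using lcomb_in_tspace[OF mQ, of r "frame B q" q] frame_TQ[OF q BG] by (simp add: TQ_tspace)
  ultimately have "w = lcomb r (frame B q)"
    using frame_dx[OF q BG] frame_conn[OF q BG] s(2) by (intro TQ_eqI_conn[OF q w]) simp_all
  then show "\<exists>r. w = lcomb r (frame B q)" ..
  fix r r' assume r: "w = lcomb r (frame B q)" "w = lcomb r' (frame B q)"
  have c: "conn D q w = lcomb (proj (iK D) r) B" "conn D q w = lcomb (proj (iK D) r') B"
    using frame_conn[OF q BG, where r = r, folded r(1)] frame_conn[OF q BG, where r = r', folded r(2)] .
  moreover have "proj (iK D) r = proj (iK D) r'"
    by (rule trans[OF sym[OF the1_equality[OF ex1 conjI[OF proj_in_coord_space c(1)]]]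
          the1_equality[OF ex1 conjI[OF proj_in_coord_space c(2)]]])
  moreover have "proj (iN D) r = proj (iN D) r'"
    using frame_dx[OF q BG, where r = r, folded r(1)] frame_dx[OF q BG, where r = r', folded r(2)]
        by simp
  ultimately have "proj (iN D) r + proj (iK D) r = proj (iN D) r' + proj (iK D) r'" by (simp only:)
  then show "r = r'" unfolding proj_iN_iK .
qed

lemma comps_frame:
  assumes q: "q \<in> cdom (xth D)" and B: "is_basis (iK D) B (lieG D)"
  shows "w \<in> TQ D q \<Longrightarrow> w = lcomb (comps (frame B q) w) (frame B q)"
    and "comps (frame B q) (lcomb r (frame B q)) = r"
proof -
  have BG: "\<forall>a\<in>iK D. B a \<in> lieG D" using B by (simp add: is_basis_def)
  show "w \<in> TQ D q \<Longrightarrow> w = lcomb (comps (frame B q) w) (frame B q)"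
    unfolding comps_def by (rule theI'[OF frame_ex1[OF q B]])
  have "lcomb r (frame B q) \<in> TQ D q"
    using lcomb_in_tspace[OF mQ, of r "frame B q" q] frame_TQ[OF q BG] by (simp add: TQ_tspace)
  from the1_equality[OF frame_ex1[OF q B this] refl]
  show "comps (frame B q) (lcomb r (frame B q)) = r" unfolding comps_def .
qed

lemma frame_tilde_eq: "frame_tilde D q = frame (bas D) q"
  by (simp add: frame_tilde_def frame_def Etilde_def fun_eq_iff)

lemma frame_hat_eq: "frame_hat D q = frame (\<lambda>a. AdG D (grp D q) (bas D a)) q"
  by (simp add: frame_hat_def frame_def Ehat_def fun_eq_iff)

lemma bas_basis: "is_basis (iK D) (bas D) (lieG D)"
  using basis by (simp add: adapted_basis_def)

lemma Ad_lcomb: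
  assumes "r \<in> coord_space (iK D)"
  shows "AdG D g (lcomb r (bas D)) = lcomb r (\<lambda>a. AdG D g (bas D a))"
proof (rule lcomb_hom[where T = "AdG D g" and p = "\<one>\<^bsub>Gr D\<^esub>" and F = "bas D", OF mG])
  show "\<forall>u\<in>tspace (coord_space (iK D)) (atG D) \<one>\<^bsub>Gr D\<^esub>. \<forall>w\<in>tspace (coord_space (iK D)) (atG D) \<one>\<^bsub>Gr D\<^esub>.
      \<forall>a b.
     AdG D g (lcomb2 a u b w) = lcomb2 a (AdG D g u) b (AdG D g w)"
    using Ad_lcomb2 by (simp add: lieG_def)
  show "r $ \<alpha> = 0 \<or> bas D \<alpha> \<in> tspace (coord_space (iK D)) (atG D) \<one>\<^bsub>Gr D\<^esub>" for \<alpha>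
    using assms bas_lieG[of \<alpha>] by (cases "\<alpha> \<in> iK D") (auto simp: lieG_def coord_space_def)
qed

lemma Ad_basis: "is_basis (iK D) (\<lambda>a. AdG D g (bas D a)) (lieG D)"
  unfolding is_basis_def
proof (intro conjI ballI)
  show "AdG D g (bas D a) \<in> lieG D" if "a \<in> iK D" for a by (rule Ad_lieG[OF bas_lieG[OF that]])
  fix \<xi> assume \<xi>: "\<xi> \<in> lieG D"
  have in_lieG: "lcomb r (bas D) \<in> lieG D" if "r \<in> coord_space (iK D)" for r
    using lcomb_in_tspace[OF mG, of r "bas D" "\<one>\<^bsub>Gr D\<^esub>"] that bas_lieG
    unfolding lieG_def coord_space_def by blast
  have iff: "\<xi> = lcomb r (\<lambda>a. AdG D g (bas D a)) \<longleftrightarrow> AdG D (inv\<^bsub>Gr D\<^esub> g) \<xi> = lcomb r (bas D)"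
    if "r \<in> coord_space (iK D)" for r
    unfolding Ad_lcomb[OF that, symmetric] using Ad_inverse[OF \<xi>] Ad_inverse[OF in_lieG[OF that]]
        by metis
  have "\<exists>!r. r \<in> coord_space (iK D) \<and> AdG D (inv\<^bsub>Gr D\<^esub> g) \<xi> = lcomb r (bas D)"
    using bas_basis Ad_lieG[OF \<xi>] by (simp add: is_basis_def)
  then show "\<exists>!r. r \<in> coord_space (iK D) \<and> \<xi> = lcomb r (\<lambda>a. AdG D g (bas D a))"
    using iff by (simp cong: conj_cong)
qed

lemma comps_hat:
  assumes q: "q \<in> cdom (xth D)"
  shows "w \<in> TQ D q \<Longrightarrow> w = lcomb (comps (frame_hat D q) w) (frame_hat D q)"
    and "comps (frame_hat D q) (lcomb r (frame_hat D q)) = r"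
  unfolding frame_hat_eq by (rule comps_frame[OF q Ad_basis], assumption) (rule comps_frame(2)[OF q
      Ad_basis])

lemmas comps_tilde = comps_frame[OF _ bas_basis, folded frame_tilde_eq]

lemma frame_hat_TQ: "q \<in> cdom (xth D) \<Longrightarrow> frame_hat D q \<alpha> \<in> TQ D q"
  unfolding frame_hat_eq by (rule frame_TQ) (simp_all add: Ad_lieG bas_lieG)

lemma lcomb_hat_TQ: "q \<in> cdom (xth D) \<Longrightarrow> lcomb r (frame_hat D q) \<in> TQ D q"
  using lcomb_in_tspace[OF mQ, of r "frame_hat D q" q] frame_hat_TQ by (simp add: TQ_tspace)

lemma hat_dx: "q \<in> cdom (xth D) \<Longrightarrow> proj (iN D) (lcomb r (frame_hat D q) (xth D)) = proj (iN D) r"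
  unfolding frame_hat_eq by (rule frame_dx) (simp_all add: Ad_lieG bas_lieG)

text \<open>Replaces the sum over components by \<open>mu\<close> of the connection form. The
  invariance of the subtracted term of the Routhian then follows from the equivariance of
  \<open>conn\<close>, and its differentiability from the smoothness of \<open>conn\<close>.\<close>

lemma mu_conn:
  assumes q: "q \<in> cdom (xth D)" and w: "w \<in> TQ D q"
  shows "(\<Sum>a\<in>iK D. mu D (bas D a) * comps (frame_tilde D q) w $ a) = mu D (conn D q w)"
proof -
  let ?r = "comps (frame_tilde D q) w"
  have "conn D q w = lcomb (proj (iK D) ?r) (bas D)"
    using arg_cong[OF comps_tilde(1)[OF q w], of "conn D q"] frame_conn[OF q, of "bas D"] bas_lieG
    by (simp add: frame_tilde_eq)
  moreover have "mu D (lcomb (proj (iK D) ?r) (bas D)) = (\<Sum>\<alpha>\<in>UNIV. proj (iK D) ?r $ \<alpha> * mu D (bas D \<alpha>))"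
    by (rule functional_on_lcomb[OF mG mu[unfolded lieG_def]])
      (use bas_lieG in \<open>auto simp: lieG_def\<close>)
  moreover have "\<dots> = (\<Sum>\<alpha>\<in>iK D. mu D (bas D \<alpha>) * ?r $ \<alpha>)"
    by (rule sum.mono_neutral_cong_right) auto
  ultimately show ?thesis by simp
qed

lemma routhian_eq: "q \<in> cdom (xth D) \<Longrightarrow> w \<in> TQ D q \<Longrightarrow> routhian D q w = Lag D q w - mu D (conn D q w)"
  by (simp add: routhian_def mu_conn)

subsection \<open>Regularity of the frames\<close>

lemma act_C2:
  assumes c: "c \<in> atQ D" "d \<in> atQ D" "q \<in> cdom c" "act D h q \<in> cdom d"
  shows "\<exists>U. open U \<and> cmap c q \<in> U \<and> C2_on (\<lambda>y. cmap d (act D h (cinv c y))) U"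
proof -
  let ?k = "chart_at (atG D) h"
  note k = manifold_chart_at[OF mG, of h]
  obtain U where U: "open U" "(cmap ?k h, cmap c q) \<in> U"
    "C2_on (\<lambda>(y, z). cmap d (act D (pull (iK D) ?k y) (pull UNIV c z))) U"
    using smooth_map2_C2_on[OF mG mQ Q smooth_act k(1) c(1,2) k(2) c(3,4)] by (elim exE conjE)
  let ?j = "\<lambda>y. (cmap ?k h, y)"
  have "C2_on (\<lambda>y. (\<lambda>(y, z). cmap d (act D (pull (iK D) ?k y) (pull UNIV c z))) ((cmap ?k h, 0) + (0,
      y))) (?j -` U)"
    by (rule C2_on_compose_affine[OF U(3) bounded_linear_Pair[OF bounded_linear_zero
        bounded_linear_ident]]) auto
  then have "C2_on (\<lambda>y. cmap d (act D h (cinv c y))) (?j -` U)"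
    by (simp add: is_chart_pull[OF manifold_is_chart[OF mG k(1)] k(2)])
  moreover have "open (?j -` U)" by (rule open_vimage[OF U(1)]) (intro continuous_intros)
  ultimately show ?thesis using U(2) by (intro exI[of _ "?j -` U"]) simp
qed

text \<open>The action is jointly C^2, so its derivative in the group variable at the identity is
  still C^1 in the point acted upon.\<close>

lemma orbit_map_C1:
  "C1_on (\<lambda>z. mder (iK D) kap (xth D) (\<lambda>h. act D h (cinv (xth D) z)) \<one>\<^bsub>Gr D\<^esub> e) (cmap (xth D) ` cdom
      (xth D))"
proof (rule C1_on_local[OF open_xth(2)])
  fix z assume z: "z \<in> cmap (xth D) ` cdom (xth D)"
  let ?q = "cinv (xth D) z"
  have q: "?q \<in> cdom (xth D)" "cmap (xth D) ?q = z" "act D \<one>\<^bsub>Gr D\<^esub> ?q \<in> cdom (xth D)"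
    using cinv_xth_image[OF z] by (simp_all add: act_simps)
  obtain U where U: "open U" "(cmap kap \<one>\<^bsub>Gr D\<^esub>, cmap (xth D) ?q) \<in> U"
    "C2_on (\<lambda>(y, z). cmap (xth D) (act D (pull (iK D) kap y) (pull UNIV (xth D) z))) U"
    using smooth_map2_C2_on[OF mG mQ Q smooth_act kap(1) xth_atQ xth_atQ kap(2) q(1,3)]
        by (elim exE conjE)
  let ?V = "{z. (cmap kap \<one>\<^bsub>Gr D\<^esub>, z) \<in> U}"
  have "C1_on (\<lambda>z. mder (iK D) kap (xth D) (\<lambda>h. act D h (cinv (xth D) z)) \<one>\<^bsub>Gr D\<^esub> e) ?V"
    using C2_on_partial[OF U(3,1), of "cmap kap \<one>\<^bsub>Gr D\<^esub>" e] by (simp add: mder_def)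
  moreover have "open ?V"
    using open_vimage[OF U(1), of "\<lambda>z. (cmap kap \<one>\<^bsub>Gr D\<^esub>, z)"]
        by (simp add: vimage_def continuous_intros)
  ultimately show "\<exists>T. open T \<and> z \<in> T \<and>
      C1_on (\<lambda>z. mder (iK D) kap (xth D) (\<lambda>h. act D h (cinv (xth D) z)) \<one>\<^bsub>Gr D\<^esub> e) T"
    using U(2) q(2) by (intro exI[of _ ?V]) simp
qed

lemma conn_C1:
  assumes c: "c \<in> atQ D"
  shows "C1_on (\<lambda>y. conn D (cinv c y) (coord_vec (atQ D) c (cinv c y) e) kap) (cmap c ` cdom c)"
  by (rule smooth_on_imp_C1_on[OF _ open_chart_image[OF Q c]])
    (use connection c kap in \<open>unfold principal_connection_def, blast\<close>)

text \<open>Unlike the definite description of \<open>Xh\<close>, this formula exhibits its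
  regularity: both the connection form of a coordinate field and the derivative of the orbit map are
  C^1.\<close>

lemma Xh_eq:
  assumes q: "q \<in> cdom (xth D)" and i: "i \<in> iN D" and u: "u = coord_vec (atQ D) (xth D) q (axis i 1)"
  shows "Xh D i q = lcomb2 1 u (-1) (fundQ D (conn D q u) q)"
proof -
  have u: "u \<in> TQ D q" "u (xth D) = axis i 1" using coord_vec_TQ[OF xth_atQ q] by (simp_all add: u)
  have c: "conn D q u \<in> lieG D" by (rule conn_lieG[OF u(1)])
  note f = fund_TQ[OF c, of q]
  have 1: "proj (iN D) (axis i 1) = axis i 1" using i by (auto simp: vec_eq_iff axis_def)
  show ?thesis
  proof (rule TQ_eqI_conn[OF q Xh(1)[OF q i] lcomb2_TQ[OF u(1) f]])
    show "proj (iN D) (Xh D i q (xth D)) = proj (iN D) (lcomb2 1 u (-1) (fundQ D (conn D q u) q) (xth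
        D))"
      using fund_vertical[OF c q] Xh(3)[OF q i] 1
          by (simp add: lcomb2_def linear_diff[OF linear_proj] u(2))
    show "conn D q (Xh D i q) = conn D q (lcomb2 1 u (-1) (fundQ D (conn D q u) q))"
      unfolding conn_lcomb2[OF u(1) f] conn_fund[OF c] Xh(2)[OF q i] by (simp add: lcomb2_def)
  qed
qed

lemma Xh_C1:
  assumes i: "i \<in> iN D"
  shows "C1_on (field_rep (Xh D i) (xth D)) (cmap (xth D) ` cdom (xth D))"
proof (rule C1_on_cong[OF open_xth(2)])
  let ?u = "\<lambda>z. conn D (cinv (xth D) z) (coord_vec (atQ D) (xth D) (cinv (xth D) z) (axis i 1)) kap"
  let ?m = "\<lambda>z. mder (iK D) kap (xth D) (\<lambda>h. act D h (cinv (xth D) z)) \<one>\<^bsub>Gr D\<^esub>"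
  show "C1_on (\<lambda>z. axis i 1 - (\<Sum>b\<in>Basis. (?u z \<bullet> b) *\<^sub>R ?m z b)) (cmap (xth D) ` cdom (xth D))"
    by (intro C1_on_diff C1_on_const C1_on_sum C1_on_scaleR C1_on_inner conn_C1[OF xth_atQ]
        orbit_map_C1)
  fix z assume z: "z \<in> cmap (xth D) ` cdom (xth D)"
  let ?q = "cinv (xth D) z"
  have q: "?q \<in> cdom (xth D)" "act D \<one>\<^bsub>Gr D\<^esub> ?q \<in> cdom (xth D)"
    using cinv_xth_image[OF z] by (simp_all add: act_simps)
  note u = coord_vec_TQ[OF xth_atQ q(1), of "axis i 1"]
  have "linear (?m z)" by (rule mder_linear[OF mdiff_act(2) kap(1) xth_atQ kap(2) q(2)])
  from linear_sum_Basis[OF this, of "?u z"]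
  show "axis i 1 - (\<Sum>b\<in>Basis. (?u z \<bullet> b) *\<^sub>R ?m z b) = field_rep (Xh D i) (xth D) z"
    using Xh_eq[OF q(1) i refl] fund_xth[OF conn_lieG[OF u(1)] q(1)]
        by (simp add: field_rep_def lcomb2_def u(2))
qed

text \<open>In the trivialization, \<open>\<hat>E\<^sub>a\<close> is a left-invariant vector field of the group.\<close>

lemma Ehat_xth:
  assumes q: "q \<in> cdom (xth D)" and a: "a \<in> iK D"
  shows "Ehat D a q (xth D) =
    frechet_derivative (\<lambda>w. cmap (thG D) (grp D q \<otimes>\<^bsub>Gr D\<^esub> pull (iK D) kap w)) (at (cmap kap \<one>\<^bsub>Gr D\<^esub>))
        (bas D a kap)"
proof -
  let ?g = "grp D q" and ?c = "\<lambda>h. grp D q \<otimes>\<^bsub>Gr D\<^esub> h \<otimes>\<^bsub>Gr D\<^esub> inv\<^bsub>Gr D\<^esub> (grp D q)"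
  have qU: "q \<in> QU D" "?g \<in> cdom (thG D)" using q by (simp_all add: cdom_xth)
  have E: "bas D a \<in> tspace (coord_space (iK D)) (atG D) \<one>\<^bsub>Gr D\<^esub>" using bas_lieG[OF a]
      by (simp add: lieG_def)
  have m: "mdiff (iK D) (atG D) (atQ D) (\<lambda>h. act D (?c h) q) \<one>\<^bsub>Gr D\<^esub>"
    by (rule mdiff_compose(1)[OF mdiff_conj mdiff_act(2) mG mG])
  have q1: "act D (?c \<one>\<^bsub>Gr D\<^esub>) q \<in> cdom (xth D)" using q by (simp add: conj_one act_simps)
  have "Ehat D a q = tangent_map (atG D) (atQ D) (\<lambda>h. act D (?c h) q) \<one>\<^bsub>Gr D\<^esub> (bas D a)"
    using tangent_map_compose[OF mG mG mdiff_conj mdiff_act(2) E, of "?g" q]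
    by (simp add: Ehat_def fund_def Ad_def conj_one)
  then have "Ehat D a q (xth D) = mder (iK D) kap (xth D) (\<lambda>h. act D (?c h) q) \<one>\<^bsub>Gr D\<^esub> (bas D a kap)"
    using tangent_map_eq_mder[OF mG m E kap(1) xth_atQ kap(2) q1] by simp
  moreover have "mder (iK D) kap (xth D) (\<lambda>h. act D (?c h) q) \<one>\<^bsub>Gr D\<^esub> =
    frechet_derivative (\<lambda>w. cmap (thG D) (?g \<otimes>\<^bsub>Gr D\<^esub> pull (iK D) kap w)) (at (cmap kap \<one>\<^bsub>Gr D\<^esub>))"
  proof (rule mder_eqI)
    have g1: "?g \<otimes>\<^bsub>Gr D\<^esub> \<one>\<^bsub>Gr D\<^esub> \<in> cdom (thG D)" using qU by (simp add: group_simps)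
    have "((\<lambda>w. cmap (thG D) (?g \<otimes>\<^bsub>Gr D\<^esub> pull (iK D) kap w)) has_derivative
      frechet_derivative (\<lambda>w. cmap (thG D) (?g \<otimes>\<^bsub>Gr D\<^esub> pull (iK D) kap w)) (at (cmap kap \<one>\<^bsub>Gr D\<^esub>))) (at
          (cmap kap \<one>\<^bsub>Gr D\<^esub>))"
      using mdiff_mder[OF mdiff_mult(1) kap(1) thG_atG kap(2) g1] by (simp add: mder_def)
    from has_derivative_add[OF has_derivative_const this, of "xco D q"]
    show "((\<lambda>w. xco D q + cmap (thG D) (?g \<otimes>\<^bsub>Gr D\<^esub> pull (iK D) kap w)) has_derivative
      frechet_derivative (\<lambda>w. cmap (thG D) (?g \<otimes>\<^bsub>Gr D\<^esub> pull (iK D) kap w)) (at (cmap kap \<one>\<^bsub>Gr D\<^esub>))) (at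
          (cmap kap \<one>\<^bsub>Gr D\<^esub>))"
      by simp
    \<comment> \<open>The conjugation built into \<open>Ad\<close> turns the left translation by the
      action into a right multiplication of the group component: \<open>g h g^-1\<close> times
      \<open>g\<close> is \<open>g h\<close>.\<close>
    have "?c h \<otimes>\<^bsub>Gr D\<^esub> ?g = ?g \<otimes>\<^bsub>Gr D\<^esub> h" for h
        by (simp add: group_simps(1)[symmetric] group_simps(2-8))
    then show "\<forall>\<^sub>F w in nhds (cmap kap \<one>\<^bsub>Gr D\<^esub>). xco D q + cmap (thG D) (?g \<otimes>\<^bsub>Gr D\<^esub> pull (iK D) kap w) =
      cmap (xth D) (act D (?c (pull (iK D) kap w)) q)"
      by (simp add: cmap_xth xco_act grp_act[OF qU(1)])
  qed
  ultimately show ?thesis by simp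
qed

lemma Ehat_C1:
  assumes a: "a \<in> iK D"
  shows "C1_on (field_rep (Ehat D a) (xth D)) (cmap (xth D) ` cdom (xth D))"
proof (rule C1_on_local[OF open_xth(2)])
  fix z assume z: "z \<in> cmap (xth D) ` cdom (xth D)"
  let ?q = "cinv (xth D) z" let ?g = "grp D ?q"
  have q: "?q \<in> cdom (xth D)" "cmap (xth D) ?q = z" using cinv_xth_image[OF z] .
  have gth: "grp D (cinv (xth D) y) = pull (iK D) (thG D) y" if "y \<in> cmap (xth D) ` cdom (xth D)" for y
    using cinv_xth_image[OF that] proj_xth(2)[of "cinv (xth D) y"]
      is_chart_cinv[OF manifold_is_chart[OF mG thG_atG], of "grp D (cinv (xth D) y)"]
    by (simp add: pull_def cdom_xth)
  have g: "?g \<in> cdom (thG D)" "?g \<otimes>\<^bsub>Gr D\<^esub> \<one>\<^bsub>Gr D\<^esub> \<in> cdom (thG D)" using q(1)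
      by (simp_all add: cdom_xth group_simps)
  obtain U where U: "open U" "(cmap (thG D) ?g, cmap kap \<one>\<^bsub>Gr D\<^esub>) \<in> U"
    "C2_on (\<lambda>(y, w). cmap (thG D) (pull (iK D) (thG D) y \<otimes>\<^bsub>Gr D\<^esub> pull (iK D) kap w)) U"
    using smooth_map2_C2_on[OF mG mG mG smooth_mult thG_atG kap(1) thG_atG g(1) kap(2) g(2)]
        by (elim exE conjE)
  \<comment> \<open>Exchanges the two variables, since \<open>C2_on_partial\<close> differentiates
    the first one, here the group element near the identity; the coordinates on \<open>Q\<close> are
    reduced to their group part.\<close>
  let ?s = "\<lambda>x::(real ^ 'm) \<times> (real ^ 'm). (proj (iK D) (snd x), fst x)"
  let ?f = "\<lambda>(y, w). cmap (thG D) (pull (iK D) (thG D) y \<otimes>\<^bsub>Gr D\<^esub> pull (iK D) kap w)"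
  have s: "bounded_linear ?s"
    by (intro bounded_linear_Pair bounded_linear_fst bounded_linear_compose[OF bounded_linear_proj
        bounded_linear_snd])
  have sU: "open (?s -` U)" by (rule open_vimage[OF U(1)]) (intro continuous_intros)
  have C2: "C2_on (\<lambda>x. ?f (?s x)) (?s -` U)" by (rule C2_on_compose_linear[OF U(3) s]) auto
  let ?V = "{y. (cmap kap \<one>\<^bsub>Gr D\<^esub>, y) \<in> ?s -` U} \<inter> cmap (xth D) ` cdom (xth D)"
  have V: "open ?V"
    using open_vimage[OF sU, of "\<lambda>y. (cmap kap \<one>\<^bsub>Gr D\<^esub>, y)"] open_xth(2)
    by (auto simp: vimage_def continuous_intros)
  have "C1_on (\<lambda>y. frechet_derivative (\<lambda>w. ?f (?s (w, y))) (at (cmap kap \<one>\<^bsub>Gr D\<^esub>)) (bas D a kap)) ?V"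
    by (rule C1_on_subset[OF C2_on_partial[OF C2 sU]]) auto
  then have "C1_on (field_rep (Ehat D a) (xth D)) ?V"
  proof (rule C1_on_cong[OF V, rotated])
    fix y assume y: "y \<in> ?V"
    then have y': "y \<in> cmap (xth D) ` cdom (xth D)" by blast
    show "frechet_derivative (\<lambda>w. ?f (?s (w, y))) (at (cmap kap \<one>\<^bsub>Gr D\<^esub>)) (bas D a kap) = field_rep
        (Ehat D a) (xth D) y"
      using Ehat_xth[OF cinv_xth_image(1)[OF y'] a] gth[OF y'] by (simp add: field_rep_def)
  qed
  moreover have "z \<in> ?V" using U(2) z q proj_xth(2)[OF q(1)] by simp
  ultimately show "\<exists>T. open T \<and> z \<in> T \<and> C1_on (field_rep (Ehat D a) (xth D)) T" using V by blast
qed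

lemma frame_hat_field: "(\<lambda>q. frame_hat D q \<alpha>) = (if \<alpha> \<in> iN D then Xh D \<alpha> else Ehat D \<alpha>)"
  by (simp add: frame_hat_def fun_eq_iff)

lemma frame_hat_C1: "C1_on (field_rep (\<lambda>q. frame_hat D q \<alpha>) (xth D)) (cmap (xth D) ` cdom (xth D))"
  using Xh_C1 Ehat_C1 by (simp add: frame_hat_field iN_iK)

lemma frame_hat_differentiable:
  assumes q: "q \<in> cdom (xth D)" and c: "c \<in> atQ D" "q \<in> cdom c"
  shows "field_rep (\<lambda>q. frame_hat D q \<alpha>) c differentiable (at (cmap c q))"
proof (rule field_rep_differentiable_change[OF Q xth_atQ c(1) q c(2) open_xth(1) q])
  show "\<forall>r\<in>cdom (xth D). frame_hat D r \<alpha> \<in> tspace UNIV (atQ D) r"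
    using frame_hat_TQ by (simp add: TQ_def)
  show "field_rep (\<lambda>q. frame_hat D q \<alpha>) (xth D) differentiable (at (cmap (xth D) q))"
    by (rule C1_on_differentiable[OF frame_hat_C1 imageI[OF q]])
qed

subsection \<open>Equivariance\<close>

text \<open>Coordinates that the action leaves unchanged near \<open>q\<close> have unchanged
  differentials. This covers the x-coordinates for every \<open>h\<close>, and the \<theta>^I for
  \<open>h\<close> in \<open>Gmu\<close>, whose orbits are their level sets.\<close>

lemma actT_proj:
  assumes q: "q \<in> cdom (xth D)" "act D h q \<in> cdom (xth D)" and w: "w \<in> TQ D q"
    and J: "\<And>r. r \<in> cdom (xth D) \<Longrightarrow> act D h r \<in> cdom (xth D) \<Longrightarrow>
      proj J (cmap (xth D) (act D h r)) = proj J (cmap (xth D) r)"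
  shows "proj J (actT D h q w (xth D)) = proj J (w (xth D))"
proof -
  let ?m = "mder UNIV (xth D) (xth D) (act D h) q"
  note * = mdiff_act(1) xth_atQ xth_atQ q
  have 1: "((\<lambda>y. proj J (cmap (xth D) (act D h (pull UNIV (xth D) y)))) has_derivative (\<lambda>e. proj J (?m
      e))) (at (cmap (xth D) q))"
    by (rule bounded_linear.has_derivative[OF bounded_linear_proj mdiff_mder[OF *]])
  have "\<forall>\<^sub>F y in nhds (cmap (xth D) q). proj J (cmap (xth D) (act D h (pull UNIV (xth D) y))) = proj J
      y"
    using mdiff_eventually[OF *]
  proof eventually_elim
    case (elim y)
    then show ?case using J[of "cinv (xth D) y"] cinv_xth_image[of y] by simp
  qed
  from has_derivative_unique[OF has_derivative_transform_nhds[OF 1 this]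
      bounded_linear_imp_has_derivative[OF bounded_linear_proj]]
  have "proj J (?m e) = proj J e" for e by metis
  then show ?thesis
    using tangent_map_eq_mder[OF mQ mdiff_act(1) w[unfolded TQ_tspace] xth_atQ xth_atQ q]
        by (simp add: actT_def)
qed

lemma actT_dx:
  assumes "q \<in> cdom (xth D)" "act D h q \<in> cdom (xth D)" "w \<in> TQ D q"
  shows "proj (iN D) (actT D h q w (xth D)) = proj (iN D) (w (xth D))"
  by (rule actT_proj[OF assms]) (simp add: proj_xth xco_act)

lemma proj_iI_xth: "q \<in> cdom (xth D) \<Longrightarrow> proj (iI D) (cmap (xth D) q) = proj (iI D) (cmap (thG D) (grp D
    q))"
  using proj_disjoint[of "iI D" "iN D" "xco D q"] indices(3) xco_coord[of q]
  by (simp add: cmap_xth proj_add cdom_xth Int_commute)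

lemma actT_dtheta:
  assumes "q \<in> cdom (xth D)" "act D h q \<in> cdom (xth D)" "w \<in> TQ D q" and h: "h \<in> Gmu D"
  shows "proj (iI D) (actT D h q w (xth D)) = proj (iI D) (w (xth D))"
proof (rule actT_proj[OF assms(1-3)])
  fix r assume r: "r \<in> cdom (xth D)" "act D h r \<in> cdom (xth D)"
  then have "grp D (act D h r) = h \<otimes>\<^bsub>Gr D\<^esub> grp D r" by (simp add: cdom_xth grp_act)
  then have "\<forall>I\<in>iI D. cmap (thG D) (grp D r) $ I = cmap (thG D) (grp D (act D h r)) $ I"
    using fibre_coords r h unfolding fibre_chart_def cdom_xth by blast
  then show "proj (iI D) (cmap (xth D) (act D h r)) = proj (iI D) (cmap (xth D) r)"
    by (simp add: proj_iI_xth r vec_eq_iff)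
qed

text \<open>Both sides are vertical and have connection form \<open>AdG D h \<xi>\<close>. As these
  data determine the vector, the underlying identity in the group need not be
  differentiated.\<close>

lemma actT_fund:
  assumes q: "q \<in> cdom (xth D)" "act D h q \<in> cdom (xth D)" and \<xi>: "\<xi> \<in> lieG D"
  shows "fundQ D (AdG D h \<xi>) (act D h q) = actT D h q (fundQ D \<xi> q)"
  using fund_vertical[OF Ad_lieG[OF \<xi>] q(2)] actT_dx[OF q fund_TQ[OF \<xi>]] fund_vertical[OF \<xi> q(1)]
  by (intro TQ_eqI_conn[OF q(2) fund_TQ[OF Ad_lieG[OF \<xi>]] actT_TQ[OF fund_TQ[OF \<xi>]]])
    (simp_all add: conn_fund[OF Ad_lieG[OF \<xi>]] conn_actT[OF fund_TQ[OF \<xi>]] conn_fund[OF \<xi>])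

lemma actT_Xh:
  assumes q: "q \<in> cdom (xth D)" "act D h q \<in> cdom (xth D)" and i: "i \<in> iN D"
  shows "Xh D i (act D h q) = actT D h q (Xh D i q)"
  using actT_dx[OF q Xh(1)[OF q(1) i]]
  by (intro TQ_eqI_conn[OF q(2) Xh(1)[OF q(2) i] actT_TQ[OF Xh(1)[OF q(1) i]]])
    (simp_all add: Xh[OF q(1) i] Xh[OF q(2) i] conn_actT[OF Xh(1)[OF q(1) i]] Ad_zero)

text \<open>Translation by \<open>h\<close> changes the group component to \<open>h g\<close>, and
  \<open>Ad\<close> of this product is exactly the \<open>Ad h\<close> by which generators change;
  the two effects match.\<close>

lemma actT_frame_hat:
  assumes q: "q \<in> cdom (xth D)" "act D h q \<in> cdom (xth D)"
  shows "frame_hat D (act D h q) \<alpha> = actT D h q (frame_hat D q \<alpha>)"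
proof (cases "\<alpha> \<in> iN D")
  case True
  then show ?thesis by (simp add: frame_hat_def actT_Xh[OF q])
next
  case False
  then have a: "\<alpha> \<in> iK D" by (simp add: iN_iK)
  have "grp D (act D h q) = h \<otimes>\<^bsub>Gr D\<^esub> grp D q" using q by (simp add: cdom_xth grp_act)
  then show ?thesis
    using False actT_fund[OF q Ad_lieG[OF bas_lieG[OF a]]]
    by (simp add: frame_hat_def Ehat_def Ad_mult[OF bas_lieG[OF a]])
qed

lemma actT_lcomb_hat:
  assumes q: "q \<in> cdom (xth D)" "act D h q \<in> cdom (xth D)"
  shows "lcomb r (frame_hat D (act D h q)) = actT D h q (lcomb r (frame_hat D q))"
proof -
  have "actT D h q (lcomb r (frame_hat D q)) = lcomb r (\<lambda>\<alpha>. actT D h q (frame_hat D q \<alpha>))"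
    by (rule lcomb_hom[where T = "actT D h q" and p = q and F = "frame_hat D q", OF mQ])
      (unfold TQ_tspace[symmetric], simp_all add: actT_lcomb2 frame_hat_TQ[OF q(1)])
  then show ?thesis by (simp add: lcomb_def actT_frame_hat[OF q])
qed

text \<open>The Routhian as a function of quasi-velocities in the invariant frame, at an actual
  point of \<open>Q\<close>; in contrast to \<open>red_routhian\<close> no representative is
  chosen.\<close>

definition rho :: "'q \<Rightarrow> real ^ 'm \<Rightarrow> real" where
  "rho q r = routhian D q (lcomb r (frame_hat D q))"

lemma mu_Ad: "h \<in> Gmu D \<Longrightarrow> \<xi> \<in> lieG D \<Longrightarrow> mu D (AdG D h \<xi>) = mu D \<xi>"
  by (simp add: Gmu_def)

text \<open>The frame and the Lagrangian are invariant, and the remaining term changes only by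
  \<open>Ad h\<close> inside \<open>mu\<close>, which isotropy removes.\<close>

lemma rho_act:
  assumes q: "q \<in> cdom (xth D)" "act D h q \<in> cdom (xth D)" and h: "h \<in> Gmu D"
  shows "rho (act D h q) r = rho q r"
proof -
  let ?w = "lcomb r (frame_hat D q)"
  have w: "?w \<in> TQ D q" by (rule lcomb_hat_TQ[OF q(1)])
  have "Lag D (act D h q) (actT D h q ?w) = Lag D q ?w"
    using lagrangian(2) w by (simp add: invariant_lagrangian_def)
  then show ?thesis
    by (simp add: rho_def actT_lcomb_hat[OF q] routhian_eq[OF q(2) actT_TQ[OF w]] routhian_eq[OF q(1) w]
      conn_actT[OF w] mu_Ad[OF h conn_lieG[OF w]])
qed

section \<open>Functions on the quotient and their representatives\<close>

lemma overD: "over D y \<eta> q \<Longrightarrow> q \<in> cdom (xth D)"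
  by (simp add: over_def)

lemma over_iff: "over D y \<eta> q \<longleftrightarrow> q \<in> cdom (xth D) \<and> proj (iN D) (cmap (xth D) q) = y \<and> proj (iI D) (cmap
    (xth D) q) = \<eta>"
  using proj_xth(1)[of q] proj_iI_xth[of q] unfolding over_def by (auto simp: proj_def)

text \<open>Equal \<theta>^I provide an element of \<open>Gmu\<close> relating the group components;
  with equal x, the translated point then has the same coordinates as \<open>q'\<close>, and charts
  are injective.\<close>

lemma over_same_orbit:
  assumes q: "over D y \<eta> q" "over D y \<eta> q'"
  obtains h where "h \<in> Gmu D" "q' = act D h q"
proof -
  have c: "q \<in> cdom (xth D)" "q' \<in> cdom (xth D)" using q by (simp_all add: over_def)
  then have g: "grp D q \<in> cdom (thG D)" "grp D q' \<in> cdom (thG D)" "q \<in> QU D" by (simp_all add: cdom_xth)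
  have "(\<chi> I. if I \<in> iI D then cmap (thG D) (grp D q) $ I else 0) = (\<chi> I. if I \<in> iI D then cmap (thG D)
      (grp D q') $ I else 0)"
    using q by (simp add: over_def)
  then have "\<forall>I\<in>iI D. cmap (thG D) (grp D q) $ I = cmap (thG D) (grp D q') $ I"
    by (metis (mono_tags, lifting) vec_lambda_beta)
  then obtain h where h: "h \<in> Gmu D" "grp D q' = h \<otimes>\<^bsub>Gr D\<^esub> grp D q"
    using fibre_coords g unfolding fibre_chart_def by blast
  have "grp D (act D h q) = grp D q'" by (simp add: grp_act[OF g(3)] h(2))
  moreover have "xco D (act D h q) = xco D q'" using q by (simp add: xco_act over_def)
  moreover have hq: "act D h q \<in> cdom (xth D)" using c calculation(1) by (simp add: cdom_xth QU_act)
  ultimately have "cmap (xth D) (act D h q) = cmap (xth D) q'" by (simp add: cmap_xth)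
  then have "q' = act D h q" using cinv_xth[OF c(2)] cinv_xth[OF hq] by simp
  with h(1) show thesis by (rule that)
qed

text \<open>Makes the \<open>SOME\<close> in \<open>repr\<close> harmless: an invariant function may
  be evaluated at any point above, in particular along the lifted curve.\<close>

lemma induced_eq:
  assumes q: "over D y \<eta> q"
    and f: "\<And>q h. q \<in> cdom (xth D) \<Longrightarrow> act D h q \<in> cdom (xth D) \<Longrightarrow> h \<in> Gmu D \<Longrightarrow> f (act D h q) = f q"
  shows "f (repr D y \<eta>) = f q"
proof -
  have r: "over D y \<eta> (repr D y \<eta>)" unfolding repr_def by (rule someI[of "over D y \<eta>", OF q])
  obtain h where h: "h \<in> Gmu D" "repr D y \<eta> = act D h q" by (rule over_same_orbit[OF q r])
  then show ?thesis using f[of q h] overD[OF q] overD[OF r] by simp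
qed

lemma red_routhian_eq: "over D y \<eta> q \<Longrightarrow> red_routhian D y \<eta> u w = rho q (u + w)"
  using induced_eq[where f = "\<lambda>q. rho q (u + w)", OF _ rho_act] by (simp add: red_routhian_def rho_def)

lemma Lco_act:
  assumes "I \<in> iI D" "a \<in> iK D" "q \<in> cdom (xth D)" "act D h q \<in> cdom (xth D)" "h \<in> Gmu D"
  shows "Lco D I a (act D h q) = Lco D I a q"
proof -
  have E: "Ehat D a q = frame_hat D q a" for q using assms(2) by (simp add: frame_hat_def iN_iK)
  have "proj (iI D) (Ehat D a (act D h q) (xth D)) $ I = proj (iI D) (Ehat D a q (xth D)) $ I"
    unfolding E by (simp only: actT_frame_hat[OF assms(3,4)] actT_dtheta[OF assms(3,4) frame_hat_TQ[OF
        assms(3)] assms(5)])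
  then show ?thesis using assms(1) by (simp add: Lco_def)
qed

lemma Lam_act:
  assumes "I \<in> iI D" "i \<in> iN D" "q \<in> cdom (xth D)" "act D h q \<in> cdom (xth D)" "h \<in> Gmu D"
  shows "Lam D I i (act D h q) = Lam D I i q"
proof -
  have "proj (iI D) (Xh D i (act D h q) (xth D)) $ I = proj (iI D) (Xh D i q (xth D)) $ I"
    by (simp only: actT_Xh[OF assms(3,4,2)] actT_dtheta[OF assms(3,4) Xh(1)[OF assms(3,2)] assms(5)])
  then show ?thesis using assms(1) by (simp add: Lam_def)
qed

lemma Xh_differentiable:
  assumes "q \<in> cdom (xth D)" "i \<in> iN D" shows "field_rep (Xh D i) (xth D) differentiable (at (cmap (xth
      D) q))"
  by (rule C1_on_differentiable[OF Xh_C1[OF assms(2)] imageI[OF assms(1)]])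

lemma bracket_TQ:
  assumes q: "q \<in> cdom (xth D)" and i: "i \<in> iN D" "j \<in> iN D"
  shows "lie_bracket (atQ D) (Xh D i) (Xh D j) q \<in> TQ D q"
  unfolding TQ_def
  by (rule lie_bracket_in_tspace[OF Q xth_atQ q open_xth(1) q])
    (use Xh(1) Xh_differentiable[OF q] i in \<open>auto simp: TQ_def\<close>)

text \<open>The coefficient is \<open>mu\<close> of the connection form of the bracket of two
  horizontal lifts. The bracket is equivariant because the lifts are, so its connection form changes
  by \<open>Ad h\<close>, which \<open>mu\<close> does not see for \<open>h\<close> in
  \<open>Gmu\<close>.\<close>

lemma muB_act:
  assumes i: "i \<in> iN D" "j \<in> iN D" and q: "q \<in> cdom (xth D)" "act D h q \<in> cdom (xth D)"
      and h: "h \<in> Gmu D"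
  shows "muB D i j (act D h q) = muB D i j q"
proof -
  let ?b = "lie_bracket (atQ D) (Xh D i) (Xh D j)"
  have rel: "\<forall>r\<in>cdom (xth D). r \<in> cdom (xth D) \<longrightarrow> act D h r \<in> cdom (xth D) \<longrightarrow>
    Xh D i (act D h r) (xth D) = mder UNIV (xth D) (xth D) (act D h) r (Xh D i r (xth D))"
        if "i \<in> iN D" for i
    using actT_Xh[OF _ _ that] tangent_map_eq_mder[OF mQ mdiff_act(1) Xh(1)[OF _ that, unfolded
        TQ_tspace] xth_atQ xth_atQ]
    by (simp add: actT_def)
  have "?b (act D h q) (xth D) = mder UNIV (xth D) (xth D) (act D h) q (?b q (xth D))"
    by (rule lie_bracket_related[where f = "act D h" and g = "act D (inv\<^bsub>Gr D\<^esub> h)" and q = q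
        and X = "Xh D i" and X' = "Xh D i" and Y = "Xh D j"
            and Y' = "Xh D j", OF Q xth_atQ xth_atQ q _ _ _ _ act_C2[OF xth_atQ xth_atQ q]
        open_xth(1) q(1) rel[OF i(1)] Xh_differentiable[OF q(1) i(1)] rel[OF i(2)] Xh_differentiable[OF
            q(1) i(2)]])
      (simp_all add: mdiff_act(1) act_inverse)
  also have "\<dots> = actT D h q (?b q) (xth D)"
    using tangent_map_eq_mder[OF mQ mdiff_act(1) bracket_TQ[OF q(1) i, unfolded TQ_tspace] xth_atQ
        xth_atQ q]
    by (simp add: actT_def)
  finally have eq: "?b (act D h q) = actT D h q (?b q)"
    by (intro TQ_eqI[OF bracket_TQ[OF q(2) i] actT_TQ[OF bracket_TQ[OF q(1) i]] xth_atQ q(2)])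
  show ?thesis
    using mu_conn[OF q(1) bracket_TQ[OF q(1) i]] mu_conn[OF q(2) bracket_TQ[OF q(2) i]]
      mu_Ad[OF h conn_lieG[OF bracket_TQ[OF q(1) i]]] conn_actT[OF bracket_TQ[OF q(1) i], of h]
    by (simp add: muB_def Bcoef_def eq)
qed

subsection \<open>Vertical and complete lifts of the frame applied to the Routhian\<close>

text \<open>\<open>mu\<close> in the coordinates of the Lie algebra given by \<open>kap\<close>: a
  linear function on a normed space, which can be composed with derivatives.\<close>

definition mu_kap :: "real ^ 'm \<Rightarrow> real" where
  "mu_kap e = mu D (coord_vec (atG D) kap \<one>\<^bsub>Gr D\<^esub> (proj (iK D) e))"

lemma mu_kap: "\<xi> \<in> lieG D \<Longrightarrow> mu D \<xi> = mu_kap (\<xi> kap)"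
  using tspace_eq_coord_vec[OF mG kap, of \<xi>] tspace_coord[OF _ kap, of \<xi> "coord_space (iK D)"]
  by (simp add: mu_kap_def lieG_def)

lemma mu_kap_linear: "linear mu_kap"
proof -
  let ?c = "\<lambda>e. coord_vec (atG D) kap \<one>\<^bsub>Gr D\<^esub> (proj (iK D) e)"
  have c: "?c e \<in> lieG D" "?c e kap = proj (iK D) e" for e
    unfolding lieG_def by (rule coord_vec_in_tspace[OF mG kap] coord_vec_self[OF mG kap], simp)+
  have l: "?c (a *\<^sub>R e + b *\<^sub>R f) = lcomb2 a (?c e) b (?c f)" for a b e f
    by (rule tspace_eqI[OF mG c(1)[unfolded lieG_def] lcomb2_lieG[OF c(1) c(1), unfolded lieG_def] kap])
      (simp only: c(2) lcomb2_def, simp only: linear_add[OF linear_proj] linear_scale[OF linear_proj])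
  have m: "mu_kap (a *\<^sub>R e + b *\<^sub>R f) = a * mu_kap e + b * mu_kap f" for a b e f
    using mu c(1) unfolding mu_kap_def l functional_on_def by blast
  show ?thesis
  proof (rule linearI)
    show "mu_kap (e + f) = mu_kap e + mu_kap f" for e f using m[of 1 e 1 f] by simp
    show "mu_kap (a *\<^sub>R e) = a *\<^sub>R mu_kap e" for a e using m[of a e 0 0] by simp
  qed
qed

text \<open>Separates the fibre variable from the base point: a finite sum of linear functions of
  \<open>e\<close> times functions of \<open>q\<close>.\<close>

lemma conn_coord_vec:
  assumes c: "c \<in> atQ D" "q \<in> cdom c"
  shows "mu D (conn D q (coord_vec (atQ D) c q e)) =
    (\<Sum>b\<in>Basis. (e \<bullet> b) * mu_kap (conn D q (coord_vec (atQ D) c q b) kap))"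
proof -
  let ?f = "\<lambda>e. mu D (conn D q (coord_vec (atQ D) c q e))"
  note cv = coord_vec_TQ[OF c]
  have l: "coord_vec (atQ D) c q (s *\<^sub>R e + t *\<^sub>R f) = lcomb2 s (coord_vec (atQ D) c q e) t (coord_vec
      (atQ D) c q f)" for s t e f
    by (rule TQ_eqI[OF cv(1) lcomb2_TQ[OF cv(1) cv(1)] c]) (simp add: cv(2) lcomb2_def)
  have m: "?f (s *\<^sub>R e + t *\<^sub>R f) = s * ?f e + t * ?f f" for s t e f
    using mu conn_lieG[OF cv(1)] unfolding l conn_lcomb2[OF cv(1) cv(1)] functional_on_def by blast
  have "linear ?f"
  proof (rule linearI)
    show "?f (e + f) = ?f e + ?f f" for e f using m[of 1 e 1 f] by simp
    show "?f (a *\<^sub>R e) = a *\<^sub>R ?f e" for a e using m[of a e 0 0] by simp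
  qed
  from linear_sum_Basis[OF this, of e] show ?thesis
    by (simp add: mu_kap[OF conn_lieG[OF cv(1)]])
qed

lemma mu_conn_differentiable:
  assumes c: "c \<in> atQ D" "y \<in> cmap c ` cdom c"
  shows "(\<lambda>z. mu_kap (conn D (cinv c z) (coord_vec (atQ D) c (cinv c z) e) kap)) differentiable (at y)"
proof -
  obtain F where "((\<lambda>z. conn D (cinv c z) (coord_vec (atQ D) c (cinv c z) e) kap) has_derivative F) (at
      y)"
    using C1_on_differentiable[OF conn_C1[OF c(1)] c(2)] unfolding differentiable_def by blast
  from bounded_linear.has_derivative[OF linear_conv_bounded_linear[THEN iffD1, OF mu_kap_linear] this]
  show ?thesis by (rule differentiableI)
qed

lemma bundle_rep_eq:
  assumes c: "c \<in> atQ D" "q \<in> cdom c" and w: "w \<in> TQ D q"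
  shows "bundle_rep (atQ D) F c (cmap c q, w c) = F q w"
  using is_chart_cinv[OF manifold_is_chart[OF Q c(1)] c(2)] tspace_eq_coord_vec[OF mQ c w[unfolded
      TQ_tspace]]
  by (simp add: bundle_rep_def)

text \<open>In a chart the Lagrangian is C^1, and the subtracted term is a sum of linear functions
  of the fibre times differentiable functions of the base. The chart must be arbitrary because the
  lifts compute in \<open>chart_at\<close>, not in \<open>xth D\<close>.\<close>

lemma bundle_rep_routhian_differentiable:
  assumes q: "q \<in> cdom (xth D)" and c: "c \<in> atQ D" "q \<in> cdom c"
  shows "bundle_rep (atQ D) (routhian D) c differentiable (at (cmap c q, e))"
proof -
  let ?I = "cmap c ` cdom c"
  have I: "open ?I" by (rule open_chart_image[OF Q c(1)])
  have "smooth_on (bundle_rep (atQ D) (Lag D) c) (?I \<times> UNIV)"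
    using lagrangian(1) c by (simp add: smooth_lagrangian_def)
  then have "C1_on (bundle_rep (atQ D) (Lag D) c) (?I \<times> UNIV)"
    by (rule smooth_on_imp_C1_on) (simp add: open_Times I)
  then have L: "bundle_rep (atQ D) (Lag D) c differentiable (at (cmap c q, e))"
    by (rule C1_on_differentiable) (use c in simp)
  let ?m = "\<lambda>b z. mu_kap (conn D (cinv c z) (coord_vec (atQ D) c (cinv c z) b) kap)"
  have m: "(\<lambda>x. ?m b (fst x)) differentiable (at (cmap c q, e))" for b
  proof -
    have "?m b differentiable (at (fst (cmap c q, e)))"
      using mu_conn_differentiable[OF c(1) imageI[OF c(2)]] by simp
    from differentiable_chain_at[OF bounded_linear_imp_differentiable[OF bounded_linear_fst] this]
    show ?thesis by (simp add: o_def)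
  qed
  have i: "(\<lambda>x. snd x \<bullet> b) differentiable (at (cmap c q, e))" for b
    by (rule bounded_linear_imp_differentiable[OF bounded_linear_compose[OF bounded_linear_inner_left
        bounded_linear_snd]])
  have "(\<lambda>x. bundle_rep (atQ D) (Lag D) c x - (\<Sum>b\<in>Basis. (snd x \<bullet> b) * ?m b (fst x))) differentiable
      (at (cmap c q, e))"
    by (intro differentiable_diff L differentiable_sum differentiable_mult i m finite_Basis ballI)
  then obtain F where F: "((\<lambda>x. bundle_rep (atQ D) (Lag D) c x - (\<Sum>b\<in>Basis. (snd x \<bullet> b) * ?m b (fst
      x))) has_derivative F) (at (cmap c q, e))"
    unfolding differentiable_def by blast
  have "(bundle_rep (atQ D) (routhian D) c has_derivative F) (at (cmap c q, e))"
  proof (rule has_derivative_transform_nhds[OF F])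
    have "\<forall>\<^sub>F y in nhds (cmap c q). y \<in> ?I \<and> cinv c y \<in> cdom (xth D)"
      using eventually_chart[OF Q c open_xth(1) q] eventually_nhds_in_open[OF I imageI[OF c(2)]]
      by eventually_elim simp
    then have "\<forall>\<^sub>F x in nhds (cmap c q, e). fst x \<in> ?I \<and> cinv c (fst x) \<in> cdom (xth D)"
      by (rule eventually_compose_filterlim) (use tendsto_fst[OF filterlim_ident[of "nhds (cmap c q,
          e)"]] in simp)
    then show "\<forall>\<^sub>F x in nhds (cmap c q, e). bundle_rep (atQ D) (Lag D) c x - (\<Sum>b\<in>Basis. (snd x \<bullet> b) *
        ?m b (fst x)) =
        bundle_rep (atQ D) (routhian D) c x"
    proof eventually_elim
      case (elim x)
      let ?q = "cinv c (fst x)"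
      have q: "?q \<in> cdom c" using elim by (simp add: inv_into_into)
      note cv = coord_vec_TQ[OF c(1) q, of "snd x"]
      show ?case using routhian_eq[OF _ cv(1)] elim conn_coord_vec[OF c(1) q, of "snd x"]
        by (simp add: bundle_rep_def case_prod_beta)
    qed
  qed
  then show ?thesis by (rule differentiableI)
qed

text \<open>Adding a multiple of a frame vector changes a single quasi-velocity, so vertical lifts
  of frame fields are partial derivatives of \<open>rho q\<close>.\<close>

lemma rho_vertical:
  assumes q: "q \<in> cdom (xth D)"
  shows "((\<lambda>s. rho q (r + s *\<^sub>R axis \<alpha> 1)) has_real_derivative
    vertical_lift (atQ D) (\<lambda>q. frame_hat D q \<alpha>) (routhian D) q (lcomb r (frame_hat D q))) (at 0)"
proof -
  let ?c = "chart_at (atQ D) q" and ?v = "lcomb r (frame_hat D q)"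
  note c = manifold_chart_at[OF Q, of q]
  let ?R = "bundle_rep (atQ D) (routhian D) ?c"
  have R: "(?R has_derivative frechet_derivative ?R (at (cmap ?c q, ?v ?c))) (at (cmap ?c q, ?v ?c))"
    using bundle_rep_routhian_differentiable[OF q c] unfolding frechet_derivative_works .
  have "?R ((cmap ?c q, ?v ?c) + s *\<^sub>R (0, frame_hat D q \<alpha> ?c)) = rho q (r + s *\<^sub>R axis \<alpha> 1)" for s
    using bundle_rep_eq[OF c lcomb_hat_TQ[OF q], of "routhian D" "r + s *\<^sub>R axis \<alpha> 1"]
    by (simp add: lcomb_add_axis rho_def)
  with has_derivative_along_line[OF R, of "(0, frame_hat D q \<alpha> ?c)"] show ?thesis
    by (simp only: vertical_lift_def Let_def)
qed

lemma frame_hat_dx: "q \<in> cdom (xth D) \<Longrightarrow> proj (iN D) (frame_hat D q \<alpha> (xth D)) = proj (iN D) (axis \<alpha> 1)"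
  using hat_dx[of q "axis \<alpha> 1"] by (simp add: lcomb_axis)

text \<open>The x-components of every frame field are constant; in this way each bracket of two
  frame fields is seen to be vertical.\<close>

lemma field_rep_constant_dx:
  assumes q: "q \<in> cdom (xth D)" and Z: "\<And>r. r \<in> cdom (xth D) \<Longrightarrow> proj (iN D) (Z r (xth D)) = k"
    and d: "field_rep Z (xth D) differentiable (at (cmap (xth D) q))"
  shows "proj (iN D) (frechet_derivative (field_rep Z (xth D)) (at (cmap (xth D) q)) e) = 0"
proof -
  note d = d[unfolded frechet_derivative_works]
  have "\<forall>\<^sub>F y in nhds (cmap (xth D) q). proj (iN D) (field_rep Z (xth D) y) = k"
    using eventually_nhds_in_open[OF open_xth(2) imageI[OF q]]
    by eventually_elim (simp add: field_rep_def Z cinv_xth_image)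
  from has_derivative_transform_nhds[OF bounded_linear.has_derivative[OF bounded_linear_proj d] this]
  have "((\<lambda>y. k) has_derivative (\<lambda>e. proj (iN D) (frechet_derivative (field_rep Z (xth D)) (at (cmap
      (xth D) q)) e))) (at (cmap (xth D) q))" .
  from has_derivative_unique[OF this has_derivative_const] show ?thesis by (rule fun_cong)
qed

text \<open>Moving the base point along \<open>X\<^sub>i\<close> with constant quasi-velocities differs from the complete
  lift by the vertical lift of a combination of the brackets of the frame with \<open>X\<^sub>i\<close>. That vector
  is vertical, so its vertical lift kills the Routhian wherever the \<open>\<hat>E\<^sub>a\<close> do.\<close>

lemma rho_complete:
  assumes q: "q \<in> cdom (xth D)" and i: "i \<in> iN D"
    and vert: "\<forall>a\<in>iK D. vertical_lift (atQ D) (\<lambda>q. frame_hat D q a) (routhian D) q (lcomb r (frame_hat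
        D q)) = 0"
  shows "\<exists>F. ((\<lambda>z. rho (cinv (xth D) z) r) has_derivative F) (at (cmap (xth D) q)) \<and>
    F (Xh D i q (xth D)) = complete_lift (atQ D) (Xh D i) (routhian D) q (lcomb r (frame_hat D q))"
proof -
  let ?c = "chart_at (atQ D) q" and ?v = "lcomb r (frame_hat D q)" and ?x = "xth D"
  let ?Z = "\<lambda>\<alpha> q. frame_hat D q \<alpha>"
  note c = manifold_chart_at[OF Q, of q]
  let ?R = "bundle_rep (atQ D) (routhian D) ?c"
  define R' where "R' = frechet_derivative ?R (at (cmap ?c q, ?v ?c))"
  have R: "(?R has_derivative R') (at (cmap ?c q, ?v ?c))"
    using bundle_rep_routhian_differentiable[OF q c] unfolding R'_def frechet_derivative_works .
  have R'lin: "linear R'" using R has_derivative_linear by blast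
  let ?M = "mder UNIV ?x ?c (\<lambda>x. x) q"
  define dZ where "dZ = (\<lambda>\<alpha>. frechet_derivative (field_rep (?Z \<alpha>) ?c) (at (cmap ?c q)))"
  have dZ: "(field_rep (?Z \<alpha>) ?c has_derivative dZ \<alpha>) (at (cmap ?c q))" for \<alpha>
    using frame_hat_differentiable[OF q c] unfolding dZ_def frechet_derivative_works .
  have X: "?Z i = Xh D i" using i by (simp add: frame_hat_field)
  have cq: "cmap ?c (cinv ?x (cmap ?x q)) = cmap ?c q" "cinv ?c (cmap ?c q) = q"
    using cinv_xth[OF q] is_chart_cinv[OF manifold_is_chart[OF Q c(1)] c(2)] by simp_all
  \<comment> \<open>Fibre coordinates, in the chart used by the lifts, of the vector with the fixed
    quasi-velocities \<open>r\<close> over the point with coordinates \<open>z\<close>.\<close>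
  define e where "e = (\<lambda>z. \<Sum>\<alpha>\<in>UNIV. r $ \<alpha> *\<^sub>R field_rep (?Z \<alpha>) ?c (cmap ?c (cinv ?x z)))"
  note phi = transition_has_derivative(1)[OF Q xth_atQ c(1) q c(2)]
  have Zphi: "((\<lambda>z. field_rep (?Z \<alpha>) ?c (cmap ?c (cinv ?x z))) has_derivative (\<lambda>h. dZ \<alpha> (?M h))) (at
      (cmap ?x q))" for \<alpha>
    by (rule has_derivative_compose[OF phi]) (simp only: cq dZ)
  have e: "(e has_derivative (\<lambda>h. \<Sum>\<alpha>\<in>UNIV. r $ \<alpha> *\<^sub>R dZ \<alpha> (?M h))) (at (cmap ?x q))"
    unfolding e_def by (intro has_derivative_sum has_derivative_scaleR_right Zphi)
  have e0: "e (cmap ?x q) = ?v ?c" by (simp add: e_def lcomb_def field_rep_def cq)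
  define F where "F = (\<lambda>h. R' (?M h, \<Sum>\<alpha>\<in>UNIV. r $ \<alpha> *\<^sub>R dZ \<alpha> (?M h)))"
  have "((\<lambda>z. ?R (cmap ?c (cinv ?x z), e z)) has_derivative F) (at (cmap ?x q))"
    unfolding F_def by (rule has_derivative_compose[OF has_derivative_Pair[OF phi e]]) (simp only: cq
        e0 R)
  then have "((\<lambda>z. rho (cinv ?x z) r) has_derivative F) (at (cmap ?x q))"
  proof (rule has_derivative_transform_nhds)
    show "\<forall>\<^sub>F z in nhds (cmap ?x q). ?R (cmap ?c (cinv ?x z), e z) = rho (cinv ?x z) r"
      using transition_has_derivative(2)[OF Q xth_atQ c(1) q c(2)]
    proof eventually_elim
      case (elim z)
      let ?p = "cinv ?x z"
      have p: "?p \<in> cdom ?x" "?p \<in> cdom ?c" using elim by blast+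
      have "e z = lcomb r (frame_hat D ?p) ?c"
        by (simp add: e_def lcomb_def field_rep_def is_chart_cinv[OF manifold_is_chart[OF Q c(1)] p(2)])
      then show ?case using bundle_rep_eq[OF c(1) p(2) lcomb_hat_TQ[OF p(1)]] by (simp add: rho_def)
    qed
  qed
  moreover have "F (Xh D i q ?x) = complete_lift (atQ D) (Xh D i) (routhian D) q ?v"
  proof -
    let ?b = "\<lambda>\<alpha>. lie_bracket (atQ D) (?Z \<alpha>) (?Z i) q"
    have Zx: "field_rep (?Z \<alpha>) ?x differentiable (at (cmap ?x q))" for \<alpha>
      by (rule C1_on_differentiable[OF frame_hat_C1 imageI[OF q]])
    have Zt: "\<forall>r\<in>cdom ?x. ?Z \<alpha> r \<in> tspace UNIV (atQ D) r" for \<alpha> using frame_hat_TQ by (simp add: TQ_def)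
    have b: "?b \<alpha> \<in> TQ D q" for \<alpha>
      unfolding TQ_def by (rule lie_bracket_in_tspace[OF Q xth_atQ q open_xth(1) q Zt Zx Zt Zx])
    have bx: "proj (iN D) (?b \<alpha> ?x) = 0" for \<alpha>
      using field_rep_constant_dx[OF q frame_hat_dx Zx] q xth_atQ
      by (simp add: lie_bracket_def linear_diff[OF linear_proj])
    \<comment> \<open>This combination of brackets is the exact correction: \<open>wc\<close> shows
      that its components are the fibre direction of the complete lift minus the derivative of
      \<open>e\<close> along \<open>Xh D i\<close>.\<close>
    define w where "w = lcomb r ?b"
    have w: "w \<in> TQ D q"
      using lcomb_in_tspace[OF mQ, of r ?b q] b by (simp add: w_def TQ_tspace)
    have wx: "proj (iN D) (w ?x) = 0"
      by (simp add: w_def lcomb_def linear_sum[OF linear_proj] linear_scale[OF linear_proj] bx)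
    have Xq: "frame_hat D q i = Xh D i q" using i by (simp add: frame_hat_def)
    have bc: "?b \<alpha> ?c = dZ i (frame_hat D q \<alpha> ?c) - dZ \<alpha> (Xh D i q ?c)" for \<alpha>
      using c by (simp add: lie_bracket_def dZ_def Xq)
    have "dZ i (?v ?c) = (\<Sum>\<alpha>\<in>UNIV. r $ \<alpha> *\<^sub>R dZ i (frame_hat D q \<alpha> ?c))"
      using has_derivative_linear[OF dZ[of i]] by (simp add: lcomb_def linear_sum linear_scale)
    then have wc: "w ?c = dZ i (?v ?c) - (\<Sum>\<alpha>\<in>UNIV. r $ \<alpha> *\<^sub>R dZ \<alpha> (Xh D i q ?c))"
      by (simp add: w_def lcomb_def bc scaleR_diff_right sum_subtractf)
    define s where "s = comps (frame_hat D q) w"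
    have s: "w = lcomb s (frame_hat D q)" unfolding s_def by (rule comps_hat(1)[OF q w])
    have sN: "proj (iN D) s = 0" using hat_dx[OF q, of s] wx s by simp
    have R0: "R' (0, u + u') = R' (0, u) + R' (0, u')" "R' (0, k *\<^sub>R u) = k * R' (0, u)" for u u' k
      using linear_add[OF R'lin, of "(0, u)" "(0, u')"] linear_scale[OF R'lin, of k "(0, u)"]
          by simp_all
    have "linear (\<lambda>u. R' (0, u))" by (rule linearI) (simp_all add: R0)
    then have "R' (0, w ?c) = (\<Sum>\<alpha>\<in>UNIV. s $ \<alpha> * R' (0, frame_hat D q \<alpha> ?c))"
      by (subst s) (simp add: lcomb_def linear_sum R0 linear_sum[where f = "\<lambda>u. R' (0, u)"])
    also have "\<dots> = 0"
    proof (rule sum.neutral, rule ballI)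
      fix \<alpha>
      show "s $ \<alpha> * R' (0, frame_hat D q \<alpha> ?c) = 0"
      proof (cases "\<alpha> \<in> iN D")
        case True
        then have "s $ \<alpha> = proj (iN D) s $ \<alpha>" by simp
        then show ?thesis by (simp add: sN)
      next
        case False
        then have "R' (0, frame_hat D q \<alpha> ?c) = 0"
          using vert unfolding vertical_lift_def Let_def R'_def by (simp add: iN_iK)
        then show ?thesis by simp
      qed
    qed
    finally have w0: "R' (0, w ?c) = 0" .
    have "?M (Xh D i q ?x) = Xh D i q ?c"
      by (rule tspace_trans[OF mQ Xh(1)[OF q i, unfolded TQ_tspace] xth_atQ c(1) q c(2), symmetric])
    then have "F (Xh D i q ?x) = R' (Xh D i q ?c, \<Sum>\<alpha>\<in>UNIV. r $ \<alpha> *\<^sub>R dZ \<alpha> (Xh D i q ?c)) + R' (0, w ?c)"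
      by (simp add: F_def w0)
    also have "\<dots> = R' (Xh D i q ?c, dZ i (?v ?c))"
      using linear_add[OF R'lin, of "(Xh D i q ?c, \<Sum>\<alpha>\<in>UNIV. r $ \<alpha> *\<^sub>R dZ \<alpha> (Xh D i q ?c))" "(0, w ?c)"]
      by (simp add: wc)
    finally show ?thesis by (simp add: complete_lift_def Let_def R'_def dZ_def X)
  qed
  ultimately show ?thesis by blast
qed

section \<open>Partial derivatives of the reduced Routhian\<close>

lemma line_in_xth:
  assumes q: "q \<in> cdom (xth D)"
  shows "\<forall>\<^sub>F s in nhds 0. cmap (xth D) q + s *\<^sub>R a \<in> cmap (xth D) ` cdom (xth D)"
proof -
  have "open ((\<lambda>s. cmap (xth D) q + s *\<^sub>R a) -` (cmap (xth D) ` cdom (xth D)))"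
    by (rule open_vimage[OF open_xth(2)]) (intro continuous_intros)
  then show ?thesis unfolding eventually_nhds
    by (rule_tac exI[of _ "(\<lambda>s. cmap (xth D) q + s *\<^sub>R a) -` (cmap (xth D) ` cdom (xth D))"]) (use q in
        auto)
qed

lemma over_cinv:
  assumes "z \<in> cmap (xth D) ` cdom (xth D)"
  shows "over D (proj (iN D) z) (proj (iI D) z) (cinv (xth D) z)"
  using cinv_xth_image[OF assms] by (simp add: over_iff)

lemma proj_axis: "proj K (axis \<alpha> 1) = (if \<alpha> \<in> K then axis \<alpha> 1 else 0)"
  by (auto simp: vec_eq_iff axis_def)

text \<open>A coordinate line moves the point of the quotient only in directions of
  \<open>iN\<close> and \<open>iI\<close>. In a direction of \<open>iA\<close> it stays over the
  same \<open>y\<close> and \<open>\<eta>\<close>, so invariance forces the derivative to vanish.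
  Along each line \<open>rho\<close> may replace \<open>red_routhian\<close>, whatever
  representative the latter selects.\<close>

lemma rho_derivative_axis:
  assumes q: "over D y \<eta> q" and F: "((\<lambda>z. rho (cinv (xth D) z) (u + w)) has_derivative F) (at (cmap
      (xth D) q))"
  shows "i \<in> iN D \<Longrightarrow> pdiff i (\<lambda>y. red_routhian D y \<eta> u w) y = F (axis i 1)"
    and "I \<in> iI D \<Longrightarrow> pdiff I (\<lambda>\<eta>. red_routhian D y \<eta> u w) \<eta> = F (axis I 1)"
    and "a \<in> iA D \<Longrightarrow> F (axis a 1) = 0"
proof -
  have qx: "q \<in> cdom (xth D)" and yz: "proj (iN D) (cmap (xth D) q) = y" "proj (iI D) (cmap (xth D) q)
      = \<eta>"
    using q by (simp_all add: over_iff)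
  have D: "((\<lambda>s. red_routhian D (y + s *\<^sub>R proj (iN D) (axis \<alpha> 1)) (\<eta> + s *\<^sub>R proj (iI D) (axis \<alpha> 1)) u
      w)
      has_real_derivative F (axis \<alpha> 1)) (at 0)" for \<alpha>
  proof (rule DERIV_eventually[OF has_derivative_along_line[OF F]])
    show "\<forall>\<^sub>F s in nhds 0. rho (cinv (xth D) (cmap (xth D) q + s *\<^sub>R axis \<alpha> 1)) (u + w) =
      red_routhian D (y + s *\<^sub>R proj (iN D) (axis \<alpha> 1)) (\<eta> + s *\<^sub>R proj (iI D) (axis \<alpha> 1)) u w"
      using line_in_xth[OF qx, of "axis \<alpha> 1"]
    proof eventually_elim
      case (elim s)
      from red_routhian_eq[OF over_cinv[OF elim], of u w] show ?case
        by (simp add: proj_add linear_scale[OF linear_proj] yz)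
    qed
  qed
  have disj: "i \<notin> iI D" if "i \<in> iN D" for i using that indices by blast
  have disj2: "I \<notin> iN D" if "I \<in> iI D" for I using that indices by blast
  have disj': "i \<notin> iN D" "i \<notin> iI D" if "i \<in> iA D" for i using that indices by blast+
  show "i \<in> iN D \<Longrightarrow> pdiff i (\<lambda>y. red_routhian D y \<eta> u w) y = F (axis i 1)"
    using DERIV_imp_deriv[OF D[of i]] disj[of i] by (simp add: pdiff_def proj_axis)
  show "I \<in> iI D \<Longrightarrow> pdiff I (\<lambda>\<eta>. red_routhian D y \<eta> u w) \<eta> = F (axis I 1)"
    using DERIV_imp_deriv[OF D[of I]] disj2[of I] by (simp add: pdiff_def proj_axis)
  show "a \<in> iA D \<Longrightarrow> F (axis a 1) = 0"
    using DERIV_unique[OF D[of a], of 0] disj'(1)[of a] disj'(2)[of a] by (simp add: proj_axis)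
qed

lemma Xh_expand:
  assumes q: "q \<in> cdom (xth D)" and i: "i \<in> iN D"
  shows "Xh D i q (xth D) = axis i 1 - (\<Sum>a\<in>iK D. Lam D a i q *\<^sub>R axis a 1)"
proof -
  let ?X = "Xh D i q (xth D)"
  have "?X = proj (iN D) ?X + proj (iK D) ?X" by (simp add: proj_iN_iK)
  also have "proj (iK D) ?X = (\<Sum>a\<in>iK D. (?X $ a) *\<^sub>R axis a 1)" by (rule proj_sum_axis)
  finally show ?thesis by (simp add: Xh(3)[OF q i] Lam_def sum_negf)
qed

text \<open>\<open>rho_complete\<close> reduces the complete lift to a directional derivative along
  \<open>Xh D i\<close>, whose coordinate components are 1 along x^i and the negatives of
  \<open>Lam\<close>; the terms with index in \<open>iA\<close> drop out by invariance.\<close>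

lemma complete_lift_Xh_routhian:
  assumes q: "over D y \<eta> q" and i: "i \<in> iN D"
    and vert: "\<forall>a\<in>iK D. vertical_lift (atQ D) (\<lambda>q. frame_hat D q a) (routhian D) q (lcomb (u + w)
        (frame_hat D q)) = 0"
  shows "complete_lift (atQ D) (Xh D i) (routhian D) q (lcomb (u + w) (frame_hat D q)) =
    pdiff i (\<lambda>y. red_routhian D y \<eta> u w) y - (\<Sum>I\<in>iI D. Lam D I i q * pdiff I (\<lambda>\<eta>. red_routhian D y \<eta> u
        w) \<eta>)"
proof -
  have qx: "q \<in> cdom (xth D)" by (rule overD[OF q])
  obtain F where F: "((\<lambda>z. rho (cinv (xth D) z) (u + w)) has_derivative F) (at (cmap (xth D) q))"
    "F (Xh D i q (xth D)) = complete_lift (atQ D) (Xh D i) (routhian D) q (lcomb (u + w) (frame_hat D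
        q))"
    using rho_complete[OF qx i vert] by (elim exE conjE)
  have lin: "linear F" by (rule has_derivative_linear[OF F(1)])
  have fin: "finite (iA D)" "finite (iI D)" by simp_all
  have "F (Xh D i q (xth D)) = F (axis i 1) - (\<Sum>a\<in>iK D. Lam D a i q * F (axis a 1))"
    unfolding Xh_expand[OF qx i] by (simp add: linear_diff[OF lin] linear_sum[OF lin] linear_scale[OF
        lin])
  also have "(\<Sum>a\<in>iK D. Lam D a i q * F (axis a 1)) = (\<Sum>I\<in>iI D. Lam D I i q * F (axis I 1))"
    unfolding iK_def sum.union_disjoint[OF fin indices(4)] using rho_derivative_axis(3)[OF q F(1)]
        by simp
  finally show ?thesis
    using F(2) rho_derivative_axis(1)[OF q F(1) i] rho_derivative_axis(2)[OF q F(1)] by simp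
qed

subsection \<open>Reconstruction\<close>

lemma frame_field_C1:
  "C1_on (\<lambda>x. \<Sum>\<alpha>\<in>UNIV. (snd x $ \<alpha>) *\<^sub>R field_rep (\<lambda>q. frame_hat D q \<alpha>) (xth D) (fst x))
    ((cmap (xth D) ` cdom (xth D)) \<times> UNIV)"
proof (intro C1_on_sum C1_on_scaleR)
  fix \<alpha>
  show "C1_on (\<lambda>x::(real ^ 'm) \<times> (real ^ 'm). snd x $ \<alpha>) (cmap (xth D) ` cdom (xth D) \<times> UNIV)"
    by (rule C1_on_linear[OF bounded_linear_compose[OF bounded_linear_vec_nth bounded_linear_snd]])
  show "C1_on (\<lambda>x::(real ^ 'm) \<times> (real ^ 'm). field_rep (\<lambda>q. frame_hat D q \<alpha>) (xth D) (fst x)) (cmap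
      (xth D) ` cdom (xth D) \<times> UNIV)"
    by (rule C1_on_compose[OF frame_hat_C1 C1_on_linear[OF bounded_linear_fst]]) auto
qed

text \<open>The equation for \<open>\<theta>\<^sup>A\<close> is an ordinary differential equation with locally
  Lipschitz right-hand side.\<close>

lemma reconstruction:
  assumes T: "open T" "t0 \<in> T"
    and y: "continuous_on T y" and u: "continuous_on T u"
    and z0: "z0 \<in> cmap (xth D) ` cdom (xth D)" "z0 = y t0 + proj (iA D) z0"
  obtains d \<zeta> where "d > 0" "{t0 - d<..<t0 + d} \<subseteq> T"
    "\<And>t. t \<in> {t0 - d<..<t0 + d} \<Longrightarrow> \<zeta> t \<in> coord_space (iA D)"
    "\<And>t. t \<in> {t0 - d<..<t0 + d} \<Longrightarrow> y t + \<zeta> t \<in> cmap (xth D) ` cdom (xth D)"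
    "\<And>t. t \<in> {t0 - d<..<t0 + d} \<Longrightarrow> (\<zeta> has_vector_derivative
      proj (iA D) (lcomb (u t) (frame_hat D (cinv (xth D) (y t + \<zeta> t))) (xth D))) (at t)"
proof -
  let ?I = "cmap (xth D) ` cdom (xth D)"
  define H where "H = (\<lambda>x. proj (iA D) (\<Sum>\<alpha>\<in>UNIV. (snd x $ \<alpha>) *\<^sub>R field_rep (\<lambda>q. frame_hat D q \<alpha>) (xth
      D) (fst x)))"
  have HC: "C1_on H (?I \<times> UNIV)" unfolding H_def
    by (rule C1_on_compose[OF C1_on_linear[OF bounded_linear_proj] frame_field_C1 subset_UNIV])
  have Hl: "H (z, v) = proj (iA D) (lcomb v (frame_hat D (cinv (xth D) z)) (xth D))" for z v
    by (simp add: H_def lcomb_def field_rep_def)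
  have "open (?I \<times> (UNIV :: (real ^ 'm) set))" by (intro open_Times open_xth(2) open_UNIV)
  from C1_on_imp_lipschitz_nhd[OF HC this, of "(z0, u t0)"] z0(1)
  obtain r B where r: "r > 0" "cball (z0, u t0) r \<subseteq> ?I \<times> UNIV" and B: "B \<ge> 0"
    and lip: "\<And>p p'. p \<in> cball (z0, u t0) r \<Longrightarrow> p' \<in> cball (z0, u t0) r \<Longrightarrow> norm (H p - H p') \<le> B * norm (p
        - p')"
    by auto
  \<comment> \<open>One third of the radius is allotted to each of three displacements: of
    \<open>y\<close>, of the unknown \<open>\<zeta>\<close> and of \<open>u\<close>.\<close>
  have r3: "r / 3 > 0" using r by simp
  obtain a1 where a1: "a1 > 0" "cball t0 a1 \<subseteq> T" using T open_contains_cball by blast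
  have "isCont y t0" "isCont u t0" using y u T by (simp_all add: continuous_on_eq_continuous_at)
  then obtain a2 a3 where a2: "a2 > 0" "\<And>t. dist t t0 < a2 \<Longrightarrow> dist (y t) (y t0) < r / 3"
    and a3: "a3 > 0" "\<And>t. dist t t0 < a3 \<Longrightarrow> dist (u t) (u t0) < r / 3"
    using r3 unfolding continuous_at_eps_delta by (metis dist_norm)
  \<comment> \<open>Halves of \<open>a2\<close> and \<open>a3\<close>, since the time interval is
    closed whereas the continuity estimates require strict inequality.\<close>
  define a where "a = min a1 (min (a2 / 2) (a3 / 2))"
  have a: "a > 0" using a1 a2 a3 by (simp add: a_def)
  have near: "t \<in> T \<and> norm (y t - y t0) \<le> r / 3 \<and> norm (u t - u t0) \<le> r / 3"
      if "t \<in> {t0 - a..t0 + a}" for t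
  proof -
    have "dist t t0 \<le> a" using that by (auto simp: dist_real_def)
    then have "dist t t0 \<le> a1" "dist t t0 < a2" "dist t t0 < a3" using a2(1) a3(1) by (auto simp: a_def)
    then show ?thesis using a1(2) less_imp_le[OF a2(2)] less_imp_le[OF a3(2)]
      by (auto simp: dist_norm dist_commute subset_iff)
  qed
  define \<zeta>0 where "\<zeta>0 = proj (iA D) z0"
  \<comment> \<open>The unknown is projected before use, so the equation can be posed on the whole
    model space; the projection of its solution solves the equation for the \<theta>^A
    alone.\<close>
  let ?p = "\<lambda>t \<zeta>. (y t + proj (iA D) \<zeta>, u t)"
  have pball: "?p t \<zeta> \<in> cball (z0, u t0) r" if "t \<in> {t0 - a..t0 + a}" "\<zeta> \<in> cball \<zeta>0 (r / 3)" for t \<zeta>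
  proof -
    have z: "z0 = y t0 + proj (iA D) \<zeta>0" using z0(2) by (simp add: \<zeta>0_def)
    have "(z0, u t0) - ?p t \<zeta> = (- (y t - y t0) + proj (iA D) (\<zeta>0 - \<zeta>), - (u t - u t0))"
      by (subst z) (simp add: linear_diff[OF linear_proj])
    then have "norm ((z0, u t0) - ?p t \<zeta>) \<le> norm (- (y t - y t0) + proj (iA D) (\<zeta>0 - \<zeta>)) + norm (- (u t
        - u t0))"
      by (simp only: norm_Pair_le)
    also have "\<dots> \<le> (norm (y t - y t0) + norm (\<zeta>0 - \<zeta>)) + norm (u t - u t0)"
      using norm_triangle_ineq[of "- (y t - y t0)" "proj (iA D) (\<zeta>0 - \<zeta>)"] norm_proj_le[of "iA D" "\<zeta>0 -
          \<zeta>"]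
      by (simp only: norm_minus_cancel)
    also have "\<dots> \<le> r" using near[OF that(1)] that(2) by (simp add: dist_norm)
    finally show ?thesis by (simp add: dist_norm)
  qed
  have cont: "continuous_on ({t0 - a..t0 + a} \<times> cball \<zeta>0 (r / 3)) (\<lambda>(t, \<zeta>). H (?p t \<zeta>))"
  proof -
    let ?S = "{t0 - a..t0 + a} \<times> cball \<zeta>0 (r / 3)"
    have fst: "fst ` ?S \<subseteq> T" using near by auto
    have "continuous_on ?S (\<lambda>s. (y (fst s) + proj (iA D) (snd s), u (fst s)))"
      by (intro continuous_intros continuous_on_compose2[OF y _ fst] continuous_on_compose2[OF u _ fst])
    from continuous_on_compose2[OF C1_on_continuous[OF HC] this]
    have "continuous_on ?S (\<lambda>s. H (?p (fst s) (snd s)))"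
      using pball r(2) by force
    then show ?thesis by (simp add: case_prod_beta)
  qed
  have lip': "norm (H (?p t \<zeta>) - H (?p t \<zeta>')) \<le> B * norm (\<zeta> - \<zeta>')"
    if "t \<in> {t0 - a..t0 + a}" "\<zeta> \<in> cball \<zeta>0 (r / 3)" "\<zeta>' \<in> cball \<zeta>0 (r / 3)" for t \<zeta> \<zeta>'
  proof -
    have "norm (H (?p t \<zeta>) - H (?p t \<zeta>')) \<le> B * norm (?p t \<zeta> - ?p t \<zeta>')"
      by (rule lip[OF pball[OF that(1,2)] pball[OF that(1,3)]])
    also have "norm (?p t \<zeta> - ?p t \<zeta>') = norm (proj (iA D) (\<zeta> - \<zeta>'))"
      by (simp add: norm_Pair linear_diff[OF linear_proj])
    also have "B * \<dots> \<le> B * norm (\<zeta> - \<zeta>')" using B by (intro mult_left_mono norm_proj_le)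
    finally show ?thesis .
  qed
  from picard_lindelof[where f = "\<lambda>t \<zeta>. H (?p t \<zeta>)", OF a r3 cont lip']
  obtain d \<zeta> where d: "0 < d" "d \<le> a" and \<zeta>: "\<And>t. t \<in> {t0 - d<..<t0 + d} \<Longrightarrow>
      \<zeta> t \<in> cball \<zeta>0 (r / 3) \<and> (\<zeta> has_vector_derivative H (?p t (\<zeta> t))) (at t)" by blast
  show thesis
  proof (rule that[of d "\<lambda>t. proj (iA D) (\<zeta> t)"])
    show "d > 0" by (rule d)
    show "{t0 - d<..<t0 + d} \<subseteq> T" using near d(2) by auto
    fix t assume t: "t \<in> {t0 - d<..<t0 + d}"
    then have ta: "t \<in> {t0 - a..t0 + a}" using d(2) by auto
    show "proj (iA D) (\<zeta> t) \<in> coord_space (iA D)" by simp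
    show "y t + proj (iA D) (\<zeta> t) \<in> ?I" using pball[OF ta] \<zeta>[OF t] r(2) by blast
    have "((\<lambda>t. proj (iA D) (\<zeta> t)) has_vector_derivative proj (iA D) (H (?p t (\<zeta> t)))) (at t)"
      by (rule bounded_linear.has_vector_derivative[OF bounded_linear_proj]) (use \<zeta>[OF t] in blast)
    then show "((\<lambda>t. proj (iA D) (\<zeta> t)) has_vector_derivative
      proj (iA D) (lcomb (u t) (frame_hat D (cinv (xth D) (y t + proj (iA D) (\<zeta> t)))) (xth D))) (at t)"
      by (simp add: Hl)
  qed
qed

section \<open>The covector of the lift and the \<theta>^I-components of its fibre vector\<close>

text \<open>The momentum condition prescribes the values on generators, and \<open>\<pi>\<close>
  those on horizontal lifts. The value 0 off the tangent space is the convention of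
  \<open>functional_on\<close>.\<close>

definition covector :: "'q \<Rightarrow> real ^ 'm \<Rightarrow> ('q, real ^ 'm) tvec \<Rightarrow> real" where
  "covector q \<pi> w = (if w \<in> TQ D q then mu D (conn D q w) + (\<Sum>i\<in>iN D. \<pi> $ i * w (xth D) $ i) else 0)"

lemma covector_functional: "functional_on (TQ D q) (covector q \<pi>)"
  unfolding functional_on_def
proof (intro conjI ballI allI impI)
  fix u w a b assume uw: "u \<in> TQ D q" "w \<in> TQ D q"
  have "mu D (conn D q (lcomb2 a u b w)) = a * mu D (conn D q u) + b * mu D (conn D q w)"
    using mu conn_lieG[OF uw(1)] conn_lieG[OF uw(2)] unfolding conn_lcomb2[OF uw] functional_on_def
        by blast
  then show "covector q \<pi> (lcomb2 a u b w) = a * covector q \<pi> u + b * covector q \<pi> w"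
    using lcomb2_TQ[OF uw] uw
    by (simp add: covector_def lcomb2_def sum.distrib sum_distrib_left algebra_simps)
qed (simp add: covector_def)

lemma covector_fund:
  assumes q: "q \<in> cdom (xth D)" and \<xi>: "\<xi> \<in> lieG D" shows "covector q \<pi> (fundQ D \<xi> q) = mu D \<xi>"
proof -
  have "fundQ D \<xi> q (xth D) $ i = 0" if "i \<in> iN D" for i
    using arg_cong[OF fund_vertical[OF \<xi> q], of "\<lambda>v. v $ i"] that by simp
  then show ?thesis by (simp add: covector_def fund_TQ[OF \<xi>] conn_fund[OF \<xi>])
qed

lemma covector_Xh:
  assumes q: "q \<in> cdom (xth D)" and i: "i \<in> iN D" shows "covector q \<pi> (Xh D i q) = \<pi> $ i"
proof -
  have "Xh D i q (xth D) $ j = axis i 1 $ j" if "j \<in> iN D" for j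
    using arg_cong[OF Xh(3)[OF q i], of "\<lambda>v. v $ j"] that by simp
  then have "covector q \<pi> (Xh D i q) = (\<Sum>j\<in>iN D. \<pi> $ j * axis i 1 $ j)"
    by (simp add: covector_def Xh[OF q i] mu_zero)
  also have "\<dots> = (\<Sum>j\<in>iN D. if j = i then \<pi> $ j else 0)" by (intro sum.cong) (auto simp: axis_def)
  finally show ?thesis using i by simp
qed

lemma covector_coord_vec:
  assumes q: "q \<in> cdom (xth D)"
  shows "covector q \<pi> (coord_vec (atQ D) (xth D) q e) =
    (\<Sum>b\<in>Basis. (e \<bullet> b) * mu_kap (conn D q (coord_vec (atQ D) (xth D) q b) kap)) + (\<Sum>i\<in>iN D. \<pi> $ i * e $
        i)"
  using coord_vec_TQ[OF xth_atQ q] conn_coord_vec[OF xth_atQ q] by (simp add: covector_def)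

text \<open>Without the hypothesis on \<open>Lco\<close> the quasi-velocities of the isotropy
  algebra would enter here. With it the component is exactly the right-hand side of the equation for
  \<theta>^I.\<close>

lemma hat_xth_component:
  assumes q: "q \<in> cdom (xth D)" and I: "I \<in> iI D" and v: "v \<in> coord_space (iN D)"
      and w: "w \<in> coord_space (iK D)"
    and L: "\<And>A. A \<in> iA D \<Longrightarrow> Lco D I A q = 0"
  shows "lcomb (v + w) (frame_hat D q) (xth D) $ I =
    (\<Sum>J\<in>iI D. w $ J * Lco D I J q) - (\<Sum>i\<in>iN D. v $ i * Lam D I i q)"
proof -
  have fin: "finite (iN D)" "finite (iK D)" "finite (iA D)" "finite (iI D)" by simp_all
  have U: "UNIV = iN D \<union> iK D" "iN D \<inter> iK D = {}" by (auto simp: iN_iK)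
  have v0: "v $ \<alpha> = 0" if "\<alpha> \<in> iK D" for \<alpha> using v that by (simp add: coord_space_def iN_iK)
  have w0: "w $ \<alpha> = 0" if "\<alpha> \<in> iN D" for \<alpha> using w that by (simp add: coord_space_def iN_iK)
  have "lcomb (v + w) (frame_hat D q) (xth D) $ I = (\<Sum>\<alpha>\<in>iN D \<union> iK D. (v + w) $ \<alpha> * frame_hat D q \<alpha> (xth
      D) $ I)"
    by (simp add: lcomb_def U(1)[symmetric])
  also have "\<dots> = (\<Sum>i\<in>iN D. (v + w) $ i * frame_hat D q i (xth D) $ I) + (\<Sum>a\<in>iK D. (v + w) $ a *
      frame_hat D q a (xth D) $ I)"
    by (rule sum.union_disjoint[OF fin(1,2) U(2)])
  also have "(\<Sum>i\<in>iN D. (v + w) $ i * frame_hat D q i (xth D) $ I) = - (\<Sum>i\<in>iN D. v $ i * Lam D I i q)"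
    by (simp add: w0 frame_hat_def Lam_def sum_negf)
  also have "(\<Sum>a\<in>iK D. (v + w) $ a * frame_hat D q a (xth D) $ I) = (\<Sum>a\<in>iK D. w $ a * Lco D I a q)"
    by (simp add: v0 frame_hat_def Lco_def iN_iK)
  also have "\<dots> = (\<Sum>J\<in>iI D. w $ J * Lco D I J q)"
    unfolding iK_def sum.union_disjoint[OF fin(3,4) indices(4)] by (simp add: L)
  finally show ?thesis by simp
qed

end

section \<open>The reduced equations\<close>

theorem proposition4p1:
  fixes D :: "('g::{t2_space, second_countable_topology}, 'q::{t2_space, second_countable_topology},
               'm::finite) routh_data"
    and T :: "real set"
    and x \<theta> v vh p :: "real \<Rightarrow> real ^ 'm"
  assumes indices: "iN D \<union> iA D \<union> iI D = UNIV" "iN D \<inter> iA D = {}" "iN D \<inter> iI D = {}" "iA D \<inter> iI D = {}"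
    and G: "lie_group (coord_space (iK D)) (Gr D) (atG D)" "connected (UNIV :: 'g set)"
    and Q: "manifold UNIV (atQ D)"
    and action: "smooth_action (Gr D) (atG D) (atQ D) (act D)"
      "free_action (Gr D) (act D)" "proper_action (act D)"
    and lagrangian: "smooth_lagrangian D" "invariant_lagrangian D"
    and connection: "principal_connection D"
    and mu: "functional_on (lieG D) (mu D)"
    and basis: "adapted_basis D"
    and local_triv: "trivialized D"
    and fibre_coords: "fibre_chart D"
    and L_IA: "\<And>q A I. q \<in> cdom (xth D) \<Longrightarrow> A \<in> iA D \<Longrightarrow> I \<in> iI D \<Longrightarrow> Lco D I A q = 0"
    and times: "open T" "is_interval T"
    and curve: "\<And>t. t \<in> T \<Longrightarrow> (x t, \<theta> t) \<in> patch D"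
      "\<And>t. t \<in> T \<Longrightarrow> v t \<in> coord_space (iN D)"
      "\<And>t. t \<in> T \<Longrightarrow> vh t \<in> coord_space (iK D)"
      "\<And>t. t \<in> T \<Longrightarrow> p t \<in> coord_space (iN D)"
      "x differentiable_on T" "\<theta> differentiable_on T" "v differentiable_on T"
      "vh differentiable_on T" "p differentiable_on T"
    and eq_x: "\<And>t i. t \<in> T \<Longrightarrow> i \<in> iN D \<Longrightarrow> deriv (\<lambda>s. x s $ i) t = v t $ i"
    and eq_theta: "\<And>t I. t \<in> T \<Longrightarrow> I \<in> iI D \<Longrightarrow> deriv (\<lambda>s. \<theta> s $ I) t =
        (\<Sum>J\<in>iI D. vh t $ J * induced D (Lco D I J) (x t) (\<theta> t))
        - (\<Sum>i\<in>iN D. deriv (\<lambda>s. x s $ i) t * induced D (Lam D I i) (x t) (\<theta> t))"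
    and eq_p_dot: "\<And>t i. t \<in> T \<Longrightarrow> i \<in> iN D \<Longrightarrow> deriv (\<lambda>s. p s $ i) t =
        pdiff i (\<lambda>y. red_routhian D y (\<theta> t) (v t) (vh t)) (x t)
        - (\<Sum>I\<in>iI D. induced D (Lam D I i) (x t) (\<theta> t) *
             pdiff I (\<lambda>\<eta>. red_routhian D (x t) \<eta> (v t) (vh t)) (\<theta> t))
        - (\<Sum>j\<in>iN D. induced D (muB D i j) (x t) (\<theta> t) * deriv (\<lambda>s. x s $ j) t)"
    and eq_p: "\<And>t i. t \<in> T \<Longrightarrow> i \<in> iN D \<Longrightarrow>
        p t $ i = pdiff i (\<lambda>u. red_routhian D (x t) (\<theta> t) u (vh t)) (v t)"
    and eq_vh: "\<And>t a. t \<in> T \<Longrightarrow> a \<in> iK D \<Longrightarrow>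
        pdiff a (\<lambda>w. red_routhian D (x t) (\<theta> t) (v t) w) (vh t) = 0"
  shows "reduced_implicit_LR D T x \<theta> v vh p"
  unfolding reduced_implicit_LR_def
proof
  interpret routh D
    by unfold_locales (fact indices G(1) Q action(1) lagrangian connection mu basis local_triv
        fibre_coords)+
  let ?I = "cmap (xth D) ` cdom (xth D)"
  fix t0 assume t0: "t0 \<in> T"
  have xN: "x t \<in> coord_space (iN D)" and \<theta>I: "\<theta> t \<in> coord_space (iI D)" if t: "t \<in> T" for t
  proof -
    obtain q where q: "over D (x t) (\<theta> t) q" using curve(1)[OF t] by (auto simp: patch_def)
    then have "proj (iN D) (cmap (xth D) q) = x t" "proj (iI D) (cmap (xth D) q) = \<theta> t"
        by (simp_all add: over_iff)
    then show "x t \<in> coord_space (iN D)" "\<theta> t \<in> coord_space (iI D)" by (metis proj_in_coord_space)+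
  qed
  obtain q0 where q0: "over D (x t0) (\<theta> t0) q0" using curve(1)[OF t0] by (auto simp: patch_def)
  \<comment> \<open>The \<theta>^A-coordinates of an arbitrary point above the curve at
    \<open>t0\<close> serve as the free initial value of the reconstruction.\<close>
  define z0 where "z0 = cmap (xth D) q0"
  \<comment> \<open>The supports of \<open>v\<close> and \<open>vh\<close> are disjoint, so their
    sum is the full vector of quasi-velocities, from which both can be recovered.\<close>
  define u where "u = (\<lambda>t. v t + vh t)"
  have split: "w = proj (iN D) w + proj (iI D) w + proj (iA D) w" for w :: "real ^ 'm"
    using indices by (auto simp: vec_eq_iff)
  have z0: "z0 \<in> ?I" "z0 = (x t0 + \<theta> t0) + proj (iA D) z0"
    using q0 split[of z0] by (simp_all add: over_iff z0_def)
  have contT: "continuous_on T (\<lambda>t. x t + \<theta> t)" "continuous_on T u" unfolding u_def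
    by (intro continuous_intros differentiable_imp_continuous_on curve)+
  obtain d \<zeta> where d: "d > 0" "{t0 - d<..<t0 + d} \<subseteq> T"
    and \<zeta>: "\<And>t. t \<in> {t0 - d<..<t0 + d} \<Longrightarrow> \<zeta> t \<in> coord_space (iA D)"
      "\<And>t. t \<in> {t0 - d<..<t0 + d} \<Longrightarrow> (x t + \<theta> t) + \<zeta> t \<in> ?I"
      "\<And>t. t \<in> {t0 - d<..<t0 + d} \<Longrightarrow> (\<zeta> has_vector_derivative
        proj (iA D) (lcomb (u t) (frame_hat D (cinv (xth D) ((x t + \<theta> t) + \<zeta> t))) (xth D))) (at t)"
    using reconstruction[OF times(1) t0 contT z0] by blast
  define T0 where "T0 = {t0 - d<..<t0 + d}"
  note \<zeta> = \<zeta>[folded T0_def]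
  have T0: "open T0" "t0 \<in> T0" "T0 \<subseteq> T" using d by (auto simp: T0_def)
  have inT: "t \<in> T" if "t \<in> T0" for t using T0(3) that by blast
  define z where "z = (\<lambda>t. (x t + \<theta> t) + \<zeta> t)"
  define qc where "qc = (\<lambda>t. cinv (xth D) (z t))"
  have qcz: "cinv (xth D) (z s) = qc s" for s by (simp add: qc_def)
  define vc where "vc = (\<lambda>t. lcomb (u t) (frame_hat D (qc t)))"
  define pc where "pc = (\<lambda>t. covector (qc t) (p t))"
  have ev: "\<forall>\<^sub>F s in nhds t. s \<in> T0" if "t \<in> T0" for t by (rule eventually_nhds_in_open[OF T0(1) that])
  have zI: "z t \<in> ?I" and q: "qc t \<in> cdom (xth D)" and cq: "cmap (xth D) (qc t) = z t" if "t \<in> T0" for t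
    using \<zeta>(2)[OF that] cinv_xth_image by (simp_all add: z_def qc_def)
  have projz: "proj (iN D) (z t) = x t" "proj (iI D) (z t) = \<theta> t" if t: "t \<in> T0" for t
    using xN[OF inT[OF t]] \<theta>I[OF inT[OF t]] \<zeta>(1)[OF t] indices(2-4)
    by (simp_all add: z_def proj_add proj_disjoint[of _ "iN D"] proj_disjoint[of _ "iA D"]
        proj_disjoint[of _ "iI D"] Int_commute)
  have over: "over D (x t) (\<theta> t) (qc t)" if t: "t \<in> T0" for t
    using over_cinv[OF zI[OF t]] by (simp add: projz[OF t] qc_def)
  have vN: "v t $ \<alpha> = (if \<alpha> \<in> iN D then u t $ \<alpha> else 0)" "vh t $ \<alpha> = (if \<alpha> \<in> iK D then u t $ \<alpha> else 0)"
    if t: "t \<in> T0" for t \<alpha>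
    using curve(2,3)[OF inT[OF t]] by (auto simp: u_def coord_space_def iN_iK)
  have Lam_ind: "induced D (Lam D I i) (x t) (\<theta> t) = Lam D I i (qc t)"
    if "t \<in> T0" "I \<in> iI D" "i \<in> iN D" for t I i
    unfolding induced_def using that by (intro induced_eq[OF over] Lam_act)
  have Lco_ind: "induced D (Lco D I J) (x t) (\<theta> t) = Lco D I J (qc t)"
    if "t \<in> T0" "I \<in> iI D" "J \<in> iI D" for t I J
    unfolding induced_def using that by (intro induced_eq[OF over] Lco_act) (auto simp: iK_def)
  have muB_ind: "induced D (muB D i j) (x t) (\<theta> t) = muB D i j (qc t)"
    if "t \<in> T0" "i \<in> iN D" "j \<in> iN D" for t i j
    unfolding induced_def using that by (intro induced_eq[OF over] muB_act)
  have vcTQ: "vc t \<in> TQ D (qc t)" if "t \<in> T0" for t unfolding vc_def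
      by (rule lcomb_hat_TQ[OF q[OF that]])
  have comps: "comps (frame_hat D (qc t)) (vc t) = u t" if "t \<in> T0" for t
    unfolding vc_def by (rule comps_hat(2)[OF q[OF that]])

  \<comment> \<open>The three blocks of components have different sources: those in
    \<open>iN\<close> come from \<open>eq_x\<close>, those in \<open>iI\<close> from
    \<open>eq_theta\<close> with the coefficients moved to the lift, and those in \<open>iA\<close>
    from the differential equation that was solved.\<close>
  have zder: "(z has_vector_derivative vc t (xth D)) (at t)" if t: "t \<in> T0" for t
  proof -
    obtain x' where x': "(x has_vector_derivative x') (at t)" "x' \<in> coord_space (iN D)" "\<And>i. deriv (\<lambda>s.
        x s $ i) t = x' $ i"
      using has_vector_derivative_coord_space[OF times(1) inT[OF t] xN curve(5)] by metis
    obtain \<theta>' where \<theta>': "(\<theta> has_vector_derivative \<theta>') (at t)" "\<theta>' \<in> coord_space (iI D)" "\<And>i. deriv (\<lambda>s.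
        \<theta> s $ i) t = \<theta>' $ i"
      using has_vector_derivative_coord_space[OF times(1) inT[OF t] \<theta>I curve(6)] by metis
    have vct: "vc t = lcomb (u t) (frame_hat D (cinv (xth D) ((x t + \<theta> t) + \<zeta> t)))"
      by (simp add: vc_def qc_def z_def)
    have 1: "(z has_vector_derivative (x' + \<theta>') + proj (iA D) (vc t (xth D))) (at t)"
      unfolding z_def vct by (intro has_vector_derivative_add x'(1) \<theta>'(1) \<zeta>(3) t)
    have "x' = proj (iN D) (vc t (xth D))"
    proof -
      have "x' $ i = v t $ i" if "i \<in> iN D" for i using eq_x[OF inT[OF t] that] x'(3) by simp
      then have "x' = v t" using x'(2) curve(2)[OF inT[OF t]]
          by (simp add: vec_eq_iff coord_space_def) metis
      then show ?thesis using vN(1)[OF t] hat_dx[OF q[OF t], of "u t"] by (simp add: vc_def vec_eq_iff)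
    qed
    moreover have "\<theta>' = proj (iI D) (vc t (xth D))"
    proof -
      have "\<theta>' $ I = vc t (xth D) $ I" if I: "I \<in> iI D" for I
      proof -
        have "vc t (xth D) $ I = (\<Sum>J\<in>iI D. vh t $ J * Lco D I J (qc t)) - (\<Sum>i\<in>iN D. v t $ i * Lam D I i
            (qc t))"
          unfolding vc_def u_def
          by (rule hat_xth_component[OF q[OF t] I curve(2)[OF inT[OF t]] curve(3)[OF inT[OF t]] L_IA[OF
              q[OF t] _ I]])
        moreover have "\<theta>' $ I = (\<Sum>J\<in>iI D. vh t $ J * Lco D I J (qc t)) - (\<Sum>i\<in>iN D. v t $ i * Lam D I i
            (qc t))"
          using eq_theta[OF inT[OF t] I] eq_x[OF inT[OF t]] Lam_ind[OF t I] Lco_ind[OF t I]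
              by (simp add: \<theta>'(3)[symmetric])
        ultimately show ?thesis by simp
      qed
      then show ?thesis using \<theta>'(2) by (auto simp: vec_eq_iff coord_space_def)
    qed
    ultimately show ?thesis using 1 split[of "vc t (xth D)"] by simp
  qed
  have zdiff: "z differentiable (at t)" if "t \<in> T0" for t
      by (rule differentiableI_vector[OF zder[OF that]])
  have zcont: "continuous_on T0 z"
    by (intro continuous_at_imp_continuous_on ballI differentiable_imp_continuous_within zdiff)
  have "continuous_on T0 qc" unfolding qc_def
    by (rule continuous_on_compose2[OF is_chart_continuous_inv[OF manifold_is_chart[OF Q xth_atQ]]
        zcont])
      (use zI in blast)
  then have qcont: "isCont qc t" if "t \<in> T0" for t
    using that T0(1) by (simp add: continuous_on_eq_continuous_at)
  have velocity: "velocity (atQ D) qc t = vc t" if t: "t \<in> T0" for t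
  proof -
    have "((\<lambda>s. cmap (xth D) (qc s)) has_vector_derivative vc t (xth D)) (at t)"
      unfolding has_vector_derivative_def
      by (rule has_derivative_transform_within_open[OF zder[OF t, unfolded has_vector_derivative_def]
          T0(1) t])
        (simp add: cq)
    from velocity_eq[OF Q xth_atQ q[OF t] qcont[OF t] this]
    show ?thesis using tspace_eq_coord_vec[OF mQ xth_atQ q[OF t] vcTQ[OF t, unfolded TQ_tspace]] by simp
  qed
  have diff: "differentiable_curve D qc vc pc t" if t: "t \<in> T0" for t
  proof -
    have at: "f differentiable (at t)" if "f differentiable_on T" for f :: "real \<Rightarrow> real ^ 'm"
      using that times(1) inT[OF t] by (simp add: differentiable_on_eq_differentiable_at)
    have "(cmap (xth D) \<circ> qc) differentiable (at t)"
      by (rule differentiable_transform_nhds[OF zdiff[OF t] eventually_mono[OF ev[OF t]]]) (simp add: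
          cq)
    moreover have "(\<lambda>s. vc s (xth D)) differentiable (at t)"
    proof (rule differentiable_transform_nhds)
      \<comment> \<open>The fibre component in this chart is a C^1 function composed with the
        differentiable curve of coordinates and quasi-velocities.\<close>
      let ?G = "\<lambda>x. \<Sum>\<alpha>\<in>UNIV. (snd x $ \<alpha>) *\<^sub>R field_rep (\<lambda>q. frame_hat D q \<alpha>) (xth D) (fst x)"
      have "?G differentiable (at (z t, u t))"
        by (rule C1_on_differentiable[OF frame_field_C1]) (use zI[OF t] in simp)
      moreover have "(\<lambda>s. (z s, u s)) differentiable (at t)"
        unfolding u_def by (intro differentiable_Pair zdiff[OF t] differentiable_add at curve(7,8))
      ultimately show "(\<lambda>s. ?G (z s, u s)) differentiable (at t)"
        using differentiable_chain_at[where f = "\<lambda>s. (z s, u s)" and g = ?G and x = t]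
            by (simp add: o_def)
      show "\<forall>\<^sub>F s in nhds t. ?G (z s, u s) = vc s (xth D)"
        by (simp add: vc_def lcomb_def field_rep_def qc_def)
    qed
    \<comment> \<open>In a fixed coordinate direction the covector depends on time only through
      connection coefficients along \<open>z\<close> and through the components of
      \<open>p\<close>.\<close>
    moreover have "(\<lambda>s. pc s (coord_vec (atQ D) (xth D) (qc s) e)) differentiable (at t)" for e
    proof (rule differentiable_transform_nhds)
      let ?m = "\<lambda>b y. mu_kap (conn D (cinv (xth D) y) (coord_vec (atQ D) (xth D) (cinv (xth D) y) b)
          kap)"
      have m: "(\<lambda>s. ?m b (z s)) differentiable (at t)" for b
        using differentiable_chain_at[where f = z and g = "?m b"
            and x = t, OF zdiff[OF t] mu_conn_differentiable[OF xth_atQ zI[OF t]]]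
        by (simp add: o_def)
      have pi: "(\<lambda>s. p s $ i) differentiable (at t)" for i
        using differentiable_chain_at[OF at[OF curve(9)] bounded_linear_imp_differentiable[OF
            bounded_linear_vec_nth]]
        by (simp add: o_def)
      show "(\<lambda>s. (\<Sum>b\<in>Basis. (e \<bullet> b) * ?m b (z s)) + (\<Sum>i\<in>iN D. p s $ i * e $ i)) differentiable (at t)"
        by (intro differentiable_add differentiable_sum differentiable_mult m pi differentiable_const
            ballI) simp_all
      show "\<forall>\<^sub>F s in nhds t. (\<Sum>b\<in>Basis. (e \<bullet> b) * ?m b (z s)) + (\<Sum>i\<in>iN D. p s $ i * e $ i) =
          pc s (coord_vec (atQ D) (xth D) (qc s) e)"
        by (rule eventually_mono[OF ev[OF t]]) (simp add: pc_def covector_coord_vec[OF q] qcz)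
    qed
    ultimately show ?thesis unfolding differentiable_curve_def
      using qcont[OF t] xth_atQ q[OF t] by blast
  qed
  have vert: "vertical_lift (atQ D) (\<lambda>q. frame_hat D q \<alpha>) (routhian D) (qc t) (vc t) =
      deriv (\<lambda>s. rho (qc t) (u t + s *\<^sub>R axis \<alpha> 1)) 0" if t: "t \<in> T0" for t \<alpha>
    using DERIV_imp_deriv[OF rho_vertical[OF q[OF t], of "u t" \<alpha>]] by (simp add: vc_def)
  \<comment> \<open>\<open>red_routhian\<close> depends on its last two arguments only through their
    sum, so a partial derivative in either of them is the derivative of \<open>rho\<close> in one
    quasi-velocity.\<close>
  have vertE: "vertical_lift (atQ D) (\<lambda>q. frame_hat D q a) (routhian D) (qc t) (vc t) = 0"
    if t: "t \<in> T0" and a: "a \<in> iK D" for t a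
    using eq_vh[OF inT[OF t] a] unfolding vert[OF t] pdiff_def red_routhian_eq[OF over[OF t]]
    by (simp add: u_def add.assoc)
  have vertX: "vertical_lift (atQ D) (Xh D i) (routhian D) (qc t) (vc t) = p t $ i"
    if t: "t \<in> T0" and i: "i \<in> iN D" for t i
  proof -
    have "(\<lambda>q. frame_hat D q i) = Xh D i" using i by (simp add: frame_hat_field)
    then show ?thesis
      using eq_p[OF inT[OF t] i] vert[OF t, of i] unfolding pdiff_def red_routhian_eq[OF over[OF t]]
      by (simp add: u_def algebra_simps)
  qed
  \<comment> \<open>On horizontal lifts the covector returns the components of the given
    \<open>p\<close>, whose derivative is prescribed by \<open>eq_p_dot\<close>. The vertical
    equations just obtained allow the complete lift to be rewritten in partial derivatives, and
    \<open>eq_x\<close> replaces the derivative of x^j by v^j.\<close>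
  have pdot: "((\<lambda>s. pc s (Xh D i (qc s))) has_real_derivative
         complete_lift (atQ D) (Xh D i) (routhian D) (qc t) (vc t)
         - (\<Sum>j\<in>iN D. muB D i j (qc t) * comps (frame_hat D (qc t)) (vc t) $ j)) (at t)"
    if t: "t \<in> T0" and i: "i \<in> iN D" for t i
  proof (rule DERIV_eventually)
    obtain p' where p': "(p has_vector_derivative p') (at t)" "\<And>i. deriv (\<lambda>s. p s $ i) t = p' $ i"
      using has_vector_derivative_coord_space[OF times(1) inT[OF t] curve(4,9)] by metis
    have "complete_lift (atQ D) (Xh D i) (routhian D) (qc t) (vc t) =
      pdiff i (\<lambda>y. red_routhian D y (\<theta> t) (v t) (vh t)) (x t)
      - (\<Sum>I\<in>iI D. Lam D I i (qc t) * pdiff I (\<lambda>\<eta>. red_routhian D (x t) \<eta> (v t) (vh t)) (\<theta> t))"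
      using complete_lift_Xh_routhian[OF over[OF t] i, of "v t" "vh t"] vertE[OF t]
          by (simp add: vc_def u_def)
    moreover have "(\<Sum>j\<in>iN D. muB D i j (qc t) * comps (frame_hat D (qc t)) (vc t) $ j) =
      (\<Sum>j\<in>iN D. muB D i j (qc t) * v t $ j)"
      by (simp add: comps[OF t] vN[OF t])
    ultimately have "p' $ i = complete_lift (atQ D) (Xh D i) (routhian D) (qc t) (vc t)
         - (\<Sum>j\<in>iN D. muB D i j (qc t) * comps (frame_hat D (qc t)) (vc t) $ j)"
      using eq_p_dot[OF inT[OF t] i] eq_x[OF inT[OF t]] Lam_ind[OF t _ i] muB_ind[OF t i]
          by (simp add: p'(2)[symmetric])
    with bounded_linear.has_vector_derivative[OF bounded_linear_vec_nth p'(1), of i]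
    show "((\<lambda>s. p s $ i) has_real_derivative
         complete_lift (atQ D) (Xh D i) (routhian D) (qc t) (vc t)
         - (\<Sum>j\<in>iN D. muB D i j (qc t) * comps (frame_hat D (qc t)) (vc t) $ j)) (at t)"
      by (simp add: has_real_derivative_iff_has_vector_derivative)
    show "\<forall>\<^sub>F s in nhds t. p s $ i = pc s (Xh D i (qc s))"
      by (rule eventually_mono[OF ev[OF t]]) (simp add: pc_def covector_Xh[OF q i])
  qed
  have "implicit_LR D T0 qc vc pc" unfolding implicit_LR_def
  proof (intro ballI conjI)
    fix t assume t: "t \<in> T0"
    show "qc t \<in> QU D" using q[OF t] by (simp add: cdom_xth)
    show "(qc t, vc t, pc t) \<in> Mmu D"
      using vcTQ[OF t] covector_functional covector_fund[OF q[OF t]]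
          by (simp add: Mmu_def momentum_def pc_def)
    show "differentiable_curve D qc vc pc t" by (rule diff[OF t])
    show "vertical_lift (atQ D) (Ehat D a) (routhian D) (qc t) (vc t) = 0" if a: "a \<in> iK D" for a
      using vertE[OF t a] a by (simp add: frame_hat_field iN_iK)
    show "vertical_lift (atQ D) (Xh D i) (routhian D) (qc t) (vc t) = pc t (Xh D i (qc t))"
        if "i \<in> iN D" for i
      using vertX[OF t that] covector_Xh[OF q[OF t] that] by (simp add: pc_def)
  qed (simp_all add: velocity pdot)
  moreover have "projects D (qc t) (vc t) (pc t) (x t) (\<theta> t) (v t) (vh t) (p t)" if t: "t \<in> T0" for t
    unfolding projects_def using over[OF t] covector_Xh[OF q[OF t]]
        by (simp add: comps[OF t] vN[OF t] pc_def)
  ultimately show "\<exists>T0 qc vc pc. open T0 \<and> t0 \<in> T0 \<and> T0 \<subseteq> T \<and> implicit_LR D T0 qc vc pc \<and>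
     (\<forall>t\<in>T0. projects D (qc t) (vc t) (pc t) (x t) (\<theta> t) (v t) (vh t) (p t))"
    using T0 by blast
qed

end
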